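(* Let $r\ge 2$ and $d\ge 3$ be integers, let $N:=\binom{r+d}{r}-1$, and let $t$ be a positive integer with $t<3d/2$. Let $P\in\mathbb{P}^N$ be a point with symmetric tensor rank $sr(P)=t$. Then the set $\mathcal{S}(P)$ is not a single point if and only if $P$ may be described in one of the following ways: (a) for any $A\in\mathcal{S}(P)$, there is a line $D\subset\mathbb{P}^r$ such that $\sharp(A\cap D)\ge\lceil(d+2)/2\rceil$ and, setting $F:=A\setminus(A\cap D)$, the following hold: the set $\langle\nu_d(A\cap D)\rangle\cap\langle\{P\}\cup\nu_d(F)\rangle$ is formed by a unique point $P_D$; $\mathcal{S}(P_D)$ is infinite; and for each $E\in\mathcal{S}(P_D)$ we have $E\cap F=\emptyset$ and $E\cup F\in\mathcal{S}(P)$. (b) for any $A\in\mathcal{S}(P)$, there is a smooth conic $T\subset\mathbb{P}^r$ such that $\sharp(A\cap T)\ge d+1$ and, setting $F:=A\setminus(A\cap T)$, the following hold: the set $\langle\nu_d(A\cap T)\rangle\cap\langle\{P\}\cup\nu_d(F)\rangle$ is formed by a unique point $P_T$; $\mathcal{S}(P_T)$ is infinite; for each $E\in\mathcal{S}(P_T)$ we have $E\cap F=\emptyset$; and every element of $\mathcal{S}(P)$ is of the form $E'\cup F$ for some $E'\subset T$ computing $sr(P_T)$ with respect to the rational normal curve $\nu_d(T)$. (c) $d$ is odd, and for any $A\in\mathcal{S}(P)$ there is a reducible conic $T=L_1\cup L_2\subset\mathbb{P}^r$, with $L_1\neq L_2$ lines, such that $\sharp(A\cap L_1)=\sharp(A\cap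 L_2)=(d+1)/2$ and $L_1\cap L_2\notin A$ (i.e. the intersection point of $L_1$ and $L_2$ does not belong to $A$).
   Context: Work over an algebraically closed field $\mathbb{K}$ of characteristic $0$. Let $\nu_d:\mathbb{P}^r\to\mathbb{P}^N$, $N=\binom{r+d}{r}-1$, be the degree $d$ Veronese embedding, and let $X_{r,d}:=\nu_d(\mathbb{P}^r)$. The symbol $\langle\ \rangle$ denotes linear span in projective space. For $Q\in\mathbb{P}^N$, the symmetric (tensor) rank $sr(Q)$ is the minimal cardinality of a finite set $S\subset X_{r,d}$ such that $Q\in\langle S\rangle$. The set $\mathcal{S}(Q)$ is the set of all finite subsets $A\subset\mathbb{P}^r$ such that $\nu_d(A)$ computes $sr(Q)$, i.e. $Q\in\langle\nu_d(A)\rangle$ and $\sharp(A)=sr(Q)$. A conic in $\mathbb{P}^r$ means a plane conic, i.e. a degree $2$ curve contained in a plane of $\mathbb{P}^r$; a reducible conic $L_1\cup L_2$ is the union of two distinct coplanar lines. For a smooth conic $T\subset\mathbb{P}^r$, $\nu_d(T)$ is a rational normal curve of degree $2d$ in its linear span; for $Q\in\langle\nu_d(T)\rangle$, the rank of $Q$ with respect to $\nu_d(T)$ is the minimal cardinality of a finite subset of $\nu_d(T)$ whose linear span contains $Q$, and a finite set $E'\subset T$ computes it if $\sharp(E')$ equals this rank and $Q\in\langle\nu_d(E')\rangle$. *)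

theory Defs
  imports Complex_Main "HOL-Computational_Algebra.Polynomial" "HOL-Library.Function_Algebras"
begin

definition fun_scale :: "'a::field \<Rightarrow> ('i \<Rightarrow> 'a) \<Rightarrow> 'i \<Rightarrow> 'a" where
  "fun_scale c x = (\<lambda>i. c * x i)"

interpretation fun_space: vector_space "fun_scale :: 'a::field \<Rightarrow> ('i \<Rightarrow> 'a) \<Rightarrow> 'i \<Rightarrow> 'a"
  by unfold_locales (auto simp: fun_scale_def fun_eq_iff algebra_simps)

(* Since r and d are variables, coordinate spaces are indexed by finite sets I and not by types:
   K^I consists of the functions that vanish outside I. *)
definition coord_space :: "'i set \<Rightarrow> ('i \<Rightarrow> 'a::field) set" where
  "coord_space I = {x. \<forall>i. i \<notin> I \<longrightarrow> x i = 0}"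

(* A point of a projective space is the corresponding one-dimensional subspace. *)
definition proj_point :: "('i \<Rightarrow> 'a::field) set \<Rightarrow> bool" where
  "proj_point p \<longleftrightarrow> fun_space.subspace p \<and> fun_space.dim p = 1"

definition proj_space :: "'i set \<Rightarrow> ('i \<Rightarrow> 'a::field) set set" where
  "proj_space I = {p. proj_point p \<and> p \<subseteq> coord_space I}"

definition proj_span :: "('i \<Rightarrow> 'a::field) set set \<Rightarrow> ('i \<Rightarrow> 'a) set set" where
  "proj_span S = {p. proj_point p \<and> p \<subseteq> fun_space.span (\<Union>S)}"

(* The k-dimensional linear subvarieties of the projective space over I. *)
definition proj_subspace :: "'i set \<Rightarrow> nat \<Rightarrow> ('i \<Rightarrow> 'a::field) set set \<Rightarrow> bool" where
  "proj_subspace I k D \<longleftrightarrow>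
     (\<exists>W. fun_space.subspace W \<and> W \<subseteq> coord_space I \<and> fun_space.dim W = k + 1 \<and>
          D = {p \<in> proj_space I. p \<subseteq> W})"

abbreviation Pr :: "nat \<Rightarrow> (nat \<Rightarrow> 'a::field) set set" where
  "Pr r \<equiv> proj_space {..r}"

abbreviation is_line :: "nat \<Rightarrow> (nat \<Rightarrow> 'a::field) set set \<Rightarrow> bool" where
  "is_line r \<equiv> proj_subspace {..r} 1"

abbreviation is_plane :: "nat \<Rightarrow> (nat \<Rightarrow> 'a::field) set set \<Rightarrow> bool" where
  "is_plane r \<equiv> proj_subspace {..r} 2"

(* Exponent vectors of the monomials of degree d in x_0, ..., x_r.  They serve as the N + 1
   homogeneous coordinate indices of the target of the Veronese embedding. *)
definition monomials :: "nat \<Rightarrow> nat \<Rightarrow> (nat \<Rightarrow> nat) set" where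
  "monomials r d = {\<alpha>. (\<forall>i>r. \<alpha> i = 0) \<and> (\<Sum>i\<le>r. \<alpha> i) = d}"

lemma card_monomials: "card (monomials r d) = (r + d) choose r"
proof -
  let ?L = "{l::nat list. size l = Suc r \<and> sum_list l = d}"
  let ?f = "\<lambda>\<alpha>::nat \<Rightarrow> nat. map \<alpha> [0..<Suc r]"
  let ?g = "\<lambda>(l::nat list) i. if i \<le> r then l ! i else 0"
  have "bij_betw ?f (monomials r d) ?L"
  proof (rule bij_betw_byWitness[where f' = ?g])
    show "\<forall>\<alpha>\<in>monomials r d. ?g (?f \<alpha>) = \<alpha>"
      by (auto simp: monomials_def fun_eq_iff simp del: upt_Suc)
    show "\<forall>l\<in>?L. ?f (?g l) = l"
      by (auto intro!: nth_equalityI simp del: upt_Suc)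
    show "?f ` monomials r d \<subseteq> ?L"
      by (auto simp: monomials_def interv_sum_list_conv_sum_set_nat atLeast0AtMost
            atLeastLessThanSuc_atLeastAtMost simp del: upt_Suc)
    show "?g ` ?L \<subseteq> monomials r d"
    proof clarify
      fix l :: "nat list" assume "size l = Suc r"
      then have "sum_list l = (\<Sum>i\<le>r. l ! i)"
        by (simp add: sum_list_sum_nth atLeast0LessThan lessThan_Suc_atMost)
      then show "?g l \<in> monomials r (sum_list l)"
        by (auto simp: monomials_def)
    qed
  qed
  then have "card (monomials r d) = card ?L"
    by (rule bij_betw_same_card)
  also have "\<dots> = (d + r) choose d"
    by (simp add: card_length_sum_list)
  also have "\<dots> = (r + d) choose r"
    using binomial_symmetric[of r "r + d"] by (simp add: add.commute)
  finally show ?thesis .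
qed

abbreviation PN :: "nat \<Rightarrow> nat \<Rightarrow> ((nat \<Rightarrow> nat) \<Rightarrow> 'a::field) set set" where
  "PN r d \<equiv> proj_space (monomials r d)"

definition veronese_vec ::
    "nat \<Rightarrow> nat \<Rightarrow> (nat \<Rightarrow> 'a::field) \<Rightarrow> (nat \<Rightarrow> nat) \<Rightarrow> 'a" where
  "veronese_vec r d x = (\<lambda>\<alpha>. if \<alpha> \<in> monomials r d then \<Prod>i\<le>r. x i ^ \<alpha> i else 0)"

(* The image of the line p under veronese_vec consists of the multiples by d-th powers of one
   nonzero vector, so its span is the image point, with no choice of a representative of p. *)
definition veronese ::
    "nat \<Rightarrow> nat \<Rightarrow> (nat \<Rightarrow> 'a::field) set \<Rightarrow> ((nat \<Rightarrow> nat) \<Rightarrow> 'a) set" where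
  "veronese r d p = fun_space.span (veronese_vec r d ` p)"

lemma veronese_vec_scale:
  "veronese_vec r d (fun_scale c x) = fun_scale (c ^ d) (veronese_vec r d x)"
proof
  fix \<alpha>
  show "veronese_vec r d (fun_scale c x) \<alpha> = fun_scale (c ^ d) (veronese_vec r d x) \<alpha>"
    by (auto simp: veronese_vec_def fun_scale_def monomials_def power_mult_distrib
        prod.distrib simp flip: power_sum)
qed

lemma veronese_vec_nonzero:
  assumes "x \<in> coord_space {..r}" "x \<noteq> 0"
  shows "veronese_vec r d x \<noteq> 0"
proof -
  obtain j where j: "j \<le> r" "x j \<noteq> 0"
    using assms by (force simp: coord_space_def fun_eq_iff)
  define \<alpha> where "\<alpha> = (\<lambda>i. if i = j then d else 0)"
  have "\<alpha> \<in> monomials r d"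
    using j by (auto simp: monomials_def \<alpha>_def)
  moreover have "(\<Prod>i\<le>r. x i ^ \<alpha> i) \<noteq> 0"
    using j by (auto simp: \<alpha>_def)
  ultimately have "veronese_vec r d x \<alpha> \<noteq> 0"
    by (simp add: veronese_vec_def)
  then show ?thesis by auto
qed

lemma proj_point_iff: "proj_point p \<longleftrightarrow> (\<exists>x. x \<noteq> 0 \<and> p = fun_space.span {x})"
proof
  assume p: "proj_point p"
  obtain B where B: "B \<subseteq> p" "\<not> fun_space.dependent B" "p \<subseteq> fun_space.span B"
      "card B = fun_space.dim p"
    by (rule fun_space.basis_exists)
  with p obtain x where "B = {x}"
    by (auto simp: proj_point_def card_1_singleton_iff)
  with B p show "\<exists>x. x \<noteq> 0 \<and> p = fun_space.span {x}"
    by (metis fun_space.dependent_single fun_space.span_minimal proj_point_def subset_antisym)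
next
  assume "\<exists>x. x \<noteq> 0 \<and> p = fun_space.span {x}"
  then obtain x where "x \<noteq> 0" "p = fun_space.span {x}" by auto
  then show "proj_point p"
    by (simp add: proj_point_def fun_space.dim_eq_card_independent fun_space.dependent_single)
qed

lemma veronese_in_PN:
  assumes "p \<in> Pr r"
  shows "veronese r d p \<in> PN r d"
proof -
  obtain x where x: "x \<noteq> 0" "p = fun_space.span {x}"
    using assms by (auto simp: proj_space_def proj_point_iff)
  then have "x \<in> p" by (simp add: fun_space.span_base)
  then have xV: "x \<in> coord_space {..r}"
    using assms by (auto simp: proj_space_def)
  let ?v = "veronese_vec r d x"
  have "fun_space.span (veronese_vec r d ` p) = fun_space.span {?v}"
  proof (rule fun_space.span_eq[THEN iffD2], intro conjI)
    show "veronese_vec r d ` p \<subseteq> fun_space.span {?v}"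
      using x by (auto simp: fun_space.span_singleton veronese_vec_scale)
    show "{?v} \<subseteq> fun_space.span (veronese_vec r d ` p)"
      using \<open>x \<in> p\<close> by (auto intro: fun_space.span_base)
  qed
  moreover have "fun_space.span {?v} \<subseteq> coord_space (monomials r d)"
    by (auto simp: fun_space.span_singleton fun_scale_def coord_space_def veronese_vec_def)
  ultimately show ?thesis
    using veronese_vec_nonzero[OF xV x(1), of d]
    unfolding proj_space_def proj_point_iff veronese_def by blast
qed

definition veronese_variety :: "nat \<Rightarrow> nat \<Rightarrow> ((nat \<Rightarrow> nat) \<Rightarrow> 'a::field) set set" where
  "veronese_variety r d = veronese r d ` Pr r"

definition rank_wrt :: "('i \<Rightarrow> 'a::field) set set \<Rightarrow> ('i \<Rightarrow> 'a) set \<Rightarrow> nat" where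
  "rank_wrt X Q = (LEAST n. \<exists>S. finite S \<and> S \<subseteq> X \<and> card S = n \<and> Q \<in> proj_span S)"

definition sr :: "nat \<Rightarrow> nat \<Rightarrow> ((nat \<Rightarrow> nat) \<Rightarrow> 'a::field) set \<Rightarrow> nat" where
  "sr r d Q = rank_wrt (veronese_variety r d) Q"

definition computing_sets ::
    "nat \<Rightarrow> nat \<Rightarrow> ((nat \<Rightarrow> nat) \<Rightarrow> 'a::field) set \<Rightarrow> (nat \<Rightarrow> 'a) set set set" where
  "computing_sets r d Q =
     {A. finite A \<and> A \<subseteq> Pr r \<and> Q \<in> proj_span (veronese r d ` A) \<and> card A = sr r d Q}"

definition computes_rank_on ::
    "nat \<Rightarrow> nat \<Rightarrow> (nat \<Rightarrow> 'a::field) set set \<Rightarrow> ((nat \<Rightarrow> nat) \<Rightarrow> 'a) set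
      \<Rightarrow> (nat \<Rightarrow> 'a) set set \<Rightarrow> bool" where
  "computes_rank_on r d T Q E \<longleftrightarrow>
     finite E \<and> E \<subseteq> T \<and> Q \<in> proj_span (veronese r d ` E) \<and>
     card E = rank_wrt (veronese r d ` T) Q"

definition quad_form :: "nat \<Rightarrow> (nat \<Rightarrow> nat \<Rightarrow> 'a::field) \<Rightarrow> (nat \<Rightarrow> 'a) \<Rightarrow> 'a" where
  "quad_form r a x = (\<Sum>i\<le>r. \<Sum>j\<le>r. a i j * x i * x j)"

(* The partial derivative of quad_form r a with respect to x_k; the matrix a need not be
   symmetric. *)
definition quad_form_deriv ::
    "nat \<Rightarrow> (nat \<Rightarrow> nat \<Rightarrow> 'a::field) \<Rightarrow> nat \<Rightarrow> (nat \<Rightarrow> 'a) \<Rightarrow> 'a" where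
  "quad_form_deriv r a k x = (\<Sum>j\<le>r. (a k j + a j k) * x j)"

(* A conic in the plane of W is cut out by a quadratic form on W, and every such form is the
   restriction of one on K^(r+1).  Smoothness is the Jacobian criterion inside the plane: at each
   point x of T some directional derivative along a vector of W is nonzero.  This also excludes
   forms that vanish identically on W, and double lines. *)
definition smooth_conic :: "nat \<Rightarrow> (nat \<Rightarrow> 'a::field) set set \<Rightarrow> bool" where
  "smooth_conic r T \<longleftrightarrow>
     (\<exists>W a. fun_space.subspace W \<and> W \<subseteq> coord_space {..r} \<and> fun_space.dim W = 3 \<and>
        T = {p \<in> Pr r. p \<subseteq> W \<and> (\<forall>x\<in>p. quad_form r a x = 0)} \<and>
        (\<forall>p\<in>T. \<forall>x\<in>p. x \<noteq> 0 \<longrightarrow>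
           (\<exists>w\<in>W. (\<Sum>k\<le>r. quad_form_deriv r a k x * w k) \<noteq> 0)))"

definition reducible_conic ::
    "nat \<Rightarrow> (nat \<Rightarrow> 'a::field) set set \<Rightarrow> (nat \<Rightarrow> 'a) set set \<Rightarrow> (nat \<Rightarrow> 'a) set set \<Rightarrow> bool" where
  "reducible_conic r T L1 L2 \<longleftrightarrow>
     is_line r L1 \<and> is_line r L2 \<and> L1 \<noteq> L2 \<and> T = L1 \<union> L2 \<and>
     (\<exists>M. is_plane r M \<and> T \<subseteq> M)"

end

theory Submission
  imports Defs
begin

text \<open>
  Let \<open>A\<close> and \<open>B\<close> be two different minimal decompositions of \<open>P\<close>. Their difference is a linear relation
  among the Veronese images of the points of \<open>A \<union> B\<close>. Its support \<open>Z\<close> contains the symmetric difference of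
  \<open>A\<close> and \<open>B\<close> and has fewer than \<open>3 d\<close> points. Multiplying the coefficients of such a relation by the values of a
  form of degree \<open>m\<close> gives a relation in degree \<open>d - m\<close> that is supported on the points where the form does not
  vanish (\<open>supports_residual\<close>). By removing lines and conics in this way one finds that \<open>Z\<close> lies on two lines or
  on a plane conic (\<open>supports_on_two_lines_or_conic\<close>), and so on two lines or on a smooth conic
  (\<open>relation_on_lines_or_smooth_conic\<close>). The hard case is a plane set without three collinear points. There the
  Hilbert function of \<open>Z\<close> either grows by three in each degree, which needs \<open>3 d\<close> points, or it slows down, and
  then a determinant of linear syzygies is a conic through many points of \<open>Z\<close> (\<open>slow_growth_conic\<close>).

  The two decompositions agree off the curve that contains \<open>Z\<close> and have equally many points on it. Counting
  gives three patterns for a decomposition: a line with at least \<open>(d + 2) / 2\<close> of its points, a smooth conic with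
  at least \<open>d + 1\<close> of them, or two coplanar lines with \<open>(d + 1) / 2\<close> points each and none at the intersection. The
  theorem asks for the same pattern in all decompositions. A rich line in one of them forces a rich line in
  every other (\<open>poor_transfer\<close>). If there are no rich lines and \<open>d \<ge> 4\<close>, a smooth conic is determined by five of the
  points that it shares with a decomposition, so it is the same for all of them (\<open>smooth_conic_rigid\<close>). If
  \<open>d = 3\<close> and there are no rich lines, four points on a smooth conic also form the third pattern.

  Conversely, in each pattern the points on the curve can be exchanged in infinitely many ways. A line and a
  smooth conic are rational curves, on which forms of degree \<open>d\<close> become polynomials of degree \<open>n = d\<close> or
  \<open>n = 2 d\<close>. If \<open>k\<close> points decompose a functional on these and \<open>2 k \<ge> n + 2\<close>, then a whole pencil of polynomials of
  degree \<open>k\<close> is apolar to the functional. Almost all of its members have simple roots, and these roots are again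
  decompositions (\<open>infinitely_many_decompositions\<close>). On two lines the same pencil arises after a multiple of the
  common point has been moved from one line to the other (\<open>infinitely_many_on_two_lines\<close>). Minimality makes the
  exchange on the curve compatible with the other points of the decomposition (\<open>part_exchange\<close>).
\<close>

section \<open>Homogeneous forms\<close>

abbreviation lspan :: "('i \<Rightarrow> 'a::field) set \<Rightarrow> ('i \<Rightarrow> 'a) set" where
  "lspan \<equiv> fun_space.span"

abbreviation ambient :: "nat \<Rightarrow> (nat \<Rightarrow> 'a::field) set" where
  "ambient r \<equiv> coord_space {..r}"

text \<open>Gaussian elimination: an equation with a nonzero coefficient at the unknown \<open>p\<close> is solved for that
unknown, and the induction hypothesis applies to the other equations with \<open>p\<close> eliminated.\<close>

lemma nonzero_solution_underdetermined:
  fixes a :: "'i \<Rightarrow> 'j \<Rightarrow> 'a::field"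
  assumes "finite I" "finite J" "card I < card J"
  shows "\<exists>x. (\<exists>j\<in>J. x j \<noteq> 0) \<and> (\<forall>i\<in>I. (\<Sum>j\<in>J. a i j * x j) = 0)"
  using assms
proof (induction I arbitrary: J a rule: finite_induct)
  case empty
  then obtain j where "j \<in> J" by fastforce
  then show ?case by (intro exI[of _ "\<lambda>_. 1"]) auto
next
  case (insert k I J a)
  show ?case
  proof (cases "\<forall>j\<in>J. a k j = 0")
    case True
    have "card I < card J" using insert by simp
    then obtain x where "\<exists>j\<in>J. x j \<noteq> 0" "\<forall>i\<in>I. (\<Sum>j\<in>J. a i j * x j) = 0"
      using insert.IH[of J a] insert.prems by blast
    with True show ?thesis by (intro exI[of _ x]) auto
  next
    case False
    then obtain p where p: "p \<in> J" "a k p \<noteq> 0" by auto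
    define b where "b i j = a i j - a i p * a k j / a k p" for i j
    have fin: "finite (J - {p})" and card: "card I < card (J - {p})"
      using insert p by auto
    obtain x where x: "\<exists>j\<in>J-{p}. x j \<noteq> 0" "\<forall>i\<in>I. (\<Sum>j\<in>J-{p}. b i j * x j) = 0"
      using insert.IH[OF fin card, of b] by blast
    define y where "y = x(p := - (\<Sum>j\<in>J-{p}. a k j * x j) / a k p)"
    have split: "(\<Sum>j\<in>J. a i j * y j) = a i p * y p + (\<Sum>j\<in>J-{p}. a i j * x j)" for i
      using p insert.prems by (simp add: sum.remove[of J p] y_def)
    have "(\<Sum>j\<in>J. a k j * y j) = 0"
      unfolding split using p by (simp add: y_def)
    moreover have "(\<Sum>j\<in>J. a i j * y j) = 0" if "i \<in> I" for i
    proof -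
      have "0 = (\<Sum>j\<in>J-{p}. a i j * x j - a i p / a k p * (a k j * x j))"
        using x(2) that by (simp add: b_def algebra_simps)
      also have "\<dots> = (\<Sum>j\<in>J-{p}. a i j * x j) + a i p * y p"
        by (simp add: sum_subtractf y_def sum_distrib_left sum_divide_distrib)
      finally show ?thesis by (simp add: split add.commute)
    qed
    moreover have "\<exists>j\<in>J. y j \<noteq> 0" using x(1) by (auto simp: y_def)
    ultimately show ?thesis by blast
  qed
qed

text \<open>Homogeneous forms of degree \<open>n\<close> in \<open>x\<^sub>0, \<dots>, x\<^sub>r\<close>, taken as functions on all sequences. The
generation by coordinates makes products and the passage from degree \<open>n\<close> to degree \<open>n + 1\<close>
immediate; the comparison with monomials is postponed to the Veronese map.\<close>

inductive hform :: "nat \<Rightarrow> nat \<Rightarrow> ((nat \<Rightarrow> 'a::field) \<Rightarrow> 'a) \<Rightarrow> bool" for r where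
  hform_const: "hform r 0 (\<lambda>x. c)"
| hform_coord: "i \<le> r \<Longrightarrow> hform r n g \<Longrightarrow> hform r (Suc n) (\<lambda>x. x i * g x)"
| hform_add: "hform r n f \<Longrightarrow> hform r n g \<Longrightarrow> hform r n (\<lambda>x. f x + g x)"

lemma hform_zero: "hform r n (\<lambda>x. 0)"
proof (induction n)
  case 0
  show ?case by (rule hform_const)
next
  case (Suc n)
  then show ?case using hform_coord[of 0 r n "\<lambda>x. 0"] by simp
qed

lemma hform_mult:
  assumes "hform r m f" "hform r n g"
  shows "hform r (m + n) (\<lambda>x. f x * g x)"
  using assms
proof (induction m f rule: hform.induct)
  case (hform_const c)
  have "hform r n (\<lambda>x. c * g x)"
    using hform_const(1)
  proof (induction n g rule: hform.induct)
    case (hform_const c') then show ?case by (rule hform.hform_const)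
  next
    case (hform_coord i n g)
    then show ?case using hform.hform_coord[of i r n "\<lambda>x. c * g x"] by (simp add: mult.left_commute)
  next
    case (hform_add n f g)
    then show ?case using hform.hform_add by (simp add: distrib_left)
  qed
  then show ?case by simp
next
  case (hform_coord i n' g')
  then show ?case
    using hform.hform_coord[of i r "n' + n" "\<lambda>x. g' x * g x"] by (simp add: mult.assoc)
next
  case (hform_add n' f' g')
  then show ?case using hform.hform_add by (simp add: distrib_right)
qed

lemma hform_scale: "hform r n g \<Longrightarrow> hform r n (\<lambda>x. c * g x)"
  using hform_mult[OF hform_const, of r n g c] by simp

lemma hform_diff: "hform r n f \<Longrightarrow> hform r n g \<Longrightarrow> hform r n (\<lambda>x. f x - g x)"
  using hform_add[OF _ hform_scale[of r n g "-1"], of f] by simp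

lemma hform_sum:
  assumes "\<And>i. i \<in> I \<Longrightarrow> hform r n (f i)"
  shows "hform r n (\<lambda>x. \<Sum>i\<in>I. f i x)"
  using assms by (induction I rule: infinite_finite_induct) (auto intro: hform_zero hform_add)

lemma hform_linear: "hform r (Suc 0) (\<lambda>x. \<Sum>i\<le>r. a i * x i)"
proof (rule hform_sum)
  fix i assume "i \<in> {..r}"
  then show "hform r (Suc 0) (\<lambda>x. a i * x i)"
    using hform_coord[OF _ hform_const, of i r "a i"] by (simp add: mult.commute)
qed

lemma hform_degree_one_cases:
  assumes "hform r (Suc 0) f"
  obtains a where "\<And>x. f x = (\<Sum>i\<le>r. a i * x i)"
proof -
  have zero: "hform r n f \<Longrightarrow> n = 0 \<Longrightarrow> \<exists>c. \<forall>x. f x = c" for n f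
  proof (induction n f rule: hform.induct)
    case (hform_add n f g)
    then obtain c c' where "\<forall>x. f x = c" "\<forall>x. g x = c'" by auto
    then show ?case by auto
  qed auto
  have "hform r n f \<Longrightarrow> n = Suc 0 \<Longrightarrow> \<exists>a. \<forall>x. f x = (\<Sum>i\<le>r. a i * x i)" for n
  proof (induction n f rule: hform.induct)
    case (hform_const c) then show ?case by simp
  next
    case (hform_coord i n g)
    then obtain c where c: "\<forall>x. g x = c" using zero[of n g] by auto
    have "x i * g x = (\<Sum>j\<le>r. (if j = i then c else 0) * x j)" for x
      using hform_coord c by (simp add: if_distrib[of "\<lambda>y. y * _"] sum.delta cong: if_cong)
    then show ?case by (intro exI[of _ "\<lambda>j. if j = i then c else 0"]) auto
  next
    case (hform_add n f g)
    then obtain a b where "\<forall>x. f x = (\<Sum>i\<le>r. a i * x i)" "\<forall>x. g x = (\<Sum>i\<le>r. b i * x i)"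
      by auto
    then have "\<forall>x. f x + g x = (\<Sum>i\<le>r. (a i + b i) * x i)"
      by (simp add: sum.distrib distrib_right)
    then show ?case by (intro exI[of _ "\<lambda>i. a i + b i"])
  qed
  then show thesis using assms that by blast
qed

lemma hform_degree_two_cases:
  assumes "hform r 2 f"
  obtains a where "\<And>x. f x = quad_form r a x"
proof -
  have "hform r n f \<Longrightarrow> n = 2 \<Longrightarrow> \<exists>a. \<forall>x. f x = quad_form r a x" for n
  proof (induction n f rule: hform.induct)
    case (hform_const c) then show ?case by simp
  next
    case (hform_coord i n g)
    then have "hform r (Suc 0) g" by (simp add: numeral_2_eq_2)
    then obtain c where c: "\<And>x. g x = (\<Sum>j\<le>r. c j * x j)"
      using hform_degree_one_cases by blast
    have "x i * g x = quad_form r (\<lambda>k j. if k = i then c j else 0) x" for x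
    proof -
      have "quad_form r (\<lambda>k j. if k = i then c j else 0) x
          = (\<Sum>k\<le>r. if k = i then x i * g x else 0)"
        unfolding quad_form_def c sum_distrib_left
        by (intro sum.cong refl) (auto intro!: sum.cong sum.neutral)
      then show ?thesis using hform_coord by simp
    qed
    then show ?case by blast
  next
    case (hform_add n f g)
    then obtain a b where "\<forall>x. f x = quad_form r a x" "\<forall>x. g x = quad_form r b x"
      by auto
    then have "\<forall>x. f x + g x = quad_form r (\<lambda>i j. a i j + b i j) x"
      by (simp add: quad_form_def sum.distrib distrib_right)
    then show ?case by (intro exI[of _ "\<lambda>i j. a i j + b i j"])
  qed
  then show thesis using assms that by blast
qed

lemma linear_form_add:
  "hform r (Suc 0) f \<Longrightarrow> f (x + y) = f x + f y"
  by (erule hform_degree_one_cases) (simp add: distrib_left sum.distrib)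

lemma linear_form_scale:
  "hform r (Suc 0) f \<Longrightarrow> f (fun_scale c x) = c * f x"
  by (erule hform_degree_one_cases) (simp add: fun_scale_def sum_distrib_left mult_ac)

lemma linear_form_zero: "hform r (Suc 0) f \<Longrightarrow> f 0 = 0"
  by (erule hform_degree_one_cases) simp

lemma linear_form_kernel_span:
  assumes "hform r (Suc 0) f" "\<And>x. x \<in> S \<Longrightarrow> f x = 0" "y \<in> lspan S"
  shows "f y = 0"
  using assms(3)
proof (induction rule: fun_space.span_induct_alt)
  case base
  then show ?case using linear_form_zero[OF assms(1)] .
next
  case (step c x y)
  then show ?case
    using assms(2) linear_form_add[OF assms(1), of "fun_scale c x" y]
      linear_form_scale[OF assms(1), of c x] by (metis add.right_neutral mult_zero_right)
qed

lemma subspace_coord_space: "fun_space.subspace (coord_space I)"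
  by (auto simp: fun_space.subspace_def coord_space_def fun_scale_def)

lemma span_subset_coord_space: "S \<subseteq> coord_space I \<Longrightarrow> lspan S \<subseteq> coord_space I"
  by (rule fun_space.span_minimal[OF _ subspace_coord_space])

lemma ambient_expand:
  assumes "x \<in> ambient r"
  shows "x = (\<Sum>i\<le>r. fun_scale (x i) (\<lambda>j. if j = i then 1 else 0))"
proof
  fix k
  have "(\<Sum>i\<le>r. fun_scale (x i) (\<lambda>j. if j = i then 1 else 0)) k
      = (\<Sum>i\<le>r. if i = k then x k else 0)"
    by (induction r) (auto simp: fun_scale_def)
  also have "\<dots> = x k" using assms by (auto simp: coord_space_def)
  finally show "x k = (\<Sum>i\<le>r. fun_scale (x i) (\<lambda>j. if j = i then 1 else 0)) k" by simp
qed

text \<open>Every linear functional on the space of the first \<open>r + 1\<close> coordinates is a form of degree one, and such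
a form sees no other coordinates. So \<open>x\<close> and \<open>S\<close> are taken in that space.\<close>

lemma separating_linear_form:
  fixes x :: "nat \<Rightarrow> 'a::field"
  assumes "x \<in> ambient r" "S \<subseteq> ambient r" "x \<notin> lspan S"
  obtains f where "hform r (Suc 0) f" "\<And>y. y \<in> lspan S \<Longrightarrow> f y = 0" "f x = 1"
proof -
  interpret vp: vector_space_pair "fun_scale :: 'a \<Rightarrow> (nat \<Rightarrow> 'a) \<Rightarrow> _" "(*) :: 'a \<Rightarrow> 'a \<Rightarrow> 'a"
    by unfold_locales (auto simp: algebra_simps)
  obtain B where B: "B \<subseteq> S" "\<not> fun_space.dependent B" "S \<subseteq> lspan B"
    by (rule fun_space.maximal_independent_subset)
  have spanB: "lspan B = lspan S"
    using B fun_space.span_mono fun_space.span_minimal by (metis fun_space.subspace_span subset_antisym)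
  then have ind: "\<not> fun_space.dependent (insert x B)"
    using assms B by (simp add: fun_space.independent_insertI)
  from vp.linear_independent_extend[OF ind, of "\<lambda>b. if b = x then 1 else 0"]
  obtain \<phi> where \<phi>: "Vector_Spaces.linear fun_scale (*) \<phi>"
      "\<forall>b\<in>insert x B. \<phi> b = (if b = x then 1 else 0)" by blast
  interpret \<phi>: Vector_Spaces.linear "fun_scale :: 'a \<Rightarrow> (nat \<Rightarrow> 'a) \<Rightarrow> _" "(*)" \<phi> by fact
  define f where "f = (\<lambda>y. \<Sum>i\<le>r. \<phi> (\<lambda>j. if j = i then 1 else 0) * y i)"
  have f: "f y = \<phi> y" if "y \<in> ambient r" for y
    by (subst (2) ambient_expand[OF that]) (simp add: f_def \<phi>.sum \<phi>.scale mult.commute)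
  have form: "hform r (Suc 0) f" unfolding f_def by (rule hform_linear)
  have "x \<notin> B" using assms spanB fun_space.span_base by blast
  then have "f b = 0" if "b \<in> B" for b
    using \<phi>(2) f that B assms by (metis insertCI subsetD)
  then have "f y = 0" if "y \<in> lspan S" for y
    using linear_form_kernel_span[of r f B y] form that spanB by simp
  moreover have "f x = 1" using \<phi>(2) f assms by simp
  ultimately show thesis using that form by blast
qed

section \<open>Relations among points and their residuals\<close>

text \<open>Points of projective space are represented by nonzero vectors, no two of them proportional.\<close>

definition point_set :: "nat \<Rightarrow> (nat \<Rightarrow> 'a::field) set \<Rightarrow> bool" where
  "point_set r Z \<longleftrightarrow> finite Z \<and> Z \<subseteq> ambient r \<and> 0 \<notin> Z \<and>
     (\<forall>x\<in>Z. \<forall>y\<in>Z. x \<in> lspan {y} \<longrightarrow> x = y)"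

text \<open>Nonzero coefficients make \<open>Z\<close> the exact support of the relation and not only a set that contains the
support. Exactness is inherited by residuals and turns each lower bound into a contradiction.\<close>

definition supports :: "nat \<Rightarrow> nat \<Rightarrow> (nat \<Rightarrow> 'a::field) set \<Rightarrow> bool" where
  "supports r e Z \<longleftrightarrow> (\<exists>c. (\<forall>z\<in>Z. c z \<noteq> 0) \<and> (\<forall>G. hform r e G \<longrightarrow> (\<Sum>z\<in>Z. c z * G z) = 0))"

lemma point_set_subset: "point_set r Z \<Longrightarrow> Y \<subseteq> Z \<Longrightarrow> point_set r Y"
  unfolding point_set_def by (blast intro: finite_subset)

text \<open>The coefficients are multiplied by the values of \<open>f\<close>: if \<open>c\<close> kills all forms of degree \<open>m + n\<close>, then
\<open>c f\<close> kills all forms of degree \<open>n\<close>, and its support loses exactly the zeros of \<open>f\<close>. Every geometric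
argument below is a choice of \<open>f\<close> followed by a count of the points that remain.\<close>

lemma supports_residual:
  assumes "supports r (m + n) Z" "finite Z" "hform r m f"
  shows "supports r n {z \<in> Z. f z \<noteq> 0}"
proof -
  obtain c where c: "\<And>z. z \<in> Z \<Longrightarrow> c z \<noteq> 0" "\<And>G. hform r (m + n) G \<Longrightarrow> (\<Sum>z\<in>Z. c z * G z) = 0"
    using assms(1) unfolding supports_def by blast
  have "(\<Sum>z\<in>{z \<in> Z. f z \<noteq> 0}. c z * f z * G z) = 0" if "hform r n G" for G
  proof -
    have "(\<Sum>z\<in>{z \<in> Z. f z \<noteq> 0}. c z * f z * G z) = (\<Sum>z\<in>Z. c z * f z * G z)"
      using assms(2) by (intro sum.mono_neutral_left) auto
    also have "\<dots> = 0"
      using c(2)[OF hform_mult[OF assms(3) that]] by (simp add: mult.assoc)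
    finally show ?thesis .
  qed
  then show ?thesis
    unfolding supports_def using c(1) by (intro exI[of _ "\<lambda>z. c z * f z"]) auto
qed

lemma supports_residual_linear:
  assumes "supports r (Suc n) Z" "finite Z" "hform r (Suc 0) f"
  shows "supports r n {z \<in> Z. f z \<noteq> 0}"
  using supports_residual[of r "Suc 0" n Z f] assms by simp

lemma supports_residual_quadratic:
  assumes "supports r (Suc (Suc n)) Z" "finite Z" "hform r 2 f"
  shows "supports r n {z \<in> Z. f z \<noteq> 0}"
  using supports_residual[of r 2 n Z f] assms by simp

lemma hform_mult_linear:
  "hform r (Suc 0) f \<Longrightarrow> hform r (Suc 0) g \<Longrightarrow> hform r 2 (\<lambda>x. f x * g x)"
  using hform_mult[of r "Suc 0" f "Suc 0" g] by (simp add: numeral_2_eq_2)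

text \<open>Each step removes at least one point and lowers the degree by one, and a relation among constants
involves at least two points.\<close>

lemma card_supports_ge:
  assumes "point_set r Z" "supports r e Z" "Z \<noteq> {}"
  shows "e + 2 \<le> card Z"
  using assms
proof (induction e arbitrary: Z)
  case 0
  obtain c where c: "\<And>z. z \<in> Z \<Longrightarrow> c z \<noteq> 0" "\<And>G. hform r 0 G \<Longrightarrow> (\<Sum>z\<in>Z. c z * G z) = 0"
    using 0(2) unfolding supports_def by blast
  have sum: "(\<Sum>z\<in>Z. c z) = 0" using c(2)[OF hform_const[of r 1]] by simp
  have fin: "finite Z" using 0 by (simp add: point_set_def)
  then have "card Z \<noteq> 0" using 0 by simp
  moreover have "card Z \<noteq> 1"
    using sum c(1) by (auto simp: card_1_singleton_iff)
  ultimately show ?case by simp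
next
  case (Suc e)
  have fin: "finite Z" and amb: "Z \<subseteq> ambient r" using Suc by (auto simp: point_set_def)
  obtain x where x: "x \<in> Z" using Suc by auto
  have res: "e + 2 \<le> card {z \<in> Z. f z \<noteq> 0}" if "hform r (Suc 0) f" "f x = 1" for f
  proof (rule Suc.IH)
    show "point_set r {z \<in> Z. f z \<noteq> 0}" using Suc.prems(1) by (rule point_set_subset) auto
    show "supports r e {z \<in> Z. f z \<noteq> 0}" by (rule supports_residual_linear[OF Suc.prems(2) fin that(1)])
    show "{z \<in> Z. f z \<noteq> 0} \<noteq> {}" using x that(2) by auto
  qed
  have "x \<noteq> 0" using x Suc by (auto simp: point_set_def)
  then have "x \<notin> lspan {}" by simp
  then obtain f where "hform r (Suc 0) f" "f x = 1"
    using separating_linear_form[of x r "{}"] x amb by blast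
  then have "e + 2 \<le> card {z \<in> Z. f z \<noteq> 0}" by (rule res)
  also have "\<dots> \<le> card Z" by (rule card_mono[OF fin]) auto
  finally have "\<not> Z \<subseteq> {x}" using card_mono[of "{x}" Z] by auto
  then obtain y where y: "y \<in> Z" "y \<noteq> x" by auto
  then have "x \<notin> lspan {y}" using Suc.prems(1) x by (auto simp: point_set_def)
  then obtain g where g: "hform r (Suc 0) g" "\<And>z. z \<in> lspan {y} \<Longrightarrow> g z = 0" "g x = 1"
    using separating_linear_form[of x r "{y}"] x y amb by blast
  then have "{z \<in> Z. g z \<noteq> 0} \<subseteq> Z - {y}" by (auto simp: fun_space.span_base)
  then have "card {z \<in> Z. g z \<noteq> 0} \<le> card Z - 1"
    using card_mono[of "Z - {y}"] fin y by simp
  with res[OF g(1,3)] show ?case by simp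
qed

lemma supports_two_points:
  assumes "point_set r Z" "supports r e Z" "Z \<noteq> {}"
  obtains x y where "x \<in> Z" "y \<in> Z" "x \<noteq> y"
proof -
  have "2 \<le> card Z" using card_supports_ge[OF assms] by simp
  then obtain T where "T \<subseteq> Z" "card T = 2" by (meson obtain_subset_with_card_n)
  then show thesis using that by (auto simp: card_2_iff)
qed

text \<open>If the points are not collinear, a linear form through two of them removes two points, so by induction
the rest lies on a line with many points. A form vanishing on that line would leave fewer points than
a relation needs.\<close>

lemma supports_small_collinear:
  assumes "point_set r Z" "supports r e Z" "Z \<noteq> {}" "card Z \<le> 2 * e + 1"
  shows "\<exists>a\<in>Z. \<exists>b\<in>Z. a \<noteq> b \<and> Z \<subseteq> lspan {a, b}"
  using assms
proof (induction e arbitrary: Z)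
  case 0
  then show ?case using card_supports_ge[of r Z 0] by simp
next
  case (Suc e)
  have fin: "finite Z" and amb: "Z \<subseteq> ambient r" using Suc by (auto simp: point_set_def)
  obtain x y where xy: "x \<in> Z" "y \<in> Z" "x \<noteq> y"
    using supports_two_points Suc.prems by blast
  show ?case
  proof (rule ccontr)
    assume no_line: "\<not> ?thesis"
    have exists_form: "\<exists>f. hform r (Suc 0) f \<and> (\<forall>z\<in>lspan {a, b}. f z = 0) \<and> {z \<in> Z. f z \<noteq> 0} \<noteq> {}"
      if ab: "a \<in> Z" "b \<in> Z" "a \<noteq> b" for a b
    proof -
      obtain z where "z \<in> Z" "z \<notin> lspan {a, b}" using no_line ab by blast
      moreover have "{a, b} \<subseteq> ambient r" using amb ab by auto
      ultimately obtain f where "hform r (Suc 0) f" "\<And>y. y \<in> lspan {a, b} \<Longrightarrow> f y = 0" "f z = 1"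
        using separating_linear_form[of z r "{a, b}"] amb by blast
      with \<open>z \<in> Z\<close> have "z \<in> {z \<in> Z. f z \<noteq> 0}" by simp
      then show ?thesis
        using \<open>hform r (Suc 0) f\<close> \<open>\<And>y. y \<in> lspan {a, b} \<Longrightarrow> f y = 0\<close> by blast
    qed
    have sub: "point_set r {z \<in> Z. f z \<noteq> 0}" for f
      using Suc.prems(1) by (rule point_set_subset) auto
    obtain f where f: "hform r (Suc 0) f" "\<And>z. z \<in> lspan {x, y} \<Longrightarrow> f z = 0" "{z \<in> Z. f z \<noteq> 0} \<noteq> {}"
      using exists_form[OF xy] by blast
    let ?Z' = "{z \<in> Z. f z \<noteq> 0}"
    have "?Z' \<subseteq> Z - {x, y}" using f(2) by (auto simp: fun_space.span_base)
    then have "card ?Z' \<le> card Z - 2" using card_mono[of "Z - {x, y}" ?Z'] fin xy by simp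
    then have small: "card ?Z' \<le> 2 * e + 1" using Suc.prems by simp
    have sup: "supports r e ?Z'" using supports_residual_linear Suc.prems fin f by blast
    obtain a b where ab: "a \<in> ?Z'" "b \<in> ?Z'" "a \<noteq> b" "?Z' \<subseteq> lspan {a, b}"
      using Suc.IH[OF sub sup f(3) small] by blast
    have big: "e + 2 \<le> card ?Z'" by (rule card_supports_ge[OF sub sup f(3)])
    obtain g where g: "hform r (Suc 0) g" "\<And>z. z \<in> lspan {a, b} \<Longrightarrow> g z = 0" "{z \<in> Z. g z \<noteq> 0} \<noteq> {}"
      using exists_form[of a b] ab by blast
    let ?Z'' = "{z \<in> Z. g z \<noteq> 0}"
    have "supports r e ?Z''" using supports_residual_linear Suc.prems fin g by blast
    then have "e + 2 \<le> card ?Z''" using card_supports_ge sub g(3) by blast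
    also have "\<dots> \<le> card (Z - ?Z')" using fin g(2) ab(4) by (intro card_mono) auto
    also have "\<dots> = card Z - card ?Z'" using fin by (intro card_Diff_subset) auto
    finally show False using big Suc.prems(4) by simp
  qed
qed

text \<open>The points of \<open>Y\<close> impose independent conditions on forms of degree \<open>n\<close>.\<close>

definition separated :: "nat \<Rightarrow> nat \<Rightarrow> (nat \<Rightarrow> 'a::field) set \<Rightarrow> bool" where
  "separated r n Y \<longleftrightarrow> (\<forall>y\<in>Y. \<exists>G. hform r n G \<and> G y = 1 \<and> (\<forall>z\<in>Y - {y}. G z = 0))"

lemma supports_subset_separated:
  assumes "supports r n X" "finite X" "X \<subseteq> Y" "separated r n Y"
  shows "X = {}"
proof (rule ccontr)
  assume "X \<noteq> {}"
  then obtain y where y: "y \<in> X" by auto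
  obtain c where c: "\<And>z. z \<in> X \<Longrightarrow> c z \<noteq> 0" "\<And>G. hform r n G \<Longrightarrow> (\<Sum>z\<in>X. c z * G z) = 0"
    using assms(1) unfolding supports_def by blast
  obtain G where G: "hform r n G" "G y = 1" "\<And>z. z \<in> Y - {y} \<Longrightarrow> G z = 0"
    using assms y unfolding separated_def by blast
  have "(\<Sum>z\<in>X. c z * G z) = c y"
  proof -
    have "(\<Sum>z\<in>X. c z * G z) = (\<Sum>z\<in>X. if z = y then c y else 0)"
      using G(2) G(3) assms(3) by (intro sum.cong) auto
    then show ?thesis using y assms(2) by simp
  qed
  then show False using c G y by force
qed

lemma separated_Suc:
  assumes "separated r n Y" "Y \<subseteq> ambient r" "0 \<notin> Y"
  shows "separated r (Suc n) Y"
  unfolding separated_def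
proof
  fix y assume y: "y \<in> Y"
  then obtain G where G: "hform r n G" "G y = 1" "\<forall>z\<in>Y - {y}. G z = 0"
    using assms unfolding separated_def by blast
  have "y \<noteq> 0" using y assms by auto
  then obtain f where "hform r (Suc 0) f" "f y = 1"
    using separating_linear_form[of y r "{}"] y assms by auto
  then show "\<exists>G. hform r (Suc n) G \<and> G y = 1 \<and> (\<forall>z\<in>Y - {y}. G z = 0)"
    using hform_mult[of r "Suc 0" f n G] G by (intro exI[of _ "\<lambda>x. f x * G x"]) auto
qed

lemma separated_insert:
  assumes "separated r n Y" "hform r n G" "\<And>y. y \<in> Y \<Longrightarrow> G y = 0" "G z \<noteq> 0"
  shows "separated r n (insert z Y)"
  unfolding separated_def
proof
  fix y assume y: "y \<in> insert z Y"
  show "\<exists>H. hform r n H \<and> H y = 1 \<and> (\<forall>x\<in>insert z Y - {y}. H x = 0)"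
  proof (cases "y = z")
    case True
    then show ?thesis
      using assms hform_scale[of r n G "1 / G z"] by (intro exI[of _ "\<lambda>x. 1 / G z * G x"]) auto
  next
    case False
    then obtain H where H: "hform r n H" "H y = 1" "\<forall>x\<in>Y - {y}. H x = 0"
      using assms y unfolding separated_def by blast
    then show ?thesis
      using assms hform_diff[OF H(1) hform_scale[of r n G "H z / G z"]] y False
      by (intro exI[of _ "\<lambda>x. H x - H z / G z * G x"]) auto
  qed
qed

text \<open>A maximal set imposing independent conditions computes the Hilbert function of \<open>Z\<close> in degree \<open>n\<close>:
a form that vanishes on it vanishes on all of \<open>Z\<close>.\<close>

lemma separated_extend:
  assumes "finite Z" "Y \<subseteq> Z" "separated r n Y"
  obtains Y' where "Y \<subseteq> Y'" "Y' \<subseteq> Z" "separated r n Y'"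
    "\<And>G z. hform r n G \<Longrightarrow> (\<And>y. y \<in> Y' \<Longrightarrow> G y = 0) \<Longrightarrow> z \<in> Z \<Longrightarrow> G z = 0"
proof -
  let ?C = "{Y'. Y \<subseteq> Y' \<and> Y' \<subseteq> Z \<and> separated r n Y'}"
  have "finite ?C" using assms by (auto intro: finite_subset[of _ "Pow Z"])
  moreover have "Y \<in> ?C" using assms by auto
  ultimately obtain Y' where Y': "Y' \<in> ?C" "\<forall>S\<in>?C. Y' \<subseteq> S \<longrightarrow> Y' = S"
    using finite_has_maximal[of ?C] by blast
  have "G z = 0" if G: "hform r n G" "\<And>y. y \<in> Y' \<Longrightarrow> G y = 0" "z \<in> Z" for G z
  proof (rule ccontr)
    assume nz: "G z \<noteq> 0"
    have "separated r n Y'" using Y' by simp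
    then have "separated r n (insert z Y')" using G(2) by (rule separated_insert[OF _ G(1) _ nz])
    then have "insert z Y' \<in> ?C" using Y'(1) G(3) by blast
    from Y'(2)[rule_format, OF this] have "Y' = insert z Y'" by (simp add: subset_insertI)
    then have "z \<in> Y'" by (metis insertI1)
    then have "G z = 0" by (rule G(2))
    then show False using nz by contradiction
  qed
  then show thesis using Y'(1) by (intro that[of Y']) simp_all
qed

lemma proportional_or_dual_vectors:
  assumes f: "hform r (Suc 0) f" and g: "hform r (Suc 0) g"
    and W: "fun_space.subspace W" and p: "p \<in> W" "f p \<noteq> 0"
  shows "(\<exists>c. \<forall>x\<in>W. g x = c * f x) \<or>
    (\<exists>v\<in>W. \<exists>w\<in>W. f v = 1 \<and> g v = 0 \<and> f w = 0 \<and> g w = 1)"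
proof (cases "\<forall>y\<in>W. f y = 0 \<longrightarrow> g y = 0")
  case True
  have "g x = g p / f p * f x" if "x \<in> W" for x
  proof -
    let ?y = "x + fun_scale (- (f x / f p)) p"
    have "?y \<in> W" using W p that by (intro fun_space.subspace_add fun_space.subspace_scale) auto
    moreover have "f ?y = 0"
      using p by (simp only: linear_form_add[OF f] linear_form_scale[OF f]) simp
    ultimately have "g ?y = 0" using True by blast
    then show ?thesis
      by (simp only: linear_form_add[OF g] linear_form_scale[OF g]) (simp add: field_simps)
  qed
  then show ?thesis by blast
next
  case False
  then obtain y where y: "y \<in> W" "f y = 0" "g y \<noteq> 0" by blast
  let ?w = "fun_scale (1 / g y) y"
  let ?v = "fun_scale (1 / f p) p + fun_scale (- (g p / f p)) ?w"
  have "?w \<in> W" "?v \<in> W"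
    using W p y by (intro fun_space.subspace_add fun_space.subspace_scale; simp)+
  moreover have "f ?w = 0" "g ?w = 1"
    using y by (simp_all add: linear_form_scale[OF f] linear_form_scale[OF g])
  moreover from this have "f ?v = 1" "g ?v = 0"
    using p by (simp_all only: linear_form_add[OF f] linear_form_scale[OF f]
        linear_form_add[OF g] linear_form_scale[OF g]) simp_all
  ultimately show ?thesis by blast
qed

text \<open>Two linear syzygies of the same pair that have vanishing determinant are proportional, once \<open>f\<close> and \<open>g\<close>
are independent on \<open>W\<close>.\<close>

lemma zero_determinant_proportional:
  assumes f: "hform r (Suc 0) f" and g: "hform r (Suc 0) g"
    and f': "hform r (Suc 0) f'" and g': "hform r (Suc 0) g'"
    and W: "fun_space.subspace W" and vw: "v \<in> W" "w \<in> W" "f v = 1" "g v = 0" "f w = 0" "g w = 1"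
    and det: "\<And>x. x \<in> W \<Longrightarrow> f x * g' x = g x * f' x"
  shows "\<exists>c. \<forall>x\<in>W. f' x = c * f x \<and> g' x = c * g x"
proof (intro exI ballI)
  note add = linear_form_add[OF f] linear_form_add[OF g] linear_form_add[OF f'] linear_form_add[OF g']
  note scale = linear_form_scale[OF f] linear_form_scale[OF g] linear_form_scale[OF f']
    linear_form_scale[OF g']
  fix x assume x: "x \<in> W"
  let ?y = "x + (fun_scale (- f x) v + fun_scale (- g x) w)"
  have y: "?y \<in> W"
    using W x vw by (intro fun_space.subspace_add fun_space.subspace_scale) auto
  have fy: "f ?y = 0" "g ?y = 0" using vw by (simp_all only: add scale) simp_all
  have v': "g' v = 0" using det[of v] vw by simp
  have w': "f' w = 0" using det[of w] vw by simp
  have "v + ?y \<in> W" "w + ?y \<in> W" "v + w \<in> W"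
    using W y vw by (auto intro!: fun_space.subspace_add simp del: plus_fun_apply)
  from this[THEN det] have "g' ?y = 0" "f' ?y = 0" "g' w = f' v"
    using vw fy v' w' by (simp_all only: add scale) simp_all
  then show "f' x = f' v * f x \<and> g' x = f' v * g x"
    using v' w' by (simp only: add scale) (simp add: algebra_simps)
qed

section \<open>Plane points in general position\<close>

text \<open>For three or more points this means that they are collinear, or lie in a plane with no three of them
on a line.\<close>

definition in_general_position :: "nat \<Rightarrow> (nat \<Rightarrow> 'a::field) set \<Rightarrow> bool" where
  "in_general_position r Z \<longleftrightarrow>
     (\<forall>f. hform r (Suc 0) f \<longrightarrow> (\<forall>z\<in>Z. f z = 0) \<or> card {z \<in> Z. f z = 0} \<le> 2)"

text \<open>A basis \<open>b\<close> of a three-dimensional \<open>W\<close> together with linear forms of the ambient space that restrict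
to its coordinates.\<close>

definition coordinate_frame ::
    "nat \<Rightarrow> (nat \<Rightarrow> 'a::field) set \<Rightarrow> (nat \<Rightarrow> nat \<Rightarrow> 'a) \<Rightarrow> (nat \<Rightarrow> (nat \<Rightarrow> 'a) \<Rightarrow> 'a) \<Rightarrow> bool" where
  "coordinate_frame r W b \<xi> \<longleftrightarrow> fun_space.subspace W \<and>
     (\<forall>i<3. b i \<in> W \<and> hform r (Suc 0) (\<xi> i)) \<and>
     (\<forall>i<3. \<forall>j<3. \<xi> i (b j) = (if i = j then 1 else 0)) \<and>
     (\<forall>x\<in>W. x = (\<Sum>i<3. fun_scale (\<xi> i x) (b i)))"

lemma general_position_no_line:
  assumes gen: "in_general_position r Z" and Z: "point_set r Z" and ab: "a \<in> Z" "b \<in> Z"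
    and no_line: "\<not> Z \<subseteq> lspan {a, b}" and X: "X \<subseteq> Z" "X \<subseteq> lspan {a, b}"
  shows "card X \<le> 2"
proof -
  have amb: "Z \<subseteq> ambient r" "finite Z" using Z by (auto simp: point_set_def)
  obtain z where z: "z \<in> Z" "z \<notin> lspan {a, b}" using no_line by blast
  moreover have "{a, b} \<subseteq> ambient r" using amb ab by auto
  ultimately obtain f where f: "hform r (Suc 0) f" "\<And>y. y \<in> lspan {a, b} \<Longrightarrow> f y = 0" "f z = 1"
    using separating_linear_form[of z r "{a, b}"] amb by blast
  have "card {z \<in> Z. f z = 0} \<le> 2"
  proof -
    have "f z \<noteq> 0" using f(3) by simp
    then have "\<not> (\<forall>z\<in>Z. f z = 0)" using z(1) by blast
    then show ?thesis using gen f(1) unfolding in_general_position_def by blast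
  qed
  moreover have "card X \<le> card {z \<in> Z. f z = 0}"
    using X f(2) amb by (intro card_mono) auto
  ultimately show ?thesis by simp
qed

text \<open>The Hilbert function of \<open>Z\<close> grows by at most two from degree \<open>n\<close> to \<open>n + 1\<close>, where \<open>Y\<close> computes it in
degree \<open>n\<close>. Take forms \<open>G1, G2\<close> dual to two points of \<open>Y\<close>. A combination of the six
products of \<open>G1, G2\<close> with the coordinates vanishes on \<open>Z\<close> once it satisfies four linear conditions, so there
are two independent syzygies
\<open>l G1 + l' G2 = 0\<close> and \<open>m G1 + m' G2 = 0\<close> on \<open>Z\<close>. The conic \<open>l m' - l' m\<close> vanishes wherever \<open>G1\<close> does not, and
these points support a relation of degree \<open>e - n \<ge> 2\<close>. Being in general position, they are at least
six.\<close>

lemma slow_growth_conic: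
  assumes Z: "point_set r Z" and sup: "supports r e Z" and gen: "in_general_position r Z"
    and no_line: "\<And>a b. a \<in> Z \<Longrightarrow> b \<in> Z \<Longrightarrow> \<not> Z \<subseteq> lspan {a, b}"
    and frame: "coordinate_frame r W b \<xi>" and ZW: "Z \<subseteq> W" and bZ: "\<And>i. i < 3 \<Longrightarrow> b i \<in> Z"
    and Y: "Y \<subseteq> Z" "separated r n Y" "2 \<le> card Y" and n: "n + 2 \<le> e"
    and slow: "\<And>Y'. Y' \<subseteq> Z \<Longrightarrow> separated r (Suc n) Y' \<Longrightarrow> card Y' \<le> card Y + 2"
  shows "\<exists>q. hform r 2 q \<and> (\<exists>x\<in>W. q x \<noteq> 0) \<and> 6 \<le> card {z \<in> Z. q z = 0}"
proof -
  have fin: "finite Z" and amb: "Z \<subseteq> ambient r" and nz: "0 \<notin> Z"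
    using Z by (auto simp: point_set_def)
  have W: "fun_space.subspace W" and b: "\<And>i. i < 3 \<Longrightarrow> b i \<in> W"
    and \<xi>: "\<And>i. i < 3 \<Longrightarrow> hform r (Suc 0) (\<xi> i)"
    and dual: "\<And>i j. i < 3 \<Longrightarrow> j < 3 \<Longrightarrow> \<xi> i (b j) = (if i = j then 1 else 0)"
    using frame by (auto simp: coordinate_frame_def)
  obtain y1 y2 where y: "y1 \<in> Y" "y2 \<in> Y" "y1 \<noteq> y2"
  proof -
    obtain T where "T \<subseteq> Y" "card T = 2" using Y(3) by (meson obtain_subset_with_card_n)
    then show thesis using that by (auto simp: card_2_iff)
  qed
  obtain G1 where G1: "hform r n G1" "G1 y1 = 1" "\<And>z. z \<in> Y - {y1} \<Longrightarrow> G1 z = 0"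
    using Y(2) y(1) unfolding separated_def by blast
  obtain G2 where G2: "hform r n G2" "G2 y2 = 1" "\<And>z. z \<in> Y - {y2} \<Longrightarrow> G2 z = 0"
    using Y(2) y(2) unfolding separated_def by blast
  have "separated r (Suc n) Y" using Y amb nz by (intro separated_Suc) auto
  then obtain Y' where Y': "Y \<subseteq> Y'" "Y' \<subseteq> Z" "separated r (Suc n) Y'"
    "\<And>G z. hform r (Suc n) G \<Longrightarrow> (\<And>y. y \<in> Y' \<Longrightarrow> G y = 0) \<Longrightarrow> z \<in> Z \<Longrightarrow> G z = 0"
    using separated_extend[OF fin Y(1)] by metis
  define I where "I = {y1, y2} \<union> (Y' - Y)"
  have finY: "finite Y" "finite Y'" using Y(1) Y'(2) fin by (auto intro: finite_subset)
  have finI: "finite I" using finY by (simp add: I_def)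
  have "card (Y' - Y) \<le> 2" using slow[OF Y'(2,3)] Y'(1) finY by (simp add: card_Diff_subset)
  moreover have "card I \<le> card {y1, y2} + card (Y' - Y)" unfolding I_def by (rule card_Un_le)
  ultimately have cardI: "card I \<le> 4" using y by simp
  \<comment> \<open>A vector \<open>s\<close> of six unknowns encodes the pair of linear forms \<open>l s\<close> and \<open>l (h s)\<close>.\<close>
  define l where "l s = (\<lambda>x. \<Sum>i<3. s i * \<xi> i x)" for s :: "nat \<Rightarrow> 'a"
  define h where "h s = (\<lambda>i::nat. s (i + 3))" for s :: "nat \<Rightarrow> 'a"
  define T where "T i = (\<lambda>x. if i < 3 then G1 x * \<xi> i x else G2 x * \<xi> (i - 3) x)" for i :: nat
  have six: "{..<6::nat} = {0,1,2,3,4,5}" by auto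
  have three: "{..<3::nat} = {0,1,2}" by auto
  have T_sum: "(\<Sum>i<6. T i x * s i) = G1 x * l s x + G2 x * l (h s) x" for s x
    by (simp add: six three T_def l_def h_def algebra_simps)
  have l_form: "hform r (Suc 0) (l s)" for s
    unfolding l_def using \<xi> by (intro hform_sum hform_scale) auto
  have l_b: "l s (b j) = s j" if "j < 3" for s j
  proof -
    have "l s (b j) = (\<Sum>i<3. if i = j then s j else 0)"
      unfolding l_def using that dual by (intro sum.cong) auto
    then show ?thesis using that by simp
  qed
  have syzygy: "G1 z * l s z + G2 z * l (h s) z = 0"
    if s: "\<And>x. x \<in> I \<Longrightarrow> (\<Sum>i<6. T i x * s i) = 0" and z: "z \<in> Z" for s z
  proof (rule Y'(4)[OF _ _ z])
    have "hform r (n + Suc 0) (\<lambda>x. G1 x * l s x)" "hform r (n + Suc 0) (\<lambda>x. G2 x * l (h s) x)"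
      by (rule hform_mult[OF G1(1) l_form] hform_mult[OF G2(1) l_form])+
    then show "hform r (Suc n) (\<lambda>z. G1 z * l s z + G2 z * l (h s) z)"
      using hform_add by simp
    fix x assume x: "x \<in> Y'"
    show "G1 x * l s x + G2 x * l (h s) x = 0"
    proof (cases "x \<in> I")
      case True
      then show ?thesis using s T_sum by simp
    next
      case False
      then have "x \<in> Y - {y1}" "x \<in> Y - {y2}" using x by (auto simp: I_def)
      then show ?thesis using G1(3) G2(3) by simp
    qed
  qed
  have big: "e - n + 2 \<le> card {z \<in> Z. G z \<noteq> 0}" and res: "supports r (e - n) {z \<in> Z. G z \<noteq> 0}"
    if "hform r n G" "x \<in> Z" "G x \<noteq> 0" for G x
  proof -
    have "supports r (n + (e - n)) Z" using sup n by simp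
    from supports_residual[OF this fin that(1)] show *: "supports r (e - n) {z \<in> Z. G z \<noteq> 0}" .
    have "point_set r {z \<in> Z. G z \<noteq> 0}" by (rule point_set_subset[OF Z]) auto
    from card_supports_ge[OF this *] that show "e - n + 2 \<le> card {z \<in> Z. G z \<noteq> 0}" by blast
  qed
  have y1Z: "y1 \<in> Z" and y2Z: "y2 \<in> Z" using y Y(1) by auto
  have G12: "G1 y2 = 0" "G2 y1 = 0" using G1 G2 y by auto

  obtain s j where s: "\<And>x. x \<in> I \<Longrightarrow> (\<Sum>i<6. T i x * s i) = 0" and j: "j < 6" "s j \<noteq> 0"
    using nonzero_solution_underdetermined[OF finI, of "{..<6::nat}" "\<lambda>x i. T i x"] cardI by auto
  \<comment> \<open>The extra equation \<open>s' j = 0\<close> makes the second solution independent of the first; the index \<open>None\<close> stands for it.\<close>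
  obtain s' k where s': "\<And>x. x \<in> I \<Longrightarrow> (\<Sum>i<6. T i x * s' i) = 0" and k: "k < 6" "s' k \<noteq> 0"
    and s'j: "s' j = 0"
  proof -
    let ?a = "\<lambda>x i. case x of None \<Rightarrow> (if i = j then 1 else 0) | Some x \<Rightarrow> T i x"
    have "card (insert None (Some ` I)) < card {..<6::nat}"
      using finI cardI by (simp add: card_insert_if card_image)
    then obtain s' where *: "\<exists>k\<in>{..<6}. s' k \<noteq> 0"
        "\<forall>x\<in>insert None (Some ` I). (\<Sum>i<6. ?a x i * s' i) = 0"
      using nonzero_solution_underdetermined[of "insert None (Some ` I)" "{..<6::nat}" ?a] finI
      by auto
    have "(\<Sum>i<6. ?a None i * s' i) = s' j"
      using j by (simp add: if_distrib[of "\<lambda>y. y * _"] cong: if_cong)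
    then have "s' j = 0" using *(2) by simp
    moreover have "(\<Sum>i<6. T i x * s' i) = 0" if "x \<in> I" for x using *(2) that by auto
    ultimately show thesis using that *(1) by blast
  qed
  have syz: "G1 z * l s z + G2 z * l (h s) z = 0"
    and syz': "G1 z * l s' z + G2 z * l (h s') z = 0" if "z \<in> Z" for z
    using syzygy s s' that by blast+

  have nonzero_on_frame: "\<exists>i<3. f (b i) \<noteq> 0" if f: "hform r (Suc 0) f" "x \<in> W" "f x \<noteq> 0" for f x
  proof (rule ccontr)
    assume "\<not> ?thesis"
    then have zero: "f y = 0" if "y \<in> b ` {..<3}" for y using that by auto
    have "x = (\<Sum>i<3. fun_scale (\<xi> i x) (b i))" using frame f(2) by (auto simp: coordinate_frame_def)
    also have "\<dots> \<in> lspan (b ` {..<3})"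
      by (intro fun_space.span_sum fun_space.span_scale fun_space.span_base) auto
    finally show False using linear_form_kernel_span[OF f(1) zero] f(3) by blast
  qed

  \<comment> \<open>If the pair were \<open>(\<alpha> \<kappa>, \<beta> \<kappa>)\<close>, then \<open>\<alpha> G1 + \<beta> G2\<close> would be nonzero only on the line \<open>\<kappa> = 0\<close>.\<close>
  have proportional: False
    if \<kappa>: "hform r (Suc 0) \<kappa>" "x \<in> W" "\<kappa> x \<noteq> 0" and \<alpha>\<beta>: "\<alpha> \<noteq> 0 \<or> \<beta> \<noteq> 0"
      and l: "\<And>x. x \<in> W \<Longrightarrow> l s x = \<alpha> * \<kappa> x" "\<And>x. x \<in> W \<Longrightarrow> l (h s) x = \<beta> * \<kappa> x"
    for \<kappa> x \<alpha> \<beta>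
  proof -
    let ?G = "\<lambda>x. \<alpha> * G1 x + \<beta> * G2 x"
    have G: "hform r n ?G" using G1(1) G2(1) by (intro hform_add hform_scale)
    have "?G y1 = \<alpha>" "?G y2 = \<beta>" using G1(2) G2(2) G12 by simp_all
    then have "3 \<le> card {z \<in> Z. ?G z \<noteq> 0}"
      using \<alpha>\<beta> big[OF G y1Z] big[OF G y2Z] n by force
    moreover have "{z \<in> Z. ?G z \<noteq> 0} \<subseteq> {z \<in> Z. \<kappa> z = 0}"
    proof clarify
      fix z assume z: "z \<in> Z" "?G z \<noteq> 0"
      have "z \<in> W" using z ZW by auto
      have "?G z * \<kappa> z = 0" using syz[OF z(1)] l[OF \<open>z \<in> W\<close>] by (simp add: algebra_simps)
      then show "\<kappa> z = 0" using z(2) by simp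
    qed
    then have "card {z \<in> Z. ?G z \<noteq> 0} \<le> card {z \<in> Z. \<kappa> z = 0}" using fin by (intro card_mono) auto
    ultimately have "\<not> card {z \<in> Z. \<kappa> z = 0} \<le> 2" by simp
    moreover have "\<not> (\<forall>z\<in>Z. \<kappa> z = 0)" using nonzero_on_frame[OF \<kappa>] bZ by auto
    ultimately show False
      using gen \<kappa>(1) unfolding in_general_position_def by blast
  qed
  have "\<exists>p\<in>W. l s p \<noteq> 0"
  proof (rule ccontr)
    assume neg: "\<not> ?thesis"
    then have "s i = 0" if "i < 3" for i using l_b[OF that, of s] b[OF that] by auto
    then have "\<not> j < 3" using j by auto
    then have "j - 3 < 3" "h s (j - 3) = s j" using j by (auto simp: h_def)
    then have "l (h s) (b (j - 3)) \<noteq> 0" using l_b j by simp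
    then show False
      using proportional[OF l_form b[OF \<open>j - 3 < 3\<close>], of "h s" 0 1] neg by auto
  qed
  then obtain p where p: "p \<in> W" "l s p \<noteq> 0" by blast
  have "\<not> (\<exists>c. \<forall>x\<in>W. l (h s) x = c * l s x)"
    using proportional[OF l_form p, of 1] by auto
  then obtain v w where vw: "v \<in> W" "w \<in> W" "l s v = 1" "l (h s) v = 0" "l s w = 0" "l (h s) w = 1"
    using proportional_or_dual_vectors[OF l_form l_form W p, of "h s"] by blast
  define q where "q x = l s x * l (h s') x - l (h s) x * l s' x" for x
  have q: "hform r 2 q"
    unfolding q_def[abs_def] by (intro hform_diff hform_mult_linear l_form)
  have "\<exists>x\<in>W. q x \<noteq> 0"
  proof (rule ccontr)
    assume "\<not> ?thesis"
    then have "l s x * l (h s') x = l (h s) x * l s' x" if "x \<in> W" for x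
      using that by (simp add: q_def)
    from zero_determinant_proportional[OF l_form l_form l_form l_form W vw this]
    obtain c where c: "\<And>x. x \<in> W \<Longrightarrow> l s' x = c * l s x" "\<And>x. x \<in> W \<Longrightarrow> l (h s') x = c * l (h s) x"
      by blast
    have "s' i = c * s i" if "i < 6" for i
    proof (cases "i < 3")
      case True
      then show ?thesis using c(1)[OF b[OF True]] by (simp add: l_b)
    next
      case False
      then have "i - 3 < 3" using that by simp
      from c(2)[OF b[OF this]] show ?thesis using False by (simp add: l_b[OF \<open>i - 3 < 3\<close>] h_def)
    qed
    then show False using j k s'j by force
  qed
  moreover have "6 \<le> card {z \<in> Z. q z = 0}"
  proof -
    let ?X = "{z \<in> Z. G1 z \<noteq> 0}"
    have X: "point_set r ?X" by (rule point_set_subset[OF Z]) auto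
    have "G1 y1 \<noteq> 0" using G1 by simp
    note big = big[OF G1(1) y1Z this] and res = res[OF G1(1) y1Z this]
    have "\<not> card ?X \<le> 2 * (e - n) + 1"
    proof
      assume *: "card ?X \<le> 2 * (e - n) + 1"
      have "?X \<noteq> {}" using \<open>G1 y1 \<noteq> 0\<close> y1Z by auto
      from supports_small_collinear[OF X res this *] obtain a b
        where ab: "a \<in> Z" "b \<in> Z" "?X \<subseteq> lspan {a, b}" by blast
      have "card ?X \<le> 2"
        by (rule general_position_no_line[OF gen Z ab(1,2) no_line[OF ab(1,2)] _ ab(3)]) auto
      then show False using big n by simp
    qed
    then have "6 \<le> card ?X" using n by simp
    also have "?X \<subseteq> {z \<in> Z. q z = 0}"
    proof clarify
      fix z assume z: "z \<in> Z" "G1 z \<noteq> 0"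
      have 1: "G1 z * l s z = - (G2 z * l (h s) z)" "G1 z * l s' z = - (G2 z * l (h s') z)"
        using syz[OF z(1)] syz'[OF z(1)] by (simp_all add: eq_neg_iff_add_eq_0)
      have "G1 z * q z = (G1 z * l s z) * l (h s') z - l (h s) z * (G1 z * l s' z)"
        by (simp add: q_def algebra_simps)
      also have "\<dots> = 0" unfolding 1 by (simp add: algebra_simps)
      finally show "q z = 0" using z by simp
    qed
    then have "card ?X \<le> card {z \<in> Z. q z = 0}" using fin by (intro card_mono) auto
    finally show ?thesis .
  qed
  ultimately show ?thesis using q by blast
qed

text \<open>If no conic contains six points of \<open>Z\<close>, the Hilbert function grows by at least three in each degree
below \<open>e\<close>, so \<open>3 (e - 1)\<close> points of \<open>Z\<close> impose independent conditions in degree \<open>e - 1\<close>. Multiplication of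
the relation by the three coordinates gives three further dimensions, hence \<open>3 e\<close> points.\<close>

lemma conic_through_six_points:
  assumes Z: "point_set r Z" and sup: "supports r e Z" and gen: "in_general_position r Z"
    and no_line: "\<And>a b. a \<in> Z \<Longrightarrow> b \<in> Z \<Longrightarrow> \<not> Z \<subseteq> lspan {a, b}"
    and frame: "coordinate_frame r W b \<xi>" and ZW: "Z \<subseteq> W" and bZ: "\<And>i. i < 3 \<Longrightarrow> b i \<in> Z"
    and small: "card Z < 3 * e"
  shows "\<exists>q. hform r 2 q \<and> (\<exists>x\<in>W. q x \<noteq> 0) \<and> 6 \<le> card {z \<in> Z. q z = 0}"
proof (rule ccontr)
  assume no_conic: "\<not> ?thesis"
  have fin: "finite Z" using Z by (auto simp: point_set_def)
  have b: "\<And>i. i < 3 \<Longrightarrow> b i \<in> W"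
    and \<xi>: "\<And>i. i < 3 \<Longrightarrow> hform r (Suc 0) (\<xi> i)"
    and dual: "\<And>i j. i < 3 \<Longrightarrow> j < 3 \<Longrightarrow> \<xi> i (b j) = (if i = j then 1 else 0)"
    using frame by (auto simp: coordinate_frame_def)
  have inj: "inj_on b {..<3}"
  proof (rule inj_onI)
    fix i j assume "i \<in> {..<3::nat}" "j \<in> {..<3}" "b i = b j"
    then show "i = j" using dual[of i i] dual[of i j] by (auto split: if_splits)
  qed
  have independent: "\<exists>Y\<subseteq>Z. separated r n Y \<and> 3 * n \<le> card Y" if "1 \<le> n" "n < e" for n
    using that
  proof (induction n rule: dec_induct)
    case base
    have "separated r 1 (b ` {..<3})"
      unfolding separated_def
    proof clarify
      fix i assume "i < (3::nat)"
      then show "\<exists>G. hform r 1 G \<and> G (b i) = 1 \<and> (\<forall>z\<in>b ` {..<3} - {b i}. G z = 0)"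
        using \<xi> dual by (intro exI[of _ "\<xi> i"]) (auto split: if_splits)
    qed
    moreover have "card (b ` {..<3}) = 3" using card_image[OF inj] by simp
    ultimately show ?case using bZ by (intro exI[of _ "b ` {..<3}"]) auto
  next
    case (step n)
    let ?C = "{Y. Y \<subseteq> Z \<and> separated r n Y}"
    from step.IH obtain Y0 where Y0: "Y0 \<subseteq> Z" "separated r n Y0" "3 * n \<le> card Y0"
      using step by (meson Suc_lessD)
    have "\<exists>Y. Y \<in> ?C \<and> (\<forall>X. X \<in> ?C \<longrightarrow> card X \<le> card Y)"
      using Y0 by (intro Lattices_Big.ex_has_greatest_nat[of _ Y0 _ "Suc (card Z)"])
        (auto intro!: le_imp_less_Suc card_mono fin)
    then obtain Y where Y: "Y \<subseteq> Z" "separated r n Y"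
        "\<And>X. X \<subseteq> Z \<Longrightarrow> separated r n X \<Longrightarrow> card X \<le> card Y"
      by auto
    have card: "3 * n \<le> card Y" using Y(3)[OF Y0(1,2)] Y0(3) by simp
    show ?case
    proof (cases "\<exists>Y'\<subseteq>Z. separated r (Suc n) Y' \<and> card Y + 2 < card Y'")
      case True
      then obtain Y' where Y': "Y' \<subseteq> Z" "separated r (Suc n) Y'" "card Y + 2 < card Y'" by blast
      have "3 * Suc n \<le> card Y'" using card Y'(3) by simp
      then show ?thesis using Y'(1,2) by (intro exI[of _ Y'] conjI)
    next
      case False
      have A: "2 \<le> card Y" "n + 2 \<le> e" using card step by simp_all
      have slow: "card Y' \<le> card Y + 2" if "Y' \<subseteq> Z" "separated r (Suc n) Y'" for Y'
        using False that by (meson not_le_imp_less)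
      have "\<exists>q. hform r 2 q \<and> (\<exists>x\<in>W. q x \<noteq> 0) \<and> 6 \<le> card {z \<in> Z. q z = 0}"
        by (rule slow_growth_conic[where \<xi> = \<xi> and b = b]) (fact Z sup gen no_line frame ZW bZ Y A slow)+
      then show ?thesis using no_conic by contradiction
    qed
  qed
  have "2 \<le> e"
  proof -
    have "Z \<noteq> {}" using bZ by force
    then have "e + 2 < 3 * e" using card_supports_ge[OF Z sup] small by simp
    then show ?thesis by simp
  qed
  then have "1 \<le> e - 1" "e - 1 < e" by simp_all
  from independent[OF this] obtain Y
    where Y: "Y \<subseteq> Z" "separated r (e - 1) Y" "3 * (e - 1) \<le> card Y" by blast
  have finY: "finite Y" using Y fin finite_subset by auto
  \<comment> \<open>At most two points lie outside \<open>Y\<close>, so a nonzero linear form vanishes there, and its residual is contained in \<open>Y\<close>.\<close>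
  have "card (Z - Y) < card {..<3::nat}"
    using small Y finY by (simp add: card_Diff_subset)
  then obtain s where s: "\<exists>i<3. s i \<noteq> 0" "\<And>x. x \<in> Z - Y \<Longrightarrow> (\<Sum>i<3. \<xi> i x * s i) = 0"
    using nonzero_solution_underdetermined[of "Z - Y" "{..<3::nat}" "\<lambda>x i. \<xi> i x"] fin by auto
  let ?l = "\<lambda>x. \<Sum>i<3. s i * \<xi> i x"
  have l: "hform r (Suc 0) ?l" using \<xi> by (intro hform_sum hform_scale) auto
  have "supports r (Suc (e - 1)) Z" using sup \<open>2 \<le> e\<close> by simp
  from supports_residual_linear[OF this fin l]
  have "{z \<in> Z. ?l z \<noteq> 0} = {}"
    by (rule supports_subset_separated[OF _ _ _ Y(2)]) (use fin s(2) in \<open>auto simp: mult.commute\<close>)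
  moreover obtain i where i: "i < 3" "s i \<noteq> 0" using s(1) by blast
  moreover have "?l (b i) = (\<Sum>j<3. if j = i then s i else 0)"
    using i dual by (intro sum.cong) auto
  ultimately show False using bZ[OF i(1)] by auto
qed

section \<open>Relations supported on few points\<close>

lemma in_span_pair:
  "x \<in> lspan {u, v} \<longleftrightarrow> (\<exists>\<alpha> \<beta>. x = fun_scale \<alpha> u + fun_scale \<beta> v)"
proof
  assume "x \<in> lspan {u, v}"
  then obtain \<alpha> where "x - fun_scale \<alpha> u \<in> lspan {v}" by (auto simp: fun_space.span_insert)
  then obtain \<beta> where "x - fun_scale \<alpha> u = fun_scale \<beta> v" by (auto simp: fun_space.span_singleton)
  then have "x = fun_scale \<alpha> u + fun_scale \<beta> v" by (simp add: diff_eq_eq add.commute)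
  then show "\<exists>\<alpha> \<beta>. x = fun_scale \<alpha> u + fun_scale \<beta> v" by blast
next
  assume "\<exists>\<alpha> \<beta>. x = fun_scale \<alpha> u + fun_scale \<beta> v"
  then obtain \<alpha> \<beta> where x: "x = fun_scale \<alpha> u + fun_scale \<beta> v" by blast
  show "x \<in> lspan {u, v}"
    unfolding x by (intro fun_space.span_add fun_space.span_scale fun_space.span_base) auto
qed

lemma in_span_triple:
  "x \<in> lspan {u, v, w} \<longleftrightarrow>
     (\<exists>\<alpha> \<beta> \<gamma>. x = fun_scale \<alpha> u + (fun_scale \<beta> v + fun_scale \<gamma> w))"
proof
  assume "x \<in> lspan {u, v, w}"
  then obtain \<alpha> where "x - fun_scale \<alpha> u \<in> lspan {v, w}" by (subst (asm) fun_space.span_insert) auto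
  then obtain \<beta> \<gamma> where "x - fun_scale \<alpha> u = fun_scale \<beta> v + fun_scale \<gamma> w"
    unfolding in_span_pair by blast
  then have "x = fun_scale \<alpha> u + (fun_scale \<beta> v + fun_scale \<gamma> w)"
    by (simp add: diff_eq_eq add_ac)
  then show "\<exists>\<alpha> \<beta> \<gamma>. x = fun_scale \<alpha> u + (fun_scale \<beta> v + fun_scale \<gamma> w)" by blast
next
  assume "\<exists>\<alpha> \<beta> \<gamma>. x = fun_scale \<alpha> u + (fun_scale \<beta> v + fun_scale \<gamma> w)"
  then obtain \<alpha> \<beta> \<gamma> where x: "x = fun_scale \<alpha> u + (fun_scale \<beta> v + fun_scale \<gamma> w)" by blast
  show "x \<in> lspan {u, v, w}"
    unfolding x by (intro fun_space.span_add fun_space.span_scale fun_space.span_base) auto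
qed

lemma coordinate_frame_exists:
  assumes amb: "u \<in> ambient r" "v \<in> ambient r" "w \<in> ambient r"
    and ind: "u \<noteq> 0" "v \<notin> lspan {u}" "w \<notin> lspan {u, v}"
  shows "\<exists>b \<xi>. coordinate_frame r (lspan {u, v, w}) b \<xi> \<and> b 0 = u \<and> b 1 = v \<and> b 2 = w"
proof -
  have "u \<notin> lspan {v}"
    using ind(1,2) fun_space.in_span_insert[of u v "{}"] by auto
  then have u: "u \<notin> lspan {v, w}"
    using fun_space.in_span_insert[of u w "{v}"] ind(3) by (metis insert_commute)
  have v: "v \<notin> lspan {u, w}"
    using fun_space.in_span_insert[of v w "{u}"] ind by (metis insert_commute)
  obtain f0 where f0: "hform r (Suc 0) f0" "\<And>y. y \<in> lspan {v, w} \<Longrightarrow> f0 y = 0" "f0 u = 1"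
    using separating_linear_form[of u r "{v, w}"] amb u by auto
  obtain f1 where f1: "hform r (Suc 0) f1" "\<And>y. y \<in> lspan {u, w} \<Longrightarrow> f1 y = 0" "f1 v = 1"
    using separating_linear_form[of v r "{u, w}"] amb v by auto
  obtain f2 where f2: "hform r (Suc 0) f2" "\<And>y. y \<in> lspan {u, v} \<Longrightarrow> f2 y = 0" "f2 w = 1"
    using separating_linear_form[of w r "{u, v}"] amb ind by auto
  note zero = f0(2)[OF fun_space.span_base] f1(2)[OF fun_space.span_base] f2(2)[OF fun_space.span_base]
  define b where "b i = (if i = 0 then u else if i = 1 then v else w)" for i :: nat
  define \<xi> where "\<xi> i = (if i = 0 then f0 else if i = 1 then f1 else f2)" for i :: nat
  have three: "{..<3::nat} = {0,1,2}" by auto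
  have "x = (\<Sum>i<3. fun_scale (\<xi> i x) (b i))" if "x \<in> lspan {u, v, w}" for x
  proof -
    obtain \<alpha> \<beta> \<gamma> where x: "x = fun_scale \<alpha> u + (fun_scale \<beta> v + fun_scale \<gamma> w)"
      using \<open>x \<in> _\<close> unfolding in_span_triple by blast
    have "f0 x = \<alpha>" "f1 x = \<beta>" "f2 x = \<gamma>"
      unfolding x using zero f0(3) f1(3) f2(3)
      by (simp_all only: linear_form_add[OF f0(1)] linear_form_add[OF f1(1)] linear_form_add[OF f2(1)]
         linear_form_scale[OF f0(1)] linear_form_scale[OF f1(1)] linear_form_scale[OF f2(1)]) simp_all
    then show ?thesis by (simp add: three b_def \<xi>_def x)
  qed
  moreover have "\<forall>i<3. b i \<in> lspan {u, v, w} \<and> hform r (Suc 0) (\<xi> i)"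
    using f0 f1 f2 by (auto simp: b_def \<xi>_def intro: fun_space.span_base)
  moreover have "\<forall>i<3. \<forall>j<3. \<xi> i (b j) = (if i = j then 1 else 0)"
    using zero f0(3) f1(3) f2(3) by (auto simp: b_def \<xi>_def)
  ultimately have "coordinate_frame r (lspan {u, v, w}) b \<xi>"
    unfolding coordinate_frame_def by blast
  then show ?thesis by (intro exI[of _ b] exI[of _ \<xi>]) (auto simp: b_def)
qed

text \<open>The form may be a product of linear forms on the plane, or a square.\<close>

definition plane_conic :: "nat \<Rightarrow> (nat \<Rightarrow> 'a::field) set \<Rightarrow> ((nat \<Rightarrow> 'a) \<Rightarrow> 'a) \<Rightarrow> bool" where
  "plane_conic r W q \<longleftrightarrow> W \<subseteq> ambient r \<and> (\<exists>b \<xi>. coordinate_frame r W b \<xi>) \<and>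
     hform r 2 q \<and> (\<exists>x\<in>W. q x \<noteq> 0)"

lemma quadric_through_plane_conic:
  assumes "plane_conic r W q" "z \<in> ambient r" "z \<notin> W \<or> q z \<noteq> 0"
  obtains Q where "hform r 2 Q" "\<And>x. x \<in> W \<Longrightarrow> q x = 0 \<Longrightarrow> Q x = 0" "Q z \<noteq> 0"
proof (cases "q z = 0")
  case False
  then show thesis using that assms by (auto simp: plane_conic_def)
next
  case True
  have "fun_space.subspace W" using assms by (auto simp: plane_conic_def coordinate_frame_def)
  then have span: "lspan W = W" by (simp add: fun_space.span_eq_iff)
  have "W \<subseteq> ambient r" "z \<notin> lspan W" using assms True unfolding span plane_conic_def by auto
  from separating_linear_form[OF assms(2) this]
  obtain f where f: "hform r (Suc 0) f" "\<And>y. y \<in> W \<Longrightarrow> f y = 0" "f z = 1"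
    unfolding span by blast
  show thesis
    by (rule that[of "\<lambda>x. f x * f x"]) (use f in \<open>auto intro: hform_mult_linear\<close>)
qed

lemma quadric_through_two_lines:
  assumes "{a, b, c, d} \<subseteq> ambient r" "z \<in> ambient r" "z \<notin> lspan {a, b} \<union> lspan {c, d}"
  obtains Q where "hform r 2 Q" "\<And>x. x \<in> lspan {a, b} \<union> lspan {c, d} \<Longrightarrow> Q x = 0" "Q z \<noteq> 0"
proof -
  obtain f where f: "hform r (Suc 0) f" "\<And>y. y \<in> lspan {a, b} \<Longrightarrow> f y = 0" "f z = 1"
    using separating_linear_form[of z r "{a, b}"] assms by auto
  obtain g where g: "hform r (Suc 0) g" "\<And>y. y \<in> lspan {c, d} \<Longrightarrow> g y = 0" "g z = 1"
    using separating_linear_form[of z r "{c, d}"] assms by auto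
  show thesis
    by (rule that[of "\<lambda>x. f x * g x"]) (use f g in \<open>auto intro: hform_mult_linear\<close>)
qed

text \<open>A quadric through \<open>X\<close> that misses one point of \<open>Z\<close> leaves a relation in degree \<open>n\<close> on at most \<open>n + 1\<close>
points, which is impossible.\<close>

lemma few_points_off_quadrics:
  assumes Z: "point_set r Z" and sup: "supports r (Suc (Suc n)) Z"
    and quadric: "\<And>z. z \<in> Z - X \<Longrightarrow> \<exists>Q. hform r 2 Q \<and> (\<forall>x\<in>X. Q x = 0) \<and> Q z \<noteq> 0"
    and few: "card (Z - X) \<le> n + 1"
  shows "Z \<subseteq> X"
proof (rule ccontr)
  assume "\<not> Z \<subseteq> X"
  then obtain z where z: "z \<in> Z - X" by blast
  then obtain Q where Q: "hform r 2 Q" "\<forall>x\<in>X. Q x = 0" "Q z \<noteq> 0" using quadric by blast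
  have fin: "finite Z" using Z by (simp add: point_set_def)
  let ?Y = "{z \<in> Z. Q z \<noteq> 0}"
  have "supports r n ?Y" by (rule supports_residual_quadratic[OF sup fin Q(1)])
  moreover have "point_set r ?Y" by (rule point_set_subset[OF Z]) auto
  moreover have "?Y \<noteq> {}" using z Q by auto
  ultimately have "n + 2 \<le> card ?Y" using card_supports_ge by blast
  also have "\<dots> \<le> card (Z - X)" using fin Q by (intro card_mono) auto
  finally show False using few by simp
qed

definition on_two_lines :: "(nat \<Rightarrow> 'a::field) set \<Rightarrow> bool" where
  "on_two_lines Z \<longleftrightarrow> (\<exists>a\<in>Z. \<exists>b\<in>Z. \<exists>c\<in>Z. \<exists>d\<in>Z. a \<noteq> b \<and> c \<noteq> d \<and> Z \<subseteq> lspan {a, b} \<union> lspan {c, d})"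

definition on_plane_conic :: "nat \<Rightarrow> (nat \<Rightarrow> 'a::field) set \<Rightarrow> bool" where
  "on_plane_conic r Z \<longleftrightarrow> (\<exists>W q. plane_conic r W q \<and> Z \<subseteq> W \<and> (\<forall>z\<in>Z. q z = 0))"

text \<open>A conic \<open>q\<close> through six points lowers the degree by two and the number of points by at least six, so
the induction hypothesis applies to the points off \<open>q\<close>. These cannot lie on two lines, each of which
meets \<open>Z\<close> at most twice, so they lie on a conic with at least \<open>2 (e - 2) + 2\<close> points. Removing the
second conic instead of \<open>q\<close> leaves so few points that they would be collinear, which is excluded.\<close>

lemma plane_conic_general_position:
  fixes Z :: "(nat \<Rightarrow> 'a::field) set"
  assumes Z: "point_set r Z" and sup: "supports r e Z" and gen: "in_general_position r Z"
    and no_line: "\<And>a b. a \<in> Z \<Longrightarrow> b \<in> Z \<Longrightarrow> \<not> Z \<subseteq> lspan {a, b}" and nonempty: "Z \<noteq> {}"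
    and small: "card Z < 3 * e"
    and IH: "\<And>e' (Y :: (nat \<Rightarrow> 'a) set). e' < e \<Longrightarrow> point_set r Y \<Longrightarrow> supports r e' Y \<Longrightarrow> Y \<noteq> {} \<Longrightarrow> card Y < 3 * e' \<Longrightarrow>
        on_two_lines Y \<or> on_plane_conic r Y"
  shows "on_plane_conic r Z"
proof -
  have fin: "finite Z" and amb: "Z \<subseteq> ambient r" and nz: "0 \<notin> Z"
    using Z by (auto simp: point_set_def)
  obtain u v where uv: "u \<in> Z" "v \<in> Z" "u \<noteq> v" using supports_two_points[OF Z sup nonempty] .
  obtain w where w: "w \<in> Z" "w \<notin> lspan {u, v}" using no_line uv by blast
  have "v \<notin> lspan {u}" using Z uv by (auto simp: point_set_def)
  moreover have "u \<noteq> 0" using uv nz by auto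
  ultimately obtain b \<xi> where frame: "coordinate_frame r (lspan {u, v, w}) b \<xi>" "b 0 = u" "b 1 = v" "b 2 = w"
    using coordinate_frame_exists[of u r v w] uv w amb by blast
  let ?W = "lspan {u, v, w}"
  have bZ: "b i \<in> Z" if "i < 3" for i
  proof -
    have "i = 0 \<or> i = 1 \<or> i = 2" using that by auto
    then show ?thesis using frame uv w by auto
  qed
  have uvw: "{u, v, w} \<subseteq> ambient r" using uv w amb by auto
  have ZW: "Z \<subseteq> ?W"
  proof (rule ccontr)
    assume "\<not> Z \<subseteq> ?W"
    then obtain z where z: "z \<in> Z" "z \<notin> ?W" by blast
    then obtain f where f: "hform r (Suc 0) f" "\<And>y. y \<in> ?W \<Longrightarrow> f y = 0" "f z = 1"
      using separating_linear_form[of z r "{u, v, w}"] uvw amb by blast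
    have "f z \<noteq> 0" using f(3) by simp
    with gen f(1) z(1) have "card {z \<in> Z. f z = 0} \<le> 2" unfolding in_general_position_def by blast
    moreover have "w \<noteq> u" "w \<noteq> v" using w(2) by (auto intro: fun_space.span_base)
    then have "card {u, v, w} = 3" using uv by simp
    moreover have "card {u, v, w} \<le> card {z \<in> Z. f z = 0}"
      using uv w f(2) fin by (intro card_mono) (auto intro: fun_space.span_base)
    ultimately show False by simp
  qed
  obtain q where q: "hform r 2 q" "\<exists>x\<in>?W. q x \<noteq> 0" "6 \<le> card {z \<in> Z. q z = 0}"
    using conic_through_six_points[OF Z sup gen no_line frame(1) ZW bZ small] by blast
  have conic: "plane_conic r ?W q"
    unfolding plane_conic_def using q frame(1) span_subset_coord_space[OF uvw] by blast
  show ?thesis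
  proof (cases "{z \<in> Z. q z \<noteq> 0} = {}")
    case True
    then show ?thesis unfolding on_plane_conic_def using conic ZW by blast
  next
    case False
    let ?Y = "{z \<in> Z. q z \<noteq> 0}"
    have "card {z \<in> Z. q z = 0} + card ?Y = card Z"
      using fin by (subst card_Un_disjoint[symmetric]) (auto intro: arg_cong[of _ _ card])
    then have cardY: "card ?Y + 6 \<le> card Z" using q(3) by simp
    then have e: "3 \<le> e" using small by simp
    define n where "n = e - 2"
    have n: "e = Suc (Suc n)" "1 \<le> n" using e by (auto simp: n_def)
    have Y: "point_set r ?Y" by (rule point_set_subset[OF Z]) auto
    have supY: "supports r n ?Y" by (rule supports_residual_quadratic[OF sup[unfolded n(1)] fin q(1)])
    have on_line: "card X \<le> 2" if "X \<subseteq> Z" "a \<in> Z" "b \<in> Z" "X \<subseteq> lspan {a, b}" for X a b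
      using general_position_no_line[OF gen Z that(2,3) no_line[OF that(2,3)] that(1,4)] .
    have not_collinear: "2 * n + 2 \<le> card X"
      if X: "X \<subseteq> Z" "supports r n X" "X \<noteq> {}" for X
    proof (rule ccontr)
      assume "\<not> ?thesis"
      then have "card X \<le> 2 * n + 1" by simp
      note PX = point_set_subset[OF Z X(1)]
      from supports_small_collinear[OF PX X(2,3) \<open>card X \<le> 2 * n + 1\<close>]
      obtain a b where "a \<in> X" "b \<in> X" "X \<subseteq> lspan {a, b}" by blast
      then have "card X \<le> 2" using on_line[of X a b] X(1) by blast
      then show False using card_supports_ge[OF PX X(2,3)] n by simp
    qed
    have big: "2 * n + 2 \<le> card ?Y" by (rule not_collinear[OF _ supY False]) auto
    have "on_two_lines ?Y \<or> on_plane_conic r ?Y"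
    proof (rule IH)
      show "n < e" using n by simp
      show "card ?Y < 3 * n" using cardY small n by simp
    qed (fact Y supY False)+
    then show ?thesis
    proof
      assume "on_two_lines ?Y"
      then obtain a b c d where abcd: "a \<in> ?Y" "b \<in> ?Y" "c \<in> ?Y" "d \<in> ?Y"
        "?Y \<subseteq> lspan {a, b} \<union> lspan {c, d}" unfolding on_two_lines_def by blast
      have "card ?Y = card ((?Y \<inter> lspan {a, b}) \<union> (?Y \<inter> lspan {c, d}))"
        using abcd(5) by (intro arg_cong[of _ _ card]) blast
      also have "\<dots> \<le> card (?Y \<inter> lspan {a, b}) + card (?Y \<inter> lspan {c, d})" by (rule card_Un_le)
      also have "\<dots> \<le> 2 + 2" using abcd(1-4) by (intro add_mono on_line[of _ a b] on_line[of _ c d]) auto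
      finally have "n = 1" using big n by simp
      then show ?thesis using big cardY small n by simp
    next
      assume "on_plane_conic r ?Y"
      then obtain W' q' where W': "plane_conic r W' q'" "?Y \<subseteq> W'" "\<And>z. z \<in> ?Y \<Longrightarrow> q' z = 0"
        unfolding on_plane_conic_def by blast
      show ?thesis
      proof (rule ccontr)
        assume "\<not> ?thesis"
        then obtain z where z: "z \<in> Z" "z \<notin> W' \<or> q' z \<noteq> 0" using W'(1) unfolding on_plane_conic_def by blast
        have zamb: "z \<in> ambient r" using z amb by auto
        obtain Q where Q: "hform r 2 Q" "\<And>x. x \<in> W' \<Longrightarrow> q' x = 0 \<Longrightarrow> Q x = 0" "Q z \<noteq> 0"
          using quadric_through_plane_conic[OF W'(1) zamb z(2)] by blast
        let ?X = "{z \<in> Z. Q z \<noteq> 0}"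
        have "supports r n ?X" by (rule supports_residual_quadratic[OF sup[unfolded n(1)] fin Q(1)])
        moreover have "?X \<noteq> {}" using z Q by auto
        ultimately have "2 * n + 2 \<le> card ?X" by (intro not_collinear) auto
        also have "\<dots> \<le> card (Z - ?Y)"
          using fin Q(2) W'(2,3) by (intro card_mono) auto
        also have "\<dots> = card Z - card ?Y" using fin by (intro card_Diff_subset) auto
        finally show False using big small n cardY by simp
      qed
    qed
  qed
qed

text \<open>This is the classification behind the whole argument. The induction removes a hyperplane through at
least three points, which preserves the bound \<open>card Z < 3 e\<close>. Either the remaining points are collinear,
and removing their line shows that the others are collinear too, or they are so numerous that the
quadrics through the lines or the conic which contain them must contain \<open>Z\<close>. If there is no such
hyperplane, \<open>Z\<close> is a plane set without three collinear points.\<close>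

lemma supports_on_two_lines_or_conic:
  assumes "point_set r Z" "supports r e Z" "Z \<noteq> {}" "card Z < 3 * e"
  shows "on_two_lines Z \<or> on_plane_conic r Z"
  using assms
proof (induction e arbitrary: Z rule: less_induct)
  case (less e Z)
  note Z = less.prems(1) and sup = less.prems(2) and nonempty = less.prems(3) and small = less.prems(4)
  have fin: "finite Z" and amb: "Z \<subseteq> ambient r" using Z by (auto simp: point_set_def)
  \<comment> \<open>The lower bound on the number of points and \<open>card Z < 3 e\<close> exclude \<open>e \<le> 1\<close>.\<close>
  define n where "n = e - 2"
  have e: "e = Suc (Suc n)"
    using card_supports_ge[OF Z sup nonempty] small by (simp add: n_def)
  show ?case
  proof (cases "\<exists>a\<in>Z. \<exists>b\<in>Z. a \<noteq> b \<and> Z \<subseteq> lspan {a, b}")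
    case True
    then show ?thesis unfolding on_two_lines_def by blast
  next
    case no_line: False
    have two_lines: "on_two_lines Z"
      if "a \<in> Z" "b \<in> Z" "c \<in> Z" "d \<in> Z" "a \<noteq> b" "c \<noteq> d"
        "card (Z - (lspan {a, b} \<union> lspan {c, d})) \<le> n + 1" for a b c d
    proof -
      have "Z \<subseteq> lspan {a, b} \<union> lspan {c, d}"
      proof (rule few_points_off_quadrics[OF Z sup[unfolded e] _ that(7)])
        fix z assume z: "z \<in> Z - (lspan {a, b} \<union> lspan {c, d})"
        have *: "{a, b, c, d} \<subseteq> ambient r" "z \<in> ambient r" "z \<notin> lspan {a, b} \<union> lspan {c, d}"
          using that z amb by auto
        show "\<exists>Q. hform r 2 Q \<and> (\<forall>x\<in>lspan {a, b} \<union> lspan {c, d}. Q x = 0) \<and> Q z \<noteq> 0"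
          by (rule quadric_through_two_lines[OF *]) (intro exI conjI ballI)
      qed
      then show ?thesis unfolding on_two_lines_def using that by blast
    qed
    show ?thesis
    proof (cases "in_general_position r Z")
      case True
      have "\<not> Z \<subseteq> lspan {a, b}" if "a \<in> Z" "b \<in> Z" for a b
      proof
        assume Zab: "Z \<subseteq> lspan {a, b}"
        obtain x y where xy: "x \<in> Z" "y \<in> Z" "x \<noteq> y" using supports_two_points[OF Z sup nonempty] .
        show False
        proof (cases "a = b")
          case True
          then have "x \<in> lspan {a}" "y \<in> lspan {a}" using Zab xy by auto
          then have "x = a" "y = a" using Z xy(1,2) that(1) unfolding point_set_def by blast+
          then show False using xy(3) by simp
        next
          case False
          then show False using no_line that Zab by blast
        qed
      qed
      then have "on_plane_conic r Z"
        by (rule plane_conic_general_position[OF Z sup True _ nonempty small less.IH])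
      then show ?thesis ..
    next
      case False
      then obtain f z where f: "hform r (Suc 0) f" "\<not> card {z \<in> Z. f z = 0} \<le> 2"
        and z: "z \<in> Z" "f z \<noteq> 0"
        unfolding in_general_position_def by blast
      let ?Y = "{z \<in> Z. f z \<noteq> 0}"
      have "card {z \<in> Z. f z = 0} + card ?Y = card Z"
        using fin by (subst card_Un_disjoint[symmetric]) (auto intro: arg_cong[of _ _ card])
      then have cardY: "card ?Y + 3 \<le> card Z" using f(2) by simp
      have Y: "point_set r ?Y" by (rule point_set_subset[OF Z]) auto
      have supY: "supports r (Suc n) ?Y" by (rule supports_residual_linear[OF sup[unfolded e] fin f(1)])
      have neY: "?Y \<noteq> {}" using z by auto
      have diff: "card (Z - ?Y) = card Z - card ?Y" using fin by (intro card_Diff_subset) auto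
      show ?thesis
      proof (cases "card ?Y \<le> 2 * Suc n + 1")
        case True
        obtain a b where ab: "a \<in> ?Y" "b \<in> ?Y" "a \<noteq> b" "?Y \<subseteq> lspan {a, b}"
          using supports_small_collinear[OF Y supY neY True] by blast
        have bigY: "Suc n + 2 \<le> card ?Y" by (rule card_supports_ge[OF Y supY neY])
        obtain x where x: "x \<in> Z" "x \<notin> lspan {a, b}" using no_line ab by blast
        have "{a, b} \<subseteq> ambient r" "x \<in> ambient r" using ab x amb by auto
        then obtain g where g: "hform r (Suc 0) g" "\<And>y. y \<in> lspan {a, b} \<Longrightarrow> g y = 0" "g x = 1"
          using separating_linear_form[of x r "{a, b}"] x by blast
        let ?X = "{z \<in> Z. g z \<noteq> 0}"
        have X: "point_set r ?X" by (rule point_set_subset[OF Z]) auto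
        have supX: "supports r (Suc n) ?X" by (rule supports_residual_linear[OF sup[unfolded e] fin g(1)])
        have neX: "?X \<noteq> {}" using x g by auto
        have sub: "?X \<subseteq> Z - ?Y" using ab(4) g(2) by auto
        have "card ?X \<le> card (Z - ?Y)" using sub fin by (intro card_mono) auto
        then have "card ?X \<le> 2 * Suc n + 1" using diff bigY small e by simp
        from supports_small_collinear[OF X supX neX this]
        obtain c d where cd: "c \<in> ?X" "d \<in> ?X" "c \<noteq> d" "?X \<subseteq> lspan {c, d}" by blast
        have bigX: "Suc n + 2 \<le> card ?X" by (rule card_supports_ge[OF X supX neX])
        have "card (Z - (lspan {a, b} \<union> lspan {c, d})) \<le> card ((Z - ?Y) - ?X)"
          using fin ab(4) cd(4) by (intro card_mono) auto
        also have "\<dots> = card Z - card ?Y - card ?X"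
          unfolding diff[symmetric] using fin sub by (intro card_Diff_subset) auto
        also have "\<dots> \<le> n + 1" using bigX bigY small e by simp
        finally have "on_two_lines Z" using two_lines[of a b c d] ab cd by blast
        then show ?thesis ..
      next
        case False
        have rest: "card (Z - X) \<le> n + 1" if "?Y \<subseteq> X" for X
        proof -
          have "card (Z - X) \<le> card (Z - ?Y)" using that fin by (intro card_mono) auto
          then show ?thesis using diff False small e by simp
        qed
        have "on_two_lines ?Y \<or> on_plane_conic r ?Y"
        proof (rule less.IH)
          show "Suc n < e" using e by simp
          show "card ?Y < 3 * Suc n" using cardY small e by simp
        qed (fact Y supY neY)+
        then show ?thesis
        proof
          assume "on_two_lines ?Y"
          then obtain a b c d where "a \<in> ?Y" "b \<in> ?Y" "c \<in> ?Y" "d \<in> ?Y" "a \<noteq> b" "c \<noteq> d"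
            "?Y \<subseteq> lspan {a, b} \<union> lspan {c, d}" unfolding on_two_lines_def by blast
          then have "on_two_lines Z" using two_lines[of a b c d] rest by blast
          then show ?thesis ..
        next
          assume "on_plane_conic r ?Y"
          then obtain W q where W: "plane_conic r W q" "?Y \<subseteq> {x \<in> W. q x = 0}"
            unfolding on_plane_conic_def by blast
          have "Z \<subseteq> {x \<in> W. q x = 0}"
          proof (rule few_points_off_quadrics[OF Z sup[unfolded e] _ rest[OF W(2)]])
            fix z assume z: "z \<in> Z - {x \<in> W. q x = 0}"
            have "z \<in> ambient r" using z amb by auto
            then obtain Q where "hform r 2 Q" "\<And>x. x \<in> W \<Longrightarrow> q x = 0 \<Longrightarrow> Q x = 0" "Q z \<noteq> 0"
              using quadric_through_plane_conic[OF W(1)] z by blast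
            then show "\<exists>Q. hform r 2 Q \<and> (\<forall>x\<in>{x \<in> W. q x = 0}. Q x = 0) \<and> Q z \<noteq> 0" by blast
          qed
          then show ?thesis unfolding on_plane_conic_def using W(1) by blast
        qed
      qed
    qed
  qed
qed

section \<open>Pencils of binary forms\<close>

definition root_poly :: "'a::field set \<Rightarrow> 'a poly" where
  "root_poly V = (\<Prod>v\<in>V. [:- v, 1:])"

lemma root_poly_zero_iff: "finite V \<Longrightarrow> poly (root_poly V) x = 0 \<longleftrightarrow> x \<in> V"
  by (auto simp: root_poly_def poly_prod)

lemma root_poly_lead: "lead_coeff (root_poly V) = 1"
  by (simp add: root_poly_def lead_coeff_prod)

lemma root_poly_nonzero: "root_poly V \<noteq> 0"
  using root_poly_lead[of V] by auto

lemma root_poly_degree: "degree (root_poly V) = card V"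
  unfolding root_poly_def by (subst degree_prod_eq_sum_degree) auto

lemma poly_zero_many_roots:
  fixes p :: "'a::field poly"
  assumes "finite U" "\<And>u. u \<in> U \<Longrightarrow> poly p u = 0" "degree p < card U"
  shows "p = 0"
proof (rule ccontr)
  assume p: "p \<noteq> 0"
  have "card U \<le> card {x. poly p x = 0}"
    using assms p by (intro card_mono poly_roots_finite) auto
  also have "\<dots> \<le> degree p" by (rule card_poly_roots_bound[OF p])
  finally show False using assms by simp
qed

lemma poly_pderiv_linear_mult: "poly (pderiv ([:- x, 1:] * p)) x = poly p (x :: 'a::field)"
  unfolding pderiv_mult by (simp add: pderiv_pCons algebra_simps)

lemma poly_pderiv_root_poly_nonzero:
  fixes U :: "'a::field set"
  assumes "finite U" "u \<in> U"
  shows "poly (pderiv (root_poly U)) u \<noteq> 0"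
proof -
  have "root_poly U = [:- u, 1:] * root_poly (U - {u})"
    using assms by (simp add: root_poly_def prod.remove)
  then have "poly (pderiv (root_poly U)) u = poly (root_poly (U - {u})) u"
    by (simp only: poly_pderiv_linear_mult)
  then show ?thesis using root_poly_zero_iff[of "U - {u}" u] assms by simp
qed

lemma squarefree_monic_eq_root_poly:
  fixes p :: "'a::{alg_closed_field, field_char_0} poly"
  assumes "lead_coeff p = 1" "\<And>x. \<not> (poly p x = 0 \<and> poly (pderiv p) x = 0)"
  shows "\<exists>V. finite V \<and> card V = degree p \<and> p = root_poly V"
proof -
  have p0: "p \<noteq> 0" using assms by auto
  obtain A where A: "size A = degree p" "p = smult (lead_coeff p) (\<Prod>x\<in>#A. [:- x, 1:])"
    using alg_closed_imp_factorization[OF p0] by blast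
  have p: "p = (\<Prod>x\<in>#A. [:- x, 1:])" using A(2) assms(1) by simp
  have "count A x \<le> 1" for x
  proof (rule ccontr)
    assume "\<not> ?thesis"
    then have "x \<in># A" "x \<in># A - {#x#}" by (auto simp flip: count_greater_zero_iff)
    then obtain B where "A = add_mset x (add_mset x B)" by (metis insert_DiffM)
    then have "p = [:- x, 1:] * ([:- x, 1:] * (\<Prod>x\<in>#B. [:- x, 1:]))"
      using p by (simp only: image_mset_add_mset prod_mset.add_mset)
    then have "poly p x = 0 \<and> poly (pderiv p) x = 0"
      by (simp only: poly_pderiv_linear_mult) simp
    then show False using assms(2) by blast
  qed
  then have "A = mset_set (set_mset A)"
    by (intro multiset_eqI) (auto simp: count_mset_set' count_eq_zero_iff le_Suc_eq)
  then have "p = root_poly (set_mset A)" "degree p = card (set_mset A)"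
    using p A(1) unfolding root_poly_def prod_unfold_prod_mset by (metis, metis size_mset_set)
  then show ?thesis by auto
qed

text \<open>A multiple root of \<open>f + l g\<close> is a root of the Wronskian of \<open>f\<close> and \<open>g\<close>, which is nonzero at a root of \<open>f\<close>
where \<open>g\<close> does not vanish. At each of the finitely many roots of the Wronskian only one value of \<open>l\<close> is
possible, because \<open>f\<close> has simple roots.\<close>

lemma pencil_root_poly:
  fixes g :: "'a::{alg_closed_field, field_char_0} poly"
  assumes U: "finite U" and g: "g \<noteq> 0" "degree g < card U"
  shows "finite {l. \<not> (\<exists>V. finite V \<and> card V = card U \<and> root_poly U + smult l g = root_poly V)}"
proof -
  let ?f = "root_poly U"
  define W where "W = ?f * pderiv g - pderiv ?f * g"
  obtain u where u: "u \<in> U" "poly g u \<noteq> 0"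
    using poly_zero_many_roots[OF U _ g(2)] g(1) by blast
  have "poly W u \<noteq> 0"
    using u root_poly_zero_iff[OF U, of u] poly_pderiv_root_poly_nonzero[OF U u(1)]
    by (simp add: W_def)
  then have finW: "finite {x. poly W x = 0}" by (intro poly_roots_finite) auto
  define B where "B x = {l. poly ?f x + l * poly g x = 0 \<and> poly (pderiv ?f) x + l * poly (pderiv g) x = 0}" for x
  have finB: "finite (B x)" for x
  proof -
    have "l = l'" if "l \<in> B x" "l' \<in> B x" for l l'
    proof (cases "poly g x = 0")
      case False
      have "(l - l') * poly g x = (poly ?f x + l * poly g x) - (poly ?f x + l' * poly g x)"
        by (simp add: algebra_simps)
      also have "\<dots> = 0" using that by (simp only: B_def mem_Collect_eq) simp
      finally have "(l - l') * poly g x = 0" .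
      then show ?thesis using False by simp
    next
      case True
      then have "poly ?f x = 0" using that by (simp add: B_def)
      then have "poly (pderiv ?f) x \<noteq> 0"
        using root_poly_zero_iff[OF U] poly_pderiv_root_poly_nonzero[OF U] by blast
      then have nz: "poly (pderiv g) x \<noteq> 0" using that by (auto simp: B_def)
      have "(l - l') * poly (pderiv g) x = (poly (pderiv ?f) x + l * poly (pderiv g) x) -
          (poly (pderiv ?f) x + l' * poly (pderiv g) x)"
        by (simp add: algebra_simps)
      also have "\<dots> = 0" using that by (simp only: B_def mem_Collect_eq) simp
      finally have "(l - l') * poly (pderiv g) x = 0" .
      then show ?thesis using nz by simp
    qed
    then have "B x \<subseteq> {l}" if "l \<in> B x" for l using that by blast
    then show ?thesis by (metis finite.emptyI finite.insertI finite_subset equals0I)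
  qed
  have "{l. \<not> (\<exists>V. finite V \<and> card V = card U \<and> ?f + smult l g = root_poly V)}
      \<subseteq> (\<Union>x\<in>{x. poly W x = 0}. B x)"
  proof clarify
    fix l assume l: "\<not> (\<exists>V. finite V \<and> card V = card U \<and> ?f + smult l g = root_poly V)"
    let ?p = "?f + smult l g"
    have small: "degree (smult l g) < degree ?f"
      using g(2) root_poly_degree[of U] degree_smult_le[of l g] by simp
    then have deg: "degree ?p = card U" by (simp add: degree_add_eq_left root_poly_degree)
    have "lead_coeff ?p = 1"
      using root_poly_lead[of U] coeff_eq_0[OF g(2)] unfolding deg root_poly_degree
      by simp
    then obtain x where x: "poly ?p x = 0" "poly (pderiv ?p) x = 0"
      using squarefree_monic_eq_root_poly[of ?p] l deg by auto
    then have "x \<in> {x. poly W x = 0}" "l \<in> B x"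
    proof -
      show "l \<in> B x" using x by (simp add: B_def pderiv_add pderiv_smult)
      then have "poly ?f x = - (l * poly g x)" "poly (pderiv ?f) x = - (l * poly (pderiv g) x)"
        by (simp_all add: B_def eq_neg_iff_add_eq_0)
      then show "x \<in> {x. poly W x = 0}" by (simp add: W_def)
    qed
    then show "l \<in> (\<Union>x\<in>{x. poly W x = 0}. B x)" by blast
  qed
  then show ?thesis using finW finB by (meson finite_UN_I finite_subset)
qed

definition poly_functional :: "('a::field poly \<Rightarrow> 'a) \<Rightarrow> bool" where
  "poly_functional Q \<longleftrightarrow> (\<forall>p q. Q (p + q) = Q p + Q q) \<and> (\<forall>c p. Q (smult c p) = c * Q p)"

lemma poly_functional_smult: "poly_functional Q \<Longrightarrow> Q (smult c p) = c * Q p"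
  by (simp add: poly_functional_def)

lemma poly_functional_zero: "poly_functional Q \<Longrightarrow> Q 0 = 0"
  using poly_functional_smult[of Q 0 0] by simp

lemma poly_functional_sum:
  assumes "poly_functional Q"
  shows "Q (\<Sum>i\<in>I. f i) = (\<Sum>i\<in>I. Q (f i))"
proof -
  show ?thesis
    using assms poly_functional_zero[OF assms] by (induction I rule: infinite_finite_induct) (auto simp: poly_functional_def)
qed

definition lagrange_poly :: "'a::field set \<Rightarrow> 'a \<Rightarrow> 'a poly" where
  "lagrange_poly V v = smult (1 / poly (root_poly (V - {v})) v) (root_poly (V - {v}))"

lemma poly_lagrange:
  "finite V \<Longrightarrow> v \<in> V \<Longrightarrow> w \<in> V \<Longrightarrow> poly (lagrange_poly V v) w = (if v = w then 1 else 0)"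
  using root_poly_zero_iff[of "V - {v}"] by (auto simp: lagrange_poly_def)

lemma degree_lagrange: "finite V \<Longrightarrow> v \<in> V \<Longrightarrow> degree (lagrange_poly V v) < card V"
  using degree_smult_le[of "1 / poly (root_poly (V - {v})) v" "root_poly (V - {v})"]
    root_poly_degree[of "V - {v}"] card_gt_0_iff[of V]
  by (auto simp: lagrange_poly_def)

text \<open>The apolarity lemma for binary forms: a functional that kills the multiples of a polynomial with
simple roots depends only on remainders, which Lagrange interpolation recovers from the values at the
roots.\<close>

lemma functional_supported_on_roots:
  assumes Q: "poly_functional Q" and V: "finite V"
    and ann: "\<And>j. card V + j \<le> n \<Longrightarrow> Q (root_poly V * monom 1 j) = 0"
  shows "\<exists>c. \<forall>h. degree h \<le> n \<longrightarrow> Q h = (\<Sum>v\<in>V. c v * poly h v)"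
proof (intro exI allI impI)
  fix h :: "'a poly" assume h: "degree h \<le> n"
  let ?g = "root_poly V"
  let ?a = "h div ?g" and ?b = "h mod ?g"
  let ?L = "\<Sum>v\<in>V. smult (poly h v) (lagrange_poly V v)"
  have L: "poly ?L w = poly h w" if "w \<in> V" for w
  proof -
    have "poly ?L w = (\<Sum>v\<in>V. if v = w then poly h w else 0)"
      unfolding poly_sum using V that by (intro sum.cong) (auto simp: poly_lagrange)
    then show ?thesis using V that by simp
  qed
  have b: "poly ?b w = poly h w" if "w \<in> V" for w
  proof -
    have "poly ?g w = 0" using that root_poly_zero_iff[OF V, of w] by simp
    then show ?thesis by (metis add_0 mult_zero_left mult_div_mod_eq poly_add poly_mult)
  qed
  have "?b = ?L"
  proof (cases "V = {}")
    case True
    then show ?thesis by (simp add: root_poly_def)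
  next
    case False
    then have pos: "0 < card V" using V by auto
    have "degree ?b < card V"
      using degree_mod_less'[of ?g h] root_poly_nonzero[of V] root_poly_degree[of V] pos
      by (cases "?b = 0") auto
    moreover have "degree ?L < card V"
      using degree_smult_le le_less_trans degree_lagrange[OF V] pos
      by (intro degree_sum_less) blast+
    ultimately have "degree (?b - ?L) < card V" by (rule degree_diff_less)
    then have "?b - ?L = 0"
      using L b by (intro poly_zero_many_roots[OF V]) auto
    then show ?thesis by simp
  qed
  moreover have "Q (?g * ?a) = 0"
  proof -
    have "?g * ?a = (\<Sum>i\<le>degree ?a. smult (coeff ?a i) (?g * monom 1 i))"
      by (subst poly_as_sum_of_monoms[symmetric]) (simp add: sum_distrib_left smult_monom flip: mult_smult_right)
    then have "Q (?g * ?a) = (\<Sum>i\<le>degree ?a. Q (smult (coeff ?a i) (?g * monom 1 i)))"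
      using poly_functional_sum[OF Q] by simp
    also have "\<dots> = 0"
    proof (intro sum.neutral ballI)
      fix i assume i: "i \<in> {..degree ?a}"
      show "Q (smult (coeff ?a i) (?g * monom 1 i)) = 0"
      proof (cases "?a = 0")
        case True
        then show ?thesis using poly_functional_zero[OF Q] by simp
      next
        case False
        then have "degree (?g * ?a) = card V + degree ?a"
          by (simp add: degree_mult_eq root_poly_nonzero root_poly_degree)
        moreover have "degree (?g * ?a + ?b) = degree (?g * ?a)" if "?b \<noteq> 0"
          using degree_mod_less'[OF root_poly_nonzero that] calculation
          by (intro degree_add_eq_left) (simp add: root_poly_degree)
        ultimately have "degree h = card V + degree ?a"
          using mult_div_mod_eq[of ?g h] by (cases "?b = 0") auto
        then have "card V + i \<le> n" using i h by simp
        then show ?thesis using Q ann unfolding poly_functional_def by simp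
      qed
    qed
    finally show ?thesis .
  qed
  ultimately have "Q h = Q ?L"
    using Q mult_div_mod_eq[of ?g h] unfolding poly_functional_def by (metis add_0)
  also have "\<dots> = (\<Sum>v\<in>V. Q (lagrange_poly V v) * poly h v)"
    unfolding poly_functional_sum[OF Q] using Q by (simp add: poly_functional_def mult.commute)
  finally show "Q h = (\<Sum>v\<in>V. Q (lagrange_poly V v) * poly h v)" .
qed

text \<open>The functional \<open>Q l\<close> may move with the parameter. It is constant when one point is decomposed in
infinitely many ways, and it moves along the line through a further point in the case of two lines.\<close>

lemma pencil_of_decompositions:
  fixes U :: "'a::{alg_closed_field, field_char_0} set" and Q :: "'a \<Rightarrow> 'a poly \<Rightarrow> 'a"
  assumes U: "finite U" and g: "g \<noteq> 0" "degree g < card U"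
    and Q: "\<And>l. poly_functional (Q l)"
    and ann: "\<And>l j. card U + j \<le> n \<Longrightarrow> Q l ((root_poly U + smult l g) * monom 1 j) = 0"
  shows "\<exists>B V. finite B \<and> inj_on V (- B) \<and> (\<forall>l. l \<notin> B \<longrightarrow> finite (V l) \<and> card (V l) = card U \<and>
    (\<exists>c. \<forall>h. degree h \<le> n \<longrightarrow> Q l h = (\<Sum>v\<in>V l. c v * poly h v)))"
proof -
  define R where "R l V \<longleftrightarrow> finite V \<and> card V = card U \<and> root_poly U + smult l g = root_poly V" for l V
  define B where "B = {l. \<not> (\<exists>V. R l V)}"
  define V where "V l = (SOME V. R l V)" for l
  have V: "R l (V l)" if "l \<notin> B" for l
    using that someI_ex[of "R l"] unfolding B_def V_def by blast
  have "finite B" unfolding B_def R_def by (rule pencil_root_poly[OF U g])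
  moreover have "inj_on V (- B)"
  proof (rule inj_onI)
    fix l l' assume l: "l \<in> - B" "l' \<in> - B" "V l = V l'"
    have "root_poly U + smult l g = root_poly U + smult l' g"
      using V[of l] V[of l'] l by (simp add: R_def)
    then have "smult (l - l') g = 0" by (simp add: smult_diff_left)
    then show "l = l'" using g by simp
  qed
  moreover have "\<exists>c. \<forall>h. degree h \<le> n \<longrightarrow> Q l h = (\<Sum>v\<in>V l. c v * poly h v)" if "l \<notin> B" for l
    using V[OF that] ann[of _ l] by (intro functional_supported_on_roots[OF Q]) (auto simp: R_def)
  moreover have "finite (V l) \<and> card (V l) = card U" if "l \<notin> B" for l
    using V[OF that] by (simp add: R_def)
  ultimately show ?thesis by (intro exI[of _ B] exI[of _ V]) simp
qed

lemma poly_expand_below: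
  fixes p :: "'a::field poly"
  assumes "degree p < k"
  shows "p = (\<Sum>i<k. smult (coeff p i) (monom 1 i))"
proof -
  have "p = (\<Sum>i\<le>k - 1. monom (coeff p i) i)"
    using poly_as_sum_of_monoms'[of p "k - 1"] assms by simp
  moreover have "{..k - 1} = {..<k}" using assms by auto
  ultimately have "p = (\<Sum>i<k. monom (coeff p i) i)" by simp
  also have "\<dots> = (\<Sum>i<k. smult (coeff p i) (monom 1 i))" by (simp add: smult_monom)
  finally show ?thesis .
qed

text \<open>The polynomials of degree less than \<open>card U\<close> that are annihilated by \<open>Q\<close> form the solution space of
\<open>n + 1 - card U\<close> equations in \<open>card U\<close> unknowns. A nonzero solution spans, together with the polynomial
whose roots are the points of \<open>U\<close>, a pencil of annihilating polynomials.\<close>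

lemma infinitely_many_decompositions:
  fixes U :: "'a::{alg_closed_field, field_char_0} set"
  assumes U: "finite U" and n: "n + 2 \<le> 2 * card U"
  shows "infinite {V. finite V \<and> card V = card U \<and>
    (\<exists>c'. \<forall>h. degree h \<le> n \<longrightarrow> (\<Sum>u\<in>U. c u * poly h u) = (\<Sum>v\<in>V. c' v * poly h v))}"
proof -
  let ?k = "card U"
  define Q where "Q h = (\<Sum>u\<in>U. c u * poly h u)" for h
  have Q: "poly_functional Q"
    unfolding poly_functional_def Q_def by (auto simp: algebra_simps sum.distrib sum_distrib_left)
  have "card {..<n + 1 - ?k} < card {..<?k}" using n by auto
  from nonzero_solution_underdetermined[OF _ _ this, of "\<lambda>j i. Q (monom 1 (i + j))"]
  obtain x where x: "\<exists>i<?k. x i \<noteq> 0"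
    "\<And>j. j < n + 1 - ?k \<Longrightarrow> (\<Sum>i<?k. Q (monom 1 (i + j)) * x i) = 0" by auto
  define g where "g = (\<Sum>i<?k. monom (x i) i)"
  have coeff_g: "coeff g i = (if i < ?k then x i else 0)" for i
    by (simp add: g_def coeff_sum)
  have g0: "g \<noteq> 0" using x(1) coeff_g by (metis coeff_0)
  have "degree g \<le> ?k - 1" by (rule degree_le) (auto simp: coeff_g)
  moreover have "0 < ?k" using x(1) by auto
  ultimately have deg: "degree g < ?k" by simp
  have ann: "Q ((root_poly U + smult l g) * monom 1 j) = 0" if "?k + j \<le> n" for l j
  proof -
    have "Q (root_poly U * monom 1 j) = 0"
      unfolding Q_def using root_poly_zero_iff[OF U] by (intro sum.neutral) auto
    moreover have "Q (g * monom 1 j) = 0"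
    proof -
      have "g * monom 1 j = (\<Sum>i<?k. smult (x i) (monom 1 (i + j)))"
        by (simp add: g_def sum_distrib_right mult_monom smult_monom)
      then have "Q (g * monom 1 j) = (\<Sum>i<?k. Q (monom 1 (i + j)) * x i)"
        by (simp only: poly_functional_sum[OF Q] poly_functional_smult[OF Q] mult.commute)
      then show ?thesis using x(2) that by simp
    qed
    ultimately show ?thesis using Q by (simp add: poly_functional_def distrib_right)
  qed
  have "\<exists>(B :: 'a set) V. finite B \<and> inj_on V (- B) \<and> (\<forall>l. l \<notin> B \<longrightarrow> finite (V l) \<and> card (V l) = card U \<and>
    (\<exists>c. \<forall>h. degree h \<le> n \<longrightarrow> Q h = (\<Sum>v\<in>V l. c v * poly h v)))"
    by (rule pencil_of_decompositions[where Q = "\<lambda>_. Q" and n = n, OF U g0 deg Q ann])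
  then obtain B :: "'a set" and V where BV: "finite B" "inj_on V (- B)"
    "\<forall>l. l \<notin> B \<longrightarrow> finite (V l) \<and> card (V l) = card U \<and>
      (\<exists>c. \<forall>h. degree h \<le> n \<longrightarrow> Q h = (\<Sum>v\<in>V l. c v * poly h v))"
    by blast
  have "infinite (- B)" using BV(1) infinite_UNIV_char_0 by (metis Compl_eq_Diff_UNIV finite_Diff2)
  then have "infinite (V ` (- B))" using BV(2) by (simp add: finite_image_iff)
  moreover have "V ` (- B) \<subseteq> {V. finite V \<and> card V = card U \<and>
    (\<exists>c'. \<forall>h. degree h \<le> n \<longrightarrow> (\<Sum>u\<in>U. c u * poly h u) = (\<Sum>v\<in>V. c' v * poly h v))}"
    using BV(3) unfolding Q_def by auto
  ultimately show ?thesis using infinite_super by blast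
qed

text \<open>Reading the coefficient of degree \<open>n\<close> is evaluation at infinity. Now there are as many
equations as unknowns, and a given functional has only one decomposition of this size; adding a
variable multiple of the evaluation at infinity gives a pencil back.\<close>

lemma decompositions_with_point_at_infinity:
  fixes U :: "'a::{alg_closed_field, field_char_0} set"
  assumes U: "finite U" "U \<noteq> {}" and c: "\<And>u. u \<in> U \<Longrightarrow> c u \<noteq> 0" and n: "n + 1 = 2 * card U"
  shows "\<exists>B V. finite B \<and> inj_on V (- B) \<and> (\<forall>l. l \<notin> B \<longrightarrow> finite (V l) \<and> card (V l) = card U \<and>
    (\<exists>c'. \<forall>h. degree h \<le> n \<longrightarrow>
       (\<Sum>u\<in>U. c u * poly h u) + l * coeff h n = (\<Sum>v\<in>V l. c' v * poly h v)))"
proof -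
  let ?k = "card U"
  have k: "0 < ?k" using U by (simp add: card_gt_0_iff)
  define Q0 where "Q0 h = (\<Sum>u\<in>U. c u * poly h u)" for h
  define Q where "Q l h = Q0 h + l * coeff h n" for l h
  have Q0: "poly_functional Q0"
    unfolding poly_functional_def Q0_def by (auto simp: algebra_simps sum.distrib sum_distrib_left)
  have Q: "poly_functional (Q l)" for l
    using Q0 unfolding poly_functional_def Q_def by (auto simp: algebra_simps)
  \<comment> \<open>The last unknown is the factor by which evaluation at infinity enters the equations.\<close>
  define a where "a j i = (if i = ?k then (if j = ?k - 1 then 1 else 0) else Q0 (monom 1 (i + j)))" for i j
  have "card {..<?k} < card {..?k}" by simp
  from nonzero_solution_underdetermined[OF _ _ this, of a]
  obtain x where x: "\<exists>i\<le>?k. x i \<noteq> 0" "\<And>j. j < ?k \<Longrightarrow> (\<Sum>i\<le>?k. a j i * x i) = 0" by auto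
  define g where "g = (\<Sum>i<?k. monom (x i) i)"
  have coeff_g: "coeff g i = (if i < ?k then x i else 0)" for i
    by (simp add: g_def coeff_sum)
  have "degree g \<le> ?k - 1" by (rule degree_le) (auto simp: coeff_g)
  then have deg: "degree g < ?k" using k by simp
  have Q0g: "Q0 (g * monom 1 j) = - (if j = ?k - 1 then x ?k else 0)" if "j < ?k" for j
  proof -
    have "g * monom 1 j = (\<Sum>i<?k. smult (x i) (monom 1 (i + j)))"
      by (simp add: g_def sum_distrib_right mult_monom smult_monom)
    then have "Q0 (g * monom 1 j) = (\<Sum>i<?k. Q0 (monom 1 (i + j)) * x i)"
      by (simp only: poly_functional_sum[OF Q0] poly_functional_smult[OF Q0] mult.commute)
    also have "\<dots> = (\<Sum>i<?k. a j i * x i)" by (intro sum.cong) (auto simp: a_def)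
    finally have "Q0 (g * monom 1 j) + (if j = ?k - 1 then x ?k else 0) = (\<Sum>i\<le>?k. a j i * x i)"
      by (simp add: a_def flip: lessThan_Suc_atMost)
    then show ?thesis using x(2)[OF that] by (simp add: eq_neg_iff_add_eq_0)
  qed
  \<comment> \<open>Otherwise \<open>g\<close> would annihilate \<open>Q0\<close> in all degrees, hence vanish on \<open>U\<close>.\<close>
  have xk: "x ?k \<noteq> 0"
  proof
    assume xk: "x ?k = 0"
    have zero: "Q0 (g * p) = 0" if p: "degree p < ?k" for p
    proof -
      have "g * p = (\<Sum>i<?k. smult (coeff p i) (g * monom 1 i))"
        by (subst poly_expand_below[OF p]) (simp add: sum_distrib_left)
      then have "Q0 (g * p) = (\<Sum>i<?k. Q0 (smult (coeff p i) (g * monom 1 i)))"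
        using poly_functional_sum[OF Q0] by simp
      also have "\<dots> = 0" using Q0 Q0g xk by (intro sum.neutral) (auto simp: poly_functional_def)
      finally show ?thesis .
    qed
    have "poly g u = 0" if u: "u \<in> U" for u
    proof -
      have "0 = (\<Sum>v\<in>U. c v * (poly g v * poly (lagrange_poly U u) v))"
        using zero[OF degree_lagrange[OF U(1) u]] by (simp add: Q0_def)
      also have "\<dots> = (\<Sum>v\<in>U. if v = u then c u * poly g u else 0)"
        using U u by (intro sum.cong) (auto simp: poly_lagrange)
      also have "\<dots> = c u * poly g u" using U u by simp
      finally show ?thesis using c[OF u] by simp
    qed
    then have "g = 0" using poly_zero_many_roots[OF U(1) _ deg] by blast
    then have "x i = 0" if "i < ?k" for i using coeff_g[of i] that by simp
    then show False using x(1) xk by (metis le_neq_implies_less)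
  qed
  define g1 where "g1 = smult (1 / x ?k) g"
  have deg1: "degree g1 < ?k" using deg by (simp add: g1_def)
  have Q0g1: "Q0 (g1 * monom 1 j) = - (if j = ?k - 1 then 1 else 0)" if "j < ?k" for j
    using Q0 Q0g[OF that] xk by (simp add: g1_def poly_functional_def)
  have g1: "g1 \<noteq> 0"
  proof
    assume "g1 = 0"
    then show False using Q0g1[of "?k - 1"] k by (simp add: Q0_def)
  qed
  have ann: "Q l ((root_poly U + smult l g1) * monom 1 j) = 0" if j: "?k + j \<le> n" for l j
  proof -
    have j': "j < ?k" using j n by simp
    have "Q0 (root_poly U * monom 1 j) = 0"
      unfolding Q0_def using root_poly_zero_iff[OF U(1)] by (intro sum.neutral) auto
    then have "Q0 ((root_poly U + smult l g1) * monom 1 j) = - (if j = ?k - 1 then l else 0)"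
      using Q0 Q0g1[OF j'] by (simp add: poly_functional_def distrib_right)
    moreover have "coeff ((root_poly U + smult l g1) * monom 1 j) n = (if j = ?k - 1 then 1 else 0)"
    proof -
      have "coeff ((root_poly U + smult l g1) * monom 1 j) n = coeff (root_poly U + smult l g1) (n - j)"
        using j by (simp add: mult.commute[of _ "monom 1 j"] coeff_monom_mult)
      also have "n - j \<ge> ?k" using j by simp
      then have "coeff (root_poly U + smult l g1) (n - j) = coeff (root_poly U) (n - j)"
        using deg1 by (simp add: coeff_eq_0)
      also have "\<dots> = (if j = ?k - 1 then 1 else 0)"
      proof (cases "j = ?k - 1")
        case True
        then have "n - j = degree (root_poly U)" using n k by (simp add: root_poly_degree)
        then show ?thesis using True root_poly_lead[of U] by simp
      next
        case False
        then have "degree (root_poly U) < n - j" using n j j' by (simp add: root_poly_degree)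
        then show ?thesis using False by (simp add: coeff_eq_0)
      qed
      finally show ?thesis .
    qed
    ultimately show ?thesis by (simp add: Q_def)
  qed
  show ?thesis
    unfolding Q0_def[symmetric] Q_def[symmetric]
    by (rule pencil_of_decompositions[where Q = Q and n = n, OF U(1) g1 deg1 Q ann])
qed

section \<open>Minimal decompositions\<close>

lemma monomial_power_form: "hform r k (\<lambda>x. x i ^ k)" if "i \<le> r"
proof (induction k)
  case 0
  show ?case using hform_const[of r 1] by simp
next
  case (Suc k)
  then show ?case using hform_coord[OF that Suc.IH] by simp
qed

lemma monomial_hform:
  assumes "\<alpha> \<in> monomials r d"
  shows "hform r d (\<lambda>x. \<Prod>i\<le>r. x i ^ \<alpha> i)"
proof -
  have "hform r (\<Sum>i\<in>S. \<alpha> i) (\<lambda>x. \<Prod>i\<in>S. x i ^ \<alpha> i)" if "finite S" "S \<subseteq> {..r}" for S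
    using that
  proof (induction S rule: finite_induct)
    case empty
    then show ?case using hform_const[of r 1] by simp
  next
    case (insert i S)
    then show ?case using hform_mult[OF monomial_power_form[of i r "\<alpha> i"]] by simp
  qed
  from this[of "{..r}"] show ?thesis using assms by (simp add: monomials_def)
qed

lemma monomial_relations_imp_form_relations:
  fixes v :: "'i \<Rightarrow> nat \<Rightarrow> 'a::field"
  assumes "hform r n G"
  shows "(\<And>\<alpha>. \<alpha> \<in> monomials r n \<Longrightarrow> (\<Sum>i\<in>I. c i * (\<Prod>j\<le>r. v i j ^ \<alpha> j)) = 0) \<Longrightarrow>
    (\<Sum>i\<in>I. c i * G (v i)) = 0"
  using assms
proof (induction n G arbitrary: c rule: hform.induct)
  case (hform_const a)
  have "(\<lambda>_. 0) \<in> monomials r 0" by (simp add: monomials_def)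
  from hform_const[OF this] have "(\<Sum>i\<in>I. c i) = 0" by simp
  then show ?case by (simp flip: sum_distrib_right)
next
  case (hform_coord k n g)
  have "(\<Sum>i\<in>I. (c i * v i k) * g (v i)) = 0"
  proof (rule hform_coord.IH)
    fix \<alpha> assume \<alpha>: "\<alpha> \<in> monomials r n"
    let ?\<beta> = "\<alpha>(k := Suc (\<alpha> k))"
    have k: "k \<in> {..r}" using hform_coord by simp
    have "(\<Sum>i\<le>r. ?\<beta> i) = Suc (\<Sum>i\<le>r. \<alpha> i)"
      using k by (simp add: sum.remove[of "{..r}" k])
    then have \<beta>: "?\<beta> \<in> monomials r (Suc n)" using \<alpha> k by (auto simp: monomials_def)
    have "(\<Prod>j\<le>r. x j ^ ?\<beta> j) = x k * (\<Prod>j\<le>r. x j ^ \<alpha> j)" for x :: "nat \<Rightarrow> 'a"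
      using k by (simp add: prod.remove[of "{..r}" k])
    then show "(\<Sum>i\<in>I. (c i * v i k) * (\<Prod>j\<le>r. v i j ^ \<alpha> j)) = 0"
      using hform_coord.prems[OF \<beta>] by (simp add: mult.assoc)
  qed
  then show ?case by (simp add: mult.assoc)
next
  case (hform_add n f g)
  then show ?case by (simp add: distrib_left sum.distrib)
qed

lemma fun_sum_apply: "(\<Sum>i\<in>I. f i) x = (\<Sum>i\<in>I. f i x)"
  by (induction I rule: infinite_finite_induct) auto

text \<open>Relations among the Veronese images are the relations in degree \<open>d\<close> studied above.\<close>

lemma veronese_relation_iff:
  fixes v :: "'i \<Rightarrow> nat \<Rightarrow> 'a::field"
  shows "(\<Sum>i\<in>I. fun_scale (c i) (veronese_vec r d (v i))) = 0 \<longleftrightarrow>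
    (\<forall>G. hform r d G \<longrightarrow> (\<Sum>i\<in>I. c i * G (v i)) = 0)"
proof -
  have "(\<Sum>i\<in>I. fun_scale (c i) (veronese_vec r d (v i))) \<alpha> =
      (if \<alpha> \<in> monomials r d then \<Sum>i\<in>I. c i * (\<Prod>j\<le>r. v i j ^ \<alpha> j) else 0)" for \<alpha>
    by (simp add: fun_sum_apply fun_scale_def veronese_vec_def)
  then have "(\<Sum>i\<in>I. fun_scale (c i) (veronese_vec r d (v i))) = 0 \<longleftrightarrow>
      (\<forall>\<alpha>\<in>monomials r d. (\<Sum>i\<in>I. c i * (\<Prod>j\<le>r. v i j ^ \<alpha> j)) = 0)"
    by (simp add: fun_eq_iff Ball_def)
  then show ?thesis
    using monomial_hform[of _ r d] monomial_relations_imp_form_relations[where I = I and c = c and v = v and n = d and r = r] by blast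
qed

lemma veronese_span_singleton: "veronese r d (lspan {u}) = lspan {veronese_vec r d u}"
proof -
  have "veronese_vec r d ` lspan {u} \<subseteq> lspan {veronese_vec r d u}"
    by (auto simp: fun_space.span_singleton veronese_vec_scale)
  moreover have "{veronese_vec r d u} \<subseteq> lspan (veronese_vec r d ` lspan {u})"
    by (simp add: fun_space.span_base)
  ultimately show ?thesis unfolding veronese_def by (intro fun_space.span_eq[THEN iffD2] conjI)
qed

lemma in_span_image_iff:
  assumes "finite V"
  shows "x \<in> lspan (g ` V) \<longleftrightarrow> (\<exists>c. x = (\<Sum>v\<in>V. fun_scale (c v) (g v)))"
proof
  assume x: "x \<in> lspan (g ` V)"
  show "\<exists>c. x = (\<Sum>v\<in>V. fun_scale (c v) (g v))"
    using assms x
  proof (induction V arbitrary: x rule: finite_induct)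
    case empty
    then show ?case by simp
  next
    case (insert v V)
    then obtain k where "x - fun_scale k (g v) \<in> lspan (g ` V)"
      by (auto simp: fun_space.span_insert)
    then obtain c where c: "x - fun_scale k (g v) = (\<Sum>v\<in>V. fun_scale (c v) (g v))"
      using insert.IH by blast
    have "x = fun_scale k (g v) + (\<Sum>v\<in>V. fun_scale (c v) (g v))"
      unfolding c[symmetric] by simp
    also have "\<dots> = (\<Sum>w\<in>insert v V. fun_scale ((c(v := k)) w) (g w))"
    proof -
      have "(\<Sum>v\<in>V. fun_scale (c v) (g v)) = (\<Sum>w\<in>V. fun_scale ((c(v := k)) w) (g w))"
        using insert(2) by (intro sum.cong) auto
      then show ?thesis using insert(1,2) by simp
    qed
    finally show ?case by blast
  qed
next
  assume "\<exists>c. x = (\<Sum>v\<in>V. fun_scale (c v) (g v))"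
  then obtain c where x: "x = (\<Sum>v\<in>V. fun_scale (c v) (g v))" by blast
  show "x \<in> lspan (g ` V)"
    unfolding x by (intro fun_space.span_sum fun_space.span_scale fun_space.span_base) auto
qed

lemma span_Union_span: "lspan (\<Union>v\<in>V. lspan {g v}) = lspan (g ` V)"
proof (rule fun_space.span_eq[THEN iffD2], intro conjI)
  show "(\<Union>v\<in>V. lspan {g v}) \<subseteq> lspan (g ` V)"
    by (intro UN_least fun_space.span_mono) auto
  show "g ` V \<subseteq> lspan (\<Union>v\<in>V. lspan {g v})"
    by (auto intro!: fun_space.span_base)
qed

lemma span_singleton_in_proj_span_iff:
  assumes "x \<noteq> 0"
  shows "lspan {x} \<in> proj_span S \<longleftrightarrow> x \<in> lspan (\<Union>S)"
proof -
  have "proj_point (lspan {x})" using assms by (auto simp: proj_point_iff)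
  moreover have "lspan {x} \<subseteq> lspan (\<Union>S) \<longleftrightarrow> x \<in> lspan (\<Union>S)"
    using fun_space.span_base[of x "{x}"] fun_space.span_minimal[of "{x}" "lspan (\<Union>S)"]
      fun_space.subspace_span[of "\<Union>S"] by auto
  ultimately show ?thesis by (simp add: proj_span_def)
qed

definition rep :: "('i \<Rightarrow> 'a::field) set \<Rightarrow> 'i \<Rightarrow> 'a" where
  "rep p = (SOME x. x \<noteq> 0 \<and> p = lspan {x})"

lemma rep_proj_point:
  assumes "proj_point p"
  shows "rep p \<noteq> 0" "lspan {rep p} = p"
proof -
  have "\<exists>x. x \<noteq> 0 \<and> p = lspan {x}" using assms by (simp add: proj_point_iff)
  from someI_ex[OF this] show "rep p \<noteq> 0" "lspan {rep p} = p" by (simp_all add: rep_def)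
qed

lemma rep_Pr:
  assumes "p \<in> Pr r"
  shows "rep p \<noteq> 0" "lspan {rep p} = p" "rep p \<in> ambient r"
proof -
  have p: "proj_point p" "p \<subseteq> ambient r" using assms by (auto simp: proj_space_def)
  show *: "rep p \<noteq> 0" "lspan {rep p} = p" using rep_proj_point[OF p(1)] by auto
  show "rep p \<in> ambient r" using p(2) * fun_space.span_base[of "rep p" "{rep p}"] by auto
qed

lemma span_singleton_Pr: "x \<in> ambient r \<Longrightarrow> x \<noteq> 0 \<Longrightarrow> lspan {x} \<in> Pr r"
  using span_subset_coord_space[of "{x}" "{..r}"] by (auto simp: proj_space_def proj_point_iff)

lemma span_singleton_eq:
  assumes "x \<in> lspan {y}" "x \<noteq> 0"
  shows "lspan {x} = lspan {y}"
proof -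
  obtain k where k: "x = fun_scale k y" using assms by (auto simp: fun_space.span_singleton)
  have "k \<noteq> 0" using k assms by auto
  then have "y = fun_scale (1 / k) x" using k by (simp add: fun_space.scale_scale[symmetric])
  then have "y \<in> lspan {x}" by (metis fun_space.span_base fun_space.span_scale insertI1)
  then show ?thesis using assms(1) by (intro fun_space.span_eq[THEN iffD2]) simp
qed

lemma point_set_rep:
  assumes "finite A" "A \<subseteq> Pr r"
  shows "point_set r (rep ` A)"
  unfolding point_set_def
proof (intro conjI ballI impI)
  fix x y assume x: "x \<in> rep ` A" and y: "y \<in> rep ` A" and xy: "x \<in> lspan {y}"
  obtain p q where pq: "p \<in> A" "q \<in> A" "x = rep p" "y = rep q" using x y by blast
  have "p \<in> Pr r" "q \<in> Pr r" using pq assms by auto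
  then have "lspan {x} = p" "lspan {y} = q" "x \<noteq> 0" using pq rep_Pr by simp_all
  then show "x = y" using span_singleton_eq[OF xy] pq by metis
next
  have "rep p \<in> ambient r" "rep p \<noteq> 0" if "p \<in> A" for p
    using rep_Pr[of p r] assms(2) that by auto
  then show "rep ` A \<subseteq> ambient r" "0 \<notin> rep ` A" by auto
qed (use assms in simp)

lemma inj_on_rep: "inj_on rep (Pr r)"
  by (rule inj_onI) (metis rep_Pr(2))

abbreviation vero :: "nat \<Rightarrow> nat \<Rightarrow> (nat \<Rightarrow> 'a::field) set \<Rightarrow> (nat \<Rightarrow> nat) \<Rightarrow> 'a" where
  "vero r d p \<equiv> veronese_vec r d (rep p)"

lemma in_proj_span_family_iff:
  assumes "finite V" "x \<noteq> 0"
  shows "lspan {x} \<in> proj_span (veronese r d ` (\<lambda>v. lspan {\<phi> v}) ` V) \<longleftrightarrow>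
    (\<exists>c. x = (\<Sum>v\<in>V. fun_scale (c v) (veronese_vec r d (\<phi> v))))"
proof -
  have "\<Union>(veronese r d ` (\<lambda>v. lspan {\<phi> v}) ` V) = (\<Union>v\<in>V. lspan {veronese_vec r d (\<phi> v)})"
    by (auto simp: veronese_span_singleton)
  then show ?thesis
    using span_singleton_in_proj_span_iff[OF assms(2)]
      span_Union_span[of "\<lambda>v. veronese_vec r d (\<phi> v)" V]
      in_span_image_iff[OF assms(1), of x "\<lambda>v. veronese_vec r d (\<phi> v)"] by simp
qed

lemma in_proj_span_iff:
  assumes "finite A" "A \<subseteq> Pr r" "x \<noteq> 0"
  shows "lspan {x} \<in> proj_span (veronese r d ` A) \<longleftrightarrow>
    (\<exists>c. x = (\<Sum>p\<in>A. fun_scale (c p) (vero r d p)))"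
proof -
  have "(\<lambda>p. lspan {rep p}) ` A = (\<lambda>p. p) ` A"
    using assms(2) rep_Pr(2) by (intro image_cong) auto
  then show ?thesis using in_proj_span_family_iff[OF assms(1,3), of r d rep] by simp
qed

lemma rank_wrt_le:
  assumes "finite S" "S \<subseteq> X" "Q \<in> proj_span S"
  shows "rank_wrt X Q \<le> card S"
  unfolding rank_wrt_def using assms by (intro Least_le) blast

lemma rank_wrt_attained:
  assumes "finite S" "S \<subseteq> X" "Q \<in> proj_span S"
  obtains S' where "finite S'" "S' \<subseteq> X" "Q \<in> proj_span S'" "card S' = rank_wrt X Q"
proof -
  have "\<exists>S'. finite S' \<and> S' \<subseteq> X \<and> card S' = rank_wrt X Q \<and> Q \<in> proj_span S'"
    unfolding rank_wrt_def
    by (rule LeastI[of "\<lambda>n. \<exists>S'. finite S' \<and> S' \<subseteq> X \<and> card S' = n \<and> Q \<in> proj_span S'" "card S"])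
      (use assms in blast)
  then show thesis using that by blast
qed

lemma sr_le_card:
  assumes "finite B" "B \<subseteq> Pr r" "Q \<in> proj_span (veronese r d ` B)"
  shows "sr r d Q \<le> card B"
proof -
  have "sr r d Q \<le> card (veronese r d ` B)"
    unfolding sr_def veronese_variety_def using assms by (intro rank_wrt_le) auto
  also have "\<dots> \<le> card B" by (rule card_image_le[OF assms(1)])
  finally show ?thesis .
qed

lemma computing_setsI:
  assumes "A \<in> computing_sets r d Q" "finite B" "B \<subseteq> Pr r" "Q \<in> proj_span (veronese r d ` B)"
    "card B \<le> card A"
  shows "B \<in> computing_sets r d Q"
  using assms sr_le_card[OF assms(2-4)] by (simp add: computing_sets_def)

lemma computing_setsD:
  assumes "A \<in> computing_sets r d Q"
  shows "finite A" "A \<subseteq> Pr r" "Q \<in> proj_span (veronese r d ` A)"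
    "\<And>B. finite B \<Longrightarrow> B \<subseteq> Pr r \<Longrightarrow> Q \<in> proj_span (veronese r d ` B) \<Longrightarrow> card A \<le> card B"
  using assms sr_le_card by (auto simp: computing_sets_def)

lemma computing_sets_minimalI:
  assumes "finite A" "A \<subseteq> Pr r" "Q \<in> proj_span (veronese r d ` A)"
    and min: "\<And>B. finite B \<Longrightarrow> B \<subseteq> Pr r \<Longrightarrow> Q \<in> proj_span (veronese r d ` B) \<Longrightarrow> card A \<le> card B"
  shows "A \<in> computing_sets r d Q"
proof -
  have "veronese r d ` A \<subseteq> veronese_variety r d" using assms(2) by (auto simp: veronese_variety_def)
  then obtain S where S: "finite S" "S \<subseteq> veronese_variety r d" "Q \<in> proj_span S"
      "card S = sr r d Q"
    unfolding sr_def by (rule rank_wrt_attained[OF finite_imageI[OF assms(1)] _ assms(3)])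
  then obtain B where B: "B \<subseteq> Pr r" "S = veronese r d ` B" "inj_on (veronese r d) B"
    unfolding veronese_variety_def by (meson subset_image_inj)
  have "finite B" "card B = card S" using B S by (simp_all add: finite_image_iff card_image)
  then have "card A \<le> sr r d Q" using min[of B] B S by simp
  moreover have "sr r d Q \<le> card A" using sr_le_card assms by blast
  ultimately show ?thesis using assms by (simp add: computing_sets_def)
qed

lemma zero_sum_extend:
  assumes "finite A" "B \<subseteq> A"
  shows "(\<Sum>p\<in>B. fun_scale (c p) (g p)) = (\<Sum>p\<in>A. fun_scale (if p \<in> B then c p else 0) (g p))"
  using assms by (intro sum.mono_neutral_cong_left) auto

locale minimal_decomposition =
  fixes r d :: nat and A :: "(nat \<Rightarrow> 'a::field) set set" and x :: "(nat \<Rightarrow> nat) \<Rightarrow> 'a" and a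
  assumes computing: "A \<in> computing_sets r d (lspan {x})" and nonzero: "x \<noteq> 0"
    and sum_eq: "x = (\<Sum>p\<in>A. fun_scale (a p) (vero r d p))"
begin

lemmas finite_A = computing_setsD(1)[OF computing] and A_Pr = computing_setsD(2)[OF computing]

lemma card_minimal:
  assumes "finite B" "B \<subseteq> Pr r" "x = (\<Sum>p\<in>B. fun_scale (b p) (vero r d p))"
  shows "card A \<le> card B"
  using computing_setsD(4)[OF computing assms(1,2)] in_proj_span_iff[OF assms(1,2) nonzero, of d] assms(3)
  by blast

lemma coeff_nonzero:
  assumes "p \<in> A"
  shows "a p \<noteq> 0"
proof
  assume "a p = 0"
  then have "x = (\<Sum>p\<in>A - {p}. fun_scale (a p) (vero r d p))"
    using sum_eq finite_A assms by (simp add: sum.remove)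
  then have "card A \<le> card (A - {p})" using finite_A A_Pr by (intro card_minimal) auto
  then show False using assms finite_A by (metis card_Diff1_less leD)
qed

text \<open>A relation among the images could be used to cancel one of the points of \<open>A\<close>.\<close>

lemma independent:
  assumes rel: "(\<Sum>p\<in>A. fun_scale (c p) (vero r d p)) = 0" and p: "p \<in> A"
  shows "c p = 0"
proof (rule ccontr)
  assume cp: "c p \<noteq> 0"
  let ?b = "\<lambda>q. a q - a p / c p * c q"
  have "x = x - fun_scale (a p / c p) (\<Sum>q\<in>A. fun_scale (c q) (vero r d q))"
    unfolding rel by simp
  also have "\<dots> = (\<Sum>q\<in>A. fun_scale (?b q) (vero r d q))"
    by (subst sum_eq)
      (simp add: fun_space.scale_sum_right fun_space.scale_left_diff_distrib sum_subtractf)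
  also have "\<dots> = (\<Sum>q\<in>A - {p}. fun_scale (?b q) (vero r d q))"
    using finite_A p cp by (simp add: sum.remove)
  finally have "x = (\<Sum>q\<in>A - {p}. fun_scale (?b q) (vero r d q))" .
  then have "card A \<le> card (A - {p})" using finite_A A_Pr by (intro card_minimal) auto
  then show False using p finite_A by (metis card_Diff1_less leD)
qed

definition part :: "(nat \<Rightarrow> 'a) set set \<Rightarrow> (nat \<Rightarrow> nat) \<Rightarrow> 'a" where
  "part B = (\<Sum>p\<in>B. fun_scale (a p) (vero r d p))"

lemma part_split: "B \<subseteq> A \<Longrightarrow> x = part B + part (A - B)"
  using sum_eq sum.subset_diff[of B A "\<lambda>p. fun_scale (a p) (vero r d p)"] finite_A
  by (simp add: part_def add.commute)

lemma part_nonzero: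
  assumes "B \<subseteq> A" "B \<noteq> {}"
  shows "part B \<noteq> 0"
proof
  assume "part B = 0"
  then have "(\<Sum>p\<in>A. fun_scale (if p \<in> B then a p else 0) (vero r d p)) = 0"
    using zero_sum_extend[OF finite_A assms(1), of a "vero r d"] by (simp add: part_def)
  moreover obtain p where "p \<in> B" using assms by auto
  ultimately have "a p = 0" using independent[of "\<lambda>p. if p \<in> B then a p else 0" p] assms by auto
  then show False using coeff_nonzero \<open>p \<in> B\<close> assms by auto
qed

text \<open>Replacing the points of \<open>B\<close> by any other decomposition of their part again decomposes \<open>x\<close>, so by
minimality no decomposition of the part is shorter than \<open>B\<close>.\<close>

lemma part_replace:
  assumes B: "B \<subseteq> A" "B \<noteq> {}" and E: "finite E" "E \<subseteq> Pr r" "lspan {part B} \<in> proj_span (veronese r d ` E)"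
  shows "lspan {x} \<in> proj_span (veronese r d ` (E \<union> (A - B)))" "card B \<le> card E"
proof -
  obtain e where e: "part B = (\<Sum>p\<in>E. fun_scale (e p) (vero r d p))"
    using in_proj_span_iff[OF E(1,2) part_nonzero[OF B], of d] E(3) by blast
  let ?U = "E \<union> (A - B)"
  have U: "finite ?U" "?U \<subseteq> Pr r" using E finite_A A_Pr by auto
  have "x = part B + part (A - B)" by (rule part_split[OF B(1)])
  also have "\<dots> = (\<Sum>p\<in>?U. fun_scale ((if p \<in> E then e p else 0) + (if p \<in> A - B then a p else 0)) (vero r d p))"
    unfolding e
    unfolding part_def
    using zero_sum_extend[OF U(1), of E e "vero r d"] zero_sum_extend[OF U(1), of "A - B" a "vero r d"]
    by (simp add: fun_space.scale_left_distrib sum.distrib)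
  finally have eq: "x = \<dots>" .
  show "lspan {x} \<in> proj_span (veronese r d ` ?U)"
    by (rule in_proj_span_iff[OF U nonzero, THEN iffD2], rule exI, rule eq)
  have "card A \<le> card ?U" using card_minimal[OF U eq] .
  also have "\<dots> \<le> card E + card (A - B)" by (rule card_Un_le)
  also have "card (A - B) = card A - card B"
    using B finite_A by (intro card_Diff_subset) (auto intro: finite_subset)
  finally show "card B \<le> card E" using card_mono[OF finite_A B(1)] by simp
qed

lemma part_computing:
  assumes B: "B \<subseteq> A" "B \<noteq> {}"
  shows "B \<in> computing_sets r d (lspan {part B})"
proof (rule computing_sets_minimalI)
  show fin: "finite B" "B \<subseteq> Pr r" using B finite_A A_Pr by (auto intro: finite_subset)
  show "lspan {part B} \<in> proj_span (veronese r d ` B)"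
    using in_proj_span_iff[OF fin part_nonzero[OF B], of d] by (auto simp: part_def)
  show "card B \<le> card E"
    if "finite E" "E \<subseteq> Pr r" "lspan {part B} \<in> proj_span (veronese r d ` E)" for E
    by (rule part_replace(2)[OF B that])
qed

text \<open>Both claims come from one count: \<open>E \<union> (A - B)\<close> decomposes \<open>x\<close> and so has at least as many elements as
\<open>A\<close>, while \<open>E\<close> has as many as \<open>B\<close>.\<close>

lemma part_exchange:
  assumes B: "B \<subseteq> A" "B \<noteq> {}" and E: "E \<in> computing_sets r d (lspan {part B})"
  shows "E \<inter> (A - B) = {}" "E \<union> (A - B) \<in> computing_sets r d (lspan {x})"
proof -
  note E' = computing_setsD[OF E]
  have fin: "finite B" using B finite_A by (auto intro: finite_subset)
  have "card E \<le> card B"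
    using E'(4) computing_setsD(1-3)[OF part_computing[OF B]] by blast
  moreover have U: "finite (E \<union> (A - B))" "E \<union> (A - B) \<subseteq> Pr r" using E' finite_A A_Pr by auto
  note * = part_replace(1)[OF B E'(1-3)]
  have "card A \<le> card (E \<union> (A - B))" by (rule computing_setsD(4)[OF computing U *])
  moreover have "card (E \<union> (A - B)) + card (E \<inter> (A - B)) = card E + card (A - B)"
    using card_Un_Int[OF E'(1), of "A - B"] finite_A by simp
  moreover have "card (A - B) = card A - card B" "card B \<le> card A"
    using B finite_A fin by (auto intro: card_Diff_subset card_mono)
  ultimately have "card (E \<inter> (A - B)) = 0" "card (E \<union> (A - B)) \<le> card A" by linarith+
  then show "E \<inter> (A - B) = {}" "E \<union> (A - B) \<in> computing_sets r d (lspan {x})"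
    using E'(1) computing_setsI[OF computing U *] by auto
qed

lemma part_infinite:
  assumes B: "B \<subseteq> A" "B \<noteq> {}" and inf: "infinite (computing_sets r d (lspan {part B}))"
  shows "infinite (computing_sets r d (lspan {x}))"
proof -
  have "inj_on (\<lambda>E. E \<union> (A - B)) (computing_sets r d (lspan {part B}))"
  proof (rule inj_onI)
    fix E E' assume "E \<in> computing_sets r d (lspan {part B})" "E' \<in> computing_sets r d (lspan {part B})"
      and eq: "E \<union> (A - B) = E' \<union> (A - B)"
    then have "E \<inter> (A - B) = {}" "E' \<inter> (A - B) = {}" using part_exchange(1)[OF B] by blast+
    then show "E = E'" using eq by blast
  qed
  then have "infinite ((\<lambda>E. E \<union> (A - B)) ` computing_sets r d (lspan {part B}))"
    using inf by (simp add: finite_image_iff)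
  moreover have "(\<lambda>E. E \<union> (A - B)) ` computing_sets r d (lspan {part B}) \<subseteq> computing_sets r d (lspan {x})"
    using part_exchange(2)[OF B] by blast
  ultimately show ?thesis using infinite_super by blast
qed

text \<open>The images of the points of \<open>A\<close> are linearly independent, so a vector in both spans has coefficients
proportional to those of \<open>x\<close> on \<open>B\<close>.\<close>

lemma part_unique:
  assumes B: "B \<subseteq> A" "B \<noteq> {}"
  shows "proj_span (veronese r d ` B) \<inter> proj_span ({lspan {x}} \<union> veronese r d ` (A - B)) = {lspan {part B}}"
proof -
  have fin: "finite B" "B \<subseteq> Pr r" "finite (A - B)" "A - B \<subseteq> Pr r"
    using B finite_A A_Pr by (auto intro: finite_subset)
  have span: "lspan (\<Union>(veronese r d ` C)) = lspan (vero r d ` C)" if "C \<subseteq> Pr r" for C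
  proof -
    have "\<Union>(veronese r d ` C) = (\<Union>p\<in>C. lspan {vero r d p})"
    proof -
      have "veronese r d p = lspan {vero r d p}" if "p \<in> C" for p
        using veronese_span_singleton[of r d "rep p"] rep_Pr(2)[of p r] \<open>C \<subseteq> Pr r\<close> that by auto
      then show ?thesis by simp
    qed
    then show ?thesis by (simp add: span_Union_span)
  qed
  have span2: "y \<in> lspan (\<Union>({lspan {x}} \<union> veronese r d ` (A - B))) \<longleftrightarrow>
      (\<exists>k. y - fun_scale k x \<in> lspan (vero r d ` (A - B)))" for y
  proof -
    have "lspan (\<Union>({lspan {x}} \<union> veronese r d ` (A - B))) = lspan (insert x (vero r d ` (A - B)))"
    proof (rule fun_space.span_eq[THEN iffD2], intro conjI)
      have "lspan {x} \<subseteq> lspan (insert x (vero r d ` (A - B)))"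
        by (intro fun_space.span_mono) auto
      moreover have "\<Union>(veronese r d ` (A - B)) \<subseteq> lspan (insert x (vero r d ` (A - B)))"
        using fun_space.span_superset[of "\<Union>(veronese r d ` (A - B))"] span[OF fin(4)]
          fun_space.span_mono[of "vero r d ` (A - B)" "insert x (vero r d ` (A - B))"] by blast
      ultimately show "\<Union>({lspan {x}} \<union> veronese r d ` (A - B)) \<subseteq> lspan (insert x (vero r d ` (A - B)))"
        by auto
      have "vero r d ` (A - B) \<subseteq> lspan (\<Union>({lspan {x}} \<union> veronese r d ` (A - B)))"
        using fun_space.span_superset[of "vero r d ` (A - B)"] span[OF fin(4)]
          fun_space.span_mono[of "\<Union>(veronese r d ` (A - B))" "\<Union>({lspan {x}} \<union> veronese r d ` (A - B))"]
        by auto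
      moreover have "x \<in> lspan (\<Union>({lspan {x}} \<union> veronese r d ` (A - B)))"
        by (intro fun_space.span_base) (auto intro: fun_space.span_base)
      ultimately show "insert x (vero r d ` (A - B)) \<subseteq> lspan (\<Union>({lspan {x}} \<union> veronese r d ` (A - B)))"
        by blast
    qed
    then show ?thesis by (simp add: fun_space.span_insert)
  qed
  show ?thesis
  proof (rule set_eqI, rule iffI)
    fix Q assume "Q \<in> proj_span (veronese r d ` B) \<inter> proj_span ({lspan {x}} \<union> veronese r d ` (A - B))"
    then have Q: "Q \<in> proj_span (veronese r d ` B)" "Q \<in> proj_span ({lspan {x}} \<union> veronese r d ` (A - B))"
      by auto
    then have "proj_point Q" by (simp add: proj_span_def)
    then obtain y where y: "y \<noteq> 0" "Q = lspan {y}" by (auto simp: proj_point_iff)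
    obtain b where b: "y = (\<Sum>p\<in>B. fun_scale (b p) (vero r d p))"
      using in_proj_span_iff[OF fin(1,2) y(1), of d] Q(1) y(2) by blast
    obtain k where k: "y - fun_scale k x \<in> lspan (vero r d ` (A - B))"
      using Q(2) span_singleton_in_proj_span_iff[OF y(1)] span2 y(2) by blast
    then obtain e where e: "y - fun_scale k x = (\<Sum>p\<in>A - B. fun_scale (e p) (vero r d p))"
      using in_span_image_iff[OF fin(3), of "y - fun_scale k x" "vero r d"] by blast
    have "0 = (\<Sum>p\<in>B. fun_scale (b p) (vero r d p)) - fun_scale k x
        - (\<Sum>p\<in>A - B. fun_scale (e p) (vero r d p))"
      using e b by simp
    also have "\<dots> = (\<Sum>p\<in>A. fun_scale ((if p \<in> B then b p else 0) - k * a p - (if p \<in> A - B then e p else 0)) (vero r d p))"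
      unfolding zero_sum_extend[OF finite_A B(1), of b] zero_sum_extend[OF finite_A, of "A - B" e, OF Diff_subset]
      by (subst sum_eq)
        (simp add: fun_space.scale_sum_right fun_space.scale_left_diff_distrib sum_subtractf)
    finally have zero: "(if p \<in> B then b p else 0) - k * a p - (if p \<in> A - B then e p else 0) = 0" if "p \<in> A" for p
      using independent[of "\<lambda>p. (if p \<in> B then b p else 0) - k * a p - (if p \<in> A - B then e p else 0)" p] that
      by simp
    have "b p = k * a p" if "p \<in> B" for p
    proof -
      have "p \<in> A" "p \<notin> A - B" using that B by auto
      then show ?thesis using zero[of p] that by simp
    qed
    then have "y = fun_scale k (part B)"
      unfolding b part_def by (simp add: fun_space.scale_sum_right)
    then have "y \<in> lspan {part B}" by (simp add: fun_space.span_scale fun_space.span_base)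
    from span_singleton_eq[OF this y(1)] show "Q \<in> {lspan {part B}}" using y(2) by simp
  next
    fix Q assume "Q \<in> {lspan {part B}}"
    then have Q: "Q = lspan {part B}" by simp
    have "lspan {part B} \<in> proj_span (veronese r d ` B)"
      using computing_setsD(3)[OF part_computing[OF B]] .
    moreover have "part B - fun_scale 1 x = (\<Sum>p\<in>A - B. fun_scale (- a p) (vero r d p))"
      using part_split[OF B(1)] by (simp add: part_def sum_negf)
    then have "part B - fun_scale 1 x \<in> lspan (vero r d ` (A - B))"
      by (intro in_span_image_iff[OF fin(3), THEN iffD2] exI[of _ "\<lambda>p. - a p"])
    then have "lspan {part B} \<in> proj_span ({lspan {x}} \<union> veronese r d ` (A - B))"
      using span_singleton_in_proj_span_iff[OF part_nonzero[OF B]] span2 by blast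
    ultimately show "Q \<in> proj_span (veronese r d ` B) \<inter> proj_span ({lspan {x}} \<union> veronese r d ` (A - B))"
      unfolding Q by blast
  qed
qed

end

section \<open>Decompositions along rational curves\<close>

text \<open>An injective parametrization of a curve by an affine line. One point of the curve is left out, which
is harmless because it can be chosen away from any given finite set.\<close>

definition rational_curve :: "nat \<Rightarrow> nat \<Rightarrow> ('a::field \<Rightarrow> nat \<Rightarrow> 'a) \<Rightarrow> bool" where
  "rational_curve r m \<phi> \<longleftrightarrow> (\<forall>s. \<phi> s \<in> ambient r) \<and> (\<forall>s. \<phi> s \<noteq> 0) \<and>
     (\<forall>s t. \<phi> s \<in> lspan {\<phi> t} \<longrightarrow> s = t) \<and>
     (\<exists>f. \<forall>i. degree (f i) \<le> m \<and> (\<forall>s. \<phi> s i = poly (f i) s))"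

lemma rational_curve_inj: "rational_curve r m \<phi> \<Longrightarrow> inj (\<lambda>s. lspan {\<phi> s})"
  by (rule injI) (metis rational_curve_def fun_space.span_base insertI1)

lemma rational_curve_Pr: "rational_curve r m \<phi> \<Longrightarrow> lspan {\<phi> s} \<in> Pr r"
  by (simp add: rational_curve_def span_singleton_Pr)

lemma veronese_of_curve:
  assumes "\<And>i. degree (f i) \<le> m" "\<And>s i. \<phi> s i = poly (f i) s"
  shows "\<exists>h. (\<forall>\<alpha>. degree (h \<alpha>) \<le> m * d) \<and> (\<forall>s \<alpha>. veronese_vec r d (\<phi> s) \<alpha> = poly (h \<alpha>) s)"
proof (intro exI conjI allI)
  let ?h = "\<lambda>\<alpha>. if \<alpha> \<in> monomials r d then \<Prod>i\<le>r. f i ^ \<alpha> i else 0"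
  fix \<alpha>
  show "degree (?h \<alpha>) \<le> m * d"
  proof (cases "\<alpha> \<in> monomials r d")
    case True
    have "degree (\<Prod>i\<le>r. f i ^ \<alpha> i) \<le> (\<Sum>i\<le>r. degree (f i ^ \<alpha> i))"
      using degree_prod_sum_le[of "{..r}" "\<lambda>i. f i ^ \<alpha> i"] by (simp add: o_def)
    also have "\<dots> \<le> (\<Sum>i\<le>r. m * \<alpha> i)"
      by (intro sum_mono order.trans[OF degree_power_le] mult_right_mono assms) simp
    also have "\<dots> = m * d" using True by (simp add: monomials_def flip: sum_distrib_left)
    finally show ?thesis using True by simp
  qed simp
  show "veronese_vec r d (\<phi> s) \<alpha> = poly (?h \<alpha>) s" for s
    by (simp add: veronese_vec_def assms(2) poly_prod)
qed

text \<open>Pulled back along the curve, forms of degree \<open>d\<close> become polynomials of degree at most \<open>m d\<close>, so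
decompositions of the corresponding functional on polynomials give decompositions of \<open>x\<close>.\<close>

lemma infinitely_many_on_curve:
  fixes \<phi> :: "'a::{alg_closed_field, field_char_0} \<Rightarrow> nat \<Rightarrow> 'a"
  assumes \<phi>: "rational_curve r m \<phi>" and B: "B \<in> computing_sets r d (lspan {x})" and x: "x \<noteq> 0"
    and on: "B \<subseteq> range (\<lambda>s. lspan {\<phi> s})" and card: "m * d + 2 \<le> 2 * card B"
  shows "infinite (computing_sets r d (lspan {x}))"
proof -
  define pt where "pt s = lspan {\<phi> s}" for s
  have inj: "inj pt" unfolding pt_def by (rule rational_curve_inj[OF \<phi>])
  have on: "B \<subseteq> range pt" using on by (simp add: pt_def)
  define U where "U = pt -` B"
  have BU: "B = pt ` U" using on by (auto simp: U_def)
  have finU: "finite U" unfolding U_def using computing_setsD(1)[OF B] inj by (rule finite_vimageI)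
  have cardU: "card U = card B" using BU inj by (metis card_image inj_on_subset subset_UNIV)
  obtain f where f: "\<And>i. degree (f i) \<le> m" "\<And>s i. \<phi> s i = poly (f i) s"
    using \<phi> unfolding rational_curve_def by blast
  obtain h where h: "\<And>\<alpha>. degree (h \<alpha>) \<le> m * d" "\<And>s \<alpha>. veronese_vec r d (\<phi> s) \<alpha> = poly (h \<alpha>) s"
    using veronese_of_curve[where \<phi> = \<phi> and f = f and d = d and r = r, OF f] by blast
  have "lspan {x} \<in> proj_span (veronese r d ` pt ` U)" using computing_setsD(3)[OF B] BU by simp
  then obtain c where c: "x = (\<Sum>u\<in>U. fun_scale (c u) (veronese_vec r d (\<phi> u)))"
    using in_proj_span_family_iff[OF finU x, of r d \<phi>] unfolding pt_def by blast
  let ?V = "{V. finite V \<and> card V = card U \<and>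
    (\<exists>c'. \<forall>h. degree h \<le> m * d \<longrightarrow> (\<Sum>u\<in>U. c u * poly h u) = (\<Sum>v\<in>V. c' v * poly h v))}"
  have "infinite ?V" using card cardU by (intro infinitely_many_decompositions[OF finU]) simp
  moreover have "inj_on ((`) pt) ?V" using inj by (meson inj_image_eq_iff inj_onI)
  ultimately have "infinite ((`) pt ` ?V)" by (simp add: finite_image_iff)
  moreover have "(`) pt ` ?V \<subseteq> computing_sets r d (lspan {x})"
  proof clarify
    fix V c' assume V: "finite V" "card V = card U"
      and c': "\<forall>h. degree h \<le> m * d \<longrightarrow> (\<Sum>u\<in>U. c u * poly h u) = (\<Sum>v\<in>V. c' v * poly h v)"
    have "x = (\<Sum>v\<in>V. fun_scale (c' v) (veronese_vec r d (\<phi> v)))"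
    proof
      fix \<alpha>
      have "x \<alpha> = (\<Sum>u\<in>U. c u * poly (h \<alpha>) u)"
        by (subst c) (simp add: fun_sum_apply fun_scale_def h(2))
      also have "\<dots> = (\<Sum>v\<in>V. c' v * poly (h \<alpha>) v)" using c' h(1) by simp
      also have "\<dots> = (\<Sum>v\<in>V. fun_scale (c' v) (veronese_vec r d (\<phi> v))) \<alpha>"
        by (simp add: fun_sum_apply fun_scale_def h(2))
      finally show "x \<alpha> = \<dots>" .
    qed
    then have "lspan {x} \<in> proj_span (veronese r d ` pt ` V)"
      unfolding pt_def by (intro in_proj_span_family_iff[OF V(1) x, THEN iffD2] exI[of _ c'])
    moreover have "pt ` V \<subseteq> Pr r" using rational_curve_Pr[OF \<phi>] by (auto simp: pt_def)
    moreover have "card (pt ` V) \<le> card B" using card_image_le[OF V(1), of pt] V(2) cardU by simp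
    ultimately show "pt ` V \<in> computing_sets r d (lspan {x})"
      using computing_setsI[OF B] V(1) by blast
  qed
  ultimately show ?thesis using infinite_super by blast
qed

lemma coeff_mult_bounded:
  fixes p q :: "'a::field poly"
  assumes "degree p \<le> m" "degree q \<le> n"
  shows "coeff (p * q) (m + n) = coeff p m * coeff q n"
proof (cases "degree p = m \<and> degree q = n")
  case True
  then show ?thesis using coeff_mult_degree_sum[of p q] by simp
next
  case False
  then have "coeff p m * coeff q n = 0" using assms by (auto simp: coeff_eq_0)
  moreover have "degree (p * q) < m + n"
    using False assms degree_mult_le[of p q] by linarith
  ultimately show ?thesis by (simp add: coeff_eq_0)
qed

lemma coeff_power_bounded:
  fixes p :: "'a::field poly"
  assumes "degree p \<le> m"
  shows "coeff (p ^ k) (m * k) = coeff p m ^ k \<and> degree (p ^ k) \<le> m * k"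
proof (induction k)
  case (Suc k)
  have "degree (p * p ^ k) \<le> m + m * k"
    using degree_mult_le[of p "p ^ k"] assms Suc by linarith
  then show ?case using coeff_mult_bounded[OF assms, of "p ^ k" "m * k"] Suc by simp
qed simp

lemma coeff_prod_bounded:
  fixes p :: "'i \<Rightarrow> 'a::field poly"
  assumes "finite I" "\<And>i. i \<in> I \<Longrightarrow> degree (p i) \<le> m i"
  shows "coeff (\<Prod>i\<in>I. p i) (\<Sum>i\<in>I. m i) = (\<Prod>i\<in>I. coeff (p i) (m i)) \<and>
    degree (\<Prod>i\<in>I. p i) \<le> (\<Sum>i\<in>I. m i)"
  using assms
proof (induction I rule: finite_induct)
  case (insert i I)
  then have "degree (p i * (\<Prod>i\<in>I. p i)) \<le> m i + (\<Sum>i\<in>I. m i)"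
    using degree_mult_le[of "p i" "\<Prod>i\<in>I. p i"] by (meson add_mono insertI1 insertI2 order.trans)
  then show ?case using coeff_mult_bounded[of "p i" "m i" "\<Prod>i\<in>I. p i" "\<Sum>i\<in>I. m i"] insert by simp
qed simp

lemma veronese_of_affine_line:
  "\<exists>h. (\<forall>\<alpha>. degree (h \<alpha>) \<le> d) \<and>
     (\<forall>s \<alpha>. veronese_vec r d (a + fun_scale s w) \<alpha> = poly (h \<alpha>) s) \<and>
     (\<forall>\<alpha>. coeff (h \<alpha>) d = veronese_vec r d w \<alpha>)"
proof (intro exI conjI allI)
  let ?h = "\<lambda>\<alpha>. if \<alpha> \<in> monomials r d then \<Prod>i\<le>r. [:a i, w i:] ^ \<alpha> i else 0"
  fix \<alpha>
  have lin: "degree ([:a i, w i:] ^ \<alpha> i) \<le> \<alpha> i \<and> coeff ([:a i, w i:] ^ \<alpha> i) (\<alpha> i) = w i ^ \<alpha> i" for i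
    using coeff_power_bounded[of "[:a i, w i:]" 1 "\<alpha> i"] by simp
  have sum: "(\<Sum>i\<le>r. \<alpha> i) = d" if "\<alpha> \<in> monomials r d" using that by (simp add: monomials_def)
  note prod = coeff_prod_bounded[of "{..r}" "\<lambda>i. [:a i, w i:] ^ \<alpha> i" \<alpha>]
  show "degree (?h \<alpha>) \<le> d" using prod lin sum by auto
  show "coeff (?h \<alpha>) d = veronese_vec r d w \<alpha>"
    using prod lin sum by (auto simp: veronese_vec_def)
  show "veronese_vec r d (a + fun_scale s w) \<alpha> = poly (?h \<alpha>) s" for s
    by (simp add: veronese_vec_def poly_prod fun_scale_def mult.commute)
qed

lemma vero_span_singleton:
  assumes "u \<noteq> 0"
  shows "\<exists>k. k \<noteq> 0 \<and> vero r d (lspan {u}) = fun_scale k (veronese_vec r d u)"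
proof -
  have "proj_point (lspan {u})" using assms by (auto simp: proj_point_iff)
  from rep_proj_point[OF this] have *: "rep (lspan {u}) \<noteq> 0" "lspan {rep (lspan {u})} = lspan {u}" by auto
  then have "rep (lspan {u}) \<in> lspan {u}" by (metis fun_space.span_base insertI1)
  then obtain k where k: "rep (lspan {u}) = fun_scale k u" by (auto simp: fun_space.span_singleton)
  then have "k \<noteq> 0" using * by auto
  then show ?thesis using k by (intro exI[of _ "k ^ d"]) (simp add: veronese_vec_scale)
qed

text \<open>The direction \<open>w\<close> is the point at infinity of the parametrized line, and its Veronese image is
the leading coefficient of the pulled back forms.\<close>

lemma part_on_affine_line:
  fixes A :: "(nat \<Rightarrow> 'a::{alg_closed_field, field_char_0}) set set"
  assumes min: "minimal_decomposition r d A x a"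
    and curve: "rational_curve r 1 (\<lambda>s. b + fun_scale s w)"
    and B: "B \<subseteq> A" "B \<noteq> {}" "B \<subseteq> range (\<lambda>s. lspan {b + fun_scale s w})" and d: "d + 1 = 2 * card B"
  shows "\<exists>(X :: 'a set) V. finite X \<and> inj_on V (- X) \<and> (\<forall>l. l \<notin> X \<longrightarrow> finite (V l) \<and> card (V l) = card B \<and>
    minimal_decomposition.part r d a B + fun_scale l (veronese_vec r d w)
      \<in> lspan (\<Union>(veronese r d ` (\<lambda>s. lspan {b + fun_scale s w}) ` V l)))"
proof -
  interpret minimal_decomposition r d A x a by (rule min)
  define \<phi> where "\<phi> s = b + fun_scale s w" for s
  define pt where "pt s = lspan {\<phi> s}" for s
  have inj: "inj pt" unfolding pt_def \<phi>_def by (rule rational_curve_inj[OF curve])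
  define U where "U = pt -` B"
  have BU: "B = pt ` U" using B(3) by (auto simp: U_def pt_def \<phi>_def)
  have finB: "finite B" using B(1) finite_A finite_subset by blast
  have finU: "finite U" unfolding U_def using finB inj by (rule finite_vimageI)
  have injU: "inj_on pt U" using inj by (meson inj_on_subset subset_UNIV)
  have cardU: "card U = card B" using BU injU by (metis card_image)
  have neU: "U \<noteq> {}" using BU B(2) by auto
  have "\<phi> s \<noteq> 0" for s using curve by (simp add: rational_curve_def \<phi>_def)
  then have "\<forall>s. \<exists>k. k \<noteq> 0 \<and> vero r d (pt s) = fun_scale k (veronese_vec r d (\<phi> s))"
    unfolding pt_def by (intro allI vero_span_singleton)
  then obtain k where k: "\<And>s. k s \<noteq> 0" "\<And>s. vero r d (pt s) = fun_scale (k s) (veronese_vec r d (\<phi> s))"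
    by metis
  define c where "c u = a (pt u) * k u" for u
  have c: "c u \<noteq> 0" if "u \<in> U" for u
    using that coeff_nonzero[of "pt u"] k(1) B(1) BU by (auto simp: c_def)
  have part: "part B = (\<Sum>u\<in>U. fun_scale (c u) (veronese_vec r d (\<phi> u)))"
    unfolding part_def BU by (subst sum.reindex[OF injU]) (simp add: k(2) c_def)
  obtain h where h: "\<And>\<alpha>. degree (h \<alpha>) \<le> d" "\<And>s \<alpha>. veronese_vec r d (\<phi> s) \<alpha> = poly (h \<alpha>) s"
      "\<And>\<alpha>. coeff (h \<alpha>) d = veronese_vec r d w \<alpha>"
    using veronese_of_affine_line[of d r b w] unfolding \<phi>_def by blast
  have "\<exists>(X :: 'a set) V. finite X \<and> inj_on V (- X) \<and> (\<forall>l. l \<notin> X \<longrightarrow> finite (V l) \<and> card (V l) = card U \<and>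
    (\<exists>c'. \<forall>h. degree h \<le> d \<longrightarrow> (\<Sum>u\<in>U. c u * poly h u) + l * coeff h d = (\<Sum>v\<in>V l. c' v * poly h v)))"
    using d cardU by (intro decompositions_with_point_at_infinity[OF finU neU c]) simp_all
  then obtain X :: "'a set" and V where XV: "finite X" "inj_on V (- X)"
    "\<forall>l. l \<notin> X \<longrightarrow> finite (V l) \<and> card (V l) = card U \<and>
    (\<exists>c'. \<forall>h. degree h \<le> d \<longrightarrow> (\<Sum>u\<in>U. c u * poly h u) + l * coeff h d = (\<Sum>v\<in>V l. c' v * poly h v))"
    by blast
  have "part B + fun_scale l (veronese_vec r d w) \<in> lspan (\<Union>(veronese r d ` pt ` V l))"
    if l: "l \<notin> X" for l
  proof -
    obtain c' where c': "\<And>h. degree h \<le> d \<Longrightarrow> (\<Sum>u\<in>U. c u * poly h u) + l * coeff h d = (\<Sum>v\<in>V l. c' v * poly h v)"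
      using XV(3) l by blast
    have "part B + fun_scale l (veronese_vec r d w) = (\<Sum>v\<in>V l. fun_scale (c' v) (veronese_vec r d (\<phi> v)))"
    proof
      fix \<alpha>
      have "(part B + fun_scale l (veronese_vec r d w)) \<alpha> = (\<Sum>u\<in>U. c u * poly (h \<alpha>) u) + l * coeff (h \<alpha>) d"
        by (simp add: part fun_sum_apply fun_scale_def h(2,3))
      also have "\<dots> = (\<Sum>v\<in>V l. c' v * poly (h \<alpha>) v)" using c' h(1) by simp
      also have "\<dots> = (\<Sum>v\<in>V l. fun_scale (c' v) (veronese_vec r d (\<phi> v))) \<alpha>"
        by (simp add: fun_sum_apply fun_scale_def h(2))
      finally show "(part B + fun_scale l (veronese_vec r d w)) \<alpha> = \<dots>" .
    qed
    also have "\<dots> \<in> lspan (\<Union>(veronese r d ` pt ` V l))"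
    proof (intro fun_space.span_sum fun_space.span_scale fun_space.span_base)
      fix v assume v: "v \<in> V l"
      have "veronese_vec r d (\<phi> v) \<in> veronese r d (pt v)"
        unfolding pt_def veronese_span_singleton by (simp add: fun_space.span_base)
      then show "veronese_vec r d (\<phi> v) \<in> \<Union>(veronese r d ` pt ` V l)" using v by blast
    qed
    finally show ?thesis .
  qed
  then show ?thesis
    using XV cardU unfolding pt_def \<phi>_def by (intro exI[of _ X] exI[of _ V]) simp
qed

text \<open>The two lines share the point \<open>w\<close>. A multiple of its image is added to the part on one line and
subtracted from the part on the other, and each of the new parts is decomposed again on its line.\<close>

lemma infinitely_many_on_two_lines:
  fixes A :: "(nat \<Rightarrow> 'a::{alg_closed_field, field_char_0}) set set"
  assumes min: "minimal_decomposition r d A x a"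
    and curve1: "rational_curve r 1 (\<lambda>s. b1 + fun_scale s w)"
    and curve2: "rational_curve r 1 (\<lambda>s. b2 + fun_scale s w)"
    and B1: "B1 \<subseteq> A" "B1 \<noteq> {}" "B1 \<subseteq> range (\<lambda>s. lspan {b1 + fun_scale s w})" "d + 1 = 2 * card B1"
    and B2: "B2 \<subseteq> A" "B2 \<noteq> {}" "B2 \<subseteq> range (\<lambda>s. lspan {b2 + fun_scale s w})" "d + 1 = 2 * card B2"
    and disj: "B1 \<inter> B2 = {}"
  shows "infinite (computing_sets r d (lspan {x}))"
proof
  assume fin: "finite (computing_sets r d (lspan {x}))"
  interpret minimal_decomposition r d A x a by (rule min)
  define pt1 where "pt1 s = lspan {b1 + fun_scale s w}" for s
  define pt2 where "pt2 s = lspan {b2 + fun_scale s w}" for s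
  define F where "F = A - (B1 \<union> B2)"
  have sub: "B1 \<union> B2 \<subseteq> A" using B1 B2 by auto
  obtain X1 :: "'a set" and V1 where V1: "finite X1" "inj_on V1 (- X1)"
    "\<And>l. l \<notin> X1 \<Longrightarrow> finite (V1 l) \<and> card (V1 l) = card B1 \<and>
      part B1 + fun_scale l (veronese_vec r d w) \<in> lspan (\<Union>(veronese r d ` pt1 ` V1 l))"
    using part_on_affine_line[OF min curve1 B1] unfolding pt1_def by blast
  obtain X2 :: "'a set" and V2 where V2: "finite X2"
    "\<And>l. l \<notin> X2 \<Longrightarrow> finite (V2 l) \<and> card (V2 l) = card B2 \<and>
      part B2 + fun_scale l (veronese_vec r d w) \<in> lspan (\<Union>(veronese r d ` pt2 ` V2 l))"
    using part_on_affine_line[OF min curve2 B2] unfolding pt2_def by blast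
  \<comment> \<open>The parameter \<open>l\<close> must avoid the exceptional values on both lines, where it enters with opposite signs.\<close>
  define X where "X = X1 \<union> uminus ` X2"
  have finX: "finite X" using V1(1) V2(1) by (simp add: X_def)
  have computing: "pt1 ` V1 l \<union> pt2 ` V2 (- l) \<union> F \<in> computing_sets r d (lspan {x})" if l: "l \<notin> X" for l
  proof -
    let ?E = "pt1 ` V1 l \<union> pt2 ` V2 (- l) \<union> F"
    have l1: "l \<notin> X1" and l2: "- l \<notin> X2" using l by (auto simp: X_def image_iff)
    have mono: "lspan (\<Union>(veronese r d ` C)) \<subseteq> lspan (\<Union>(veronese r d ` ?E))" if "C \<subseteq> ?E" for C
      using that by (intro fun_space.span_mono Union_mono image_mono)
    have "part B1 + fun_scale l (veronese_vec r d w) \<in> lspan (\<Union>(veronese r d ` ?E))"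
      using V1(3)[OF l1] mono[of "pt1 ` V1 l"] by blast
    moreover have "part B2 + fun_scale (- l) (veronese_vec r d w) \<in> lspan (\<Union>(veronese r d ` ?E))"
      using V2(2)[OF l2] mono[of "pt2 ` V2 (- l)"] by blast
    moreover have "part F \<in> lspan (\<Union>(veronese r d ` ?E))"
      unfolding part_def
    proof (intro fun_space.span_sum fun_space.span_scale fun_space.span_base)
      fix p assume p: "p \<in> F"
      then have "p \<in> Pr r" using A_Pr by (auto simp: F_def)
      then have "veronese r d p = lspan {vero r d p}"
        using veronese_span_singleton[of r d "rep p"] rep_Pr(2)[of p r] by simp
      then have "vero r d p \<in> veronese r d p" by (simp add: fun_space.span_base)
      then show "vero r d p \<in> \<Union>(veronese r d ` ?E)" using p by blast
    qed
    moreover have "x = (part B1 + fun_scale l (veronese_vec r d w)) +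
        ((part B2 + fun_scale (- l) (veronese_vec r d w)) + part F)"
    proof -
      have "part (B1 \<union> B2) = part B1 + part B2"
        unfolding part_def using B1(1) B2(1) finite_A disj
        by (intro sum.union_disjoint) (auto intro: finite_subset)
      then have "x = part B1 + part B2 + part F" using part_split[OF sub] by (simp only: F_def)
      then show ?thesis by (simp add: fun_space.scale_minus_left)
    qed
    ultimately have "x \<in> lspan (\<Union>(veronese r d ` ?E))" by (metis fun_space.span_add)
    then have span: "lspan {x} \<in> proj_span (veronese r d ` ?E)"
      by (rule span_singleton_in_proj_span_iff[OF nonzero, THEN iffD2])
    have finE: "finite ?E" using V1(3)[OF l1] V2(2)[OF l2] finite_A by (simp add: F_def)
    have "card ?E \<le> card (pt1 ` V1 l \<union> pt2 ` V2 (- l)) + card F" by (rule card_Un_le)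
    also have "\<dots> \<le> (card (pt1 ` V1 l) + card (pt2 ` V2 (- l))) + card F" by (simp add: card_Un_le)
    also have "\<dots> \<le> (card B1 + card B2) + card F"
      using V1(3)[OF l1] V2(2)[OF l2] card_image_le[of "V1 l" pt1] card_image_le[of "V2 (- l)" pt2] by simp
    also have "card B1 + card B2 = card (B1 \<union> B2)"
      using B1(1) B2(1) finite_A disj by (intro card_Un_disjoint[symmetric]) (auto intro: finite_subset)
    also have "card (B1 \<union> B2) + card F = card A"
      using sub finite_A card_mono[OF finite_A sub] unfolding F_def
      by (subst card_Diff_subset) (auto intro: finite_subset)
    finally have card: "card ?E \<le> card A" .
    have "?E \<subseteq> Pr r"
      using rational_curve_Pr[OF curve1] rational_curve_Pr[OF curve2] A_Pr
      by (auto simp: pt1_def pt2_def F_def)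
    then show ?thesis by (rule computing_setsI[OF computing finE _ span card])
  qed
  \<comment> \<open>Finitely many computing sets would leave only finitely many subsets of parameters for \<open>V1\<close>.\<close>
  define S where "S = pt1 -` (\<Union>(computing_sets r d (lspan {x})))"
  have "finite (\<Union>(computing_sets r d (lspan {x})))" using fin computing_setsD(1) by (intro finite_Union)
  moreover have "inj pt1" unfolding pt1_def by (rule rational_curve_inj[OF curve1])
  ultimately have finS: "finite S" unfolding S_def by (rule finite_vimageI)
  have "V1 l \<subseteq> S" if "l \<notin> X" for l
    unfolding S_def using computing[OF that] by (intro subsetI vimageI2 UnionI) auto
  then have "V1 ` (- X) \<subseteq> Pow S" by auto
  then have "finite (V1 ` (- X))" using finS by (meson finite_Pow_iff finite_subset)
  moreover have "inj_on V1 (- X)" using V1(2) by (rule inj_on_subset) (auto simp: X_def)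
  ultimately have "finite (- X)" by (simp add: finite_image_iff)
  then show False using finX infinite_UNIV_char_0 by (metis Compl_partition finite_Un)
qed

section \<open>Lines and quadratic forms\<close>

lemma independent_pair: "u \<noteq> 0 \<Longrightarrow> v \<notin> lspan {u} \<Longrightarrow> \<not> fun_space.dependent {u, v} \<and> card {u, v} = 2"
proof -
  assume *: "u \<noteq> 0" "v \<notin> lspan {u}"
  then have "u \<noteq> v" using fun_space.span_base[of u "{u}"] by auto
  then show ?thesis
    using * fun_space.independent_insertI[of v "{u}"] by (simp add: insert_commute)
qed

lemma independent_triple:
  "u \<noteq> 0 \<Longrightarrow> v \<notin> lspan {u} \<Longrightarrow> w \<notin> lspan {u, v} \<Longrightarrow>
    \<not> fun_space.dependent {u, v, w} \<and> card {u, v, w} = 3"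
proof -
  assume *: "u \<noteq> 0" "v \<notin> lspan {u}" "w \<notin> lspan {u, v}"
  then have "w \<notin> {u, v}" using fun_space.span_base[of _ "{u, v}"] by auto
  moreover have "{u, v, w} = insert w {u, v}" by auto
  ultimately show ?thesis
    using independent_pair[OF *(1,2)] fun_space.independent_insertI[of w "{u, v}"] * by simp
qed

text \<open>The coordinate space of all sequences is infinite-dimensional, so the dimension count is done inside a
finite basis of \<open>W\<close>.\<close>

lemma subspace_eq_span_independent:
  assumes W: "fun_space.subspace W" "fun_space.dim W = card S" and S: "S \<subseteq> W" "\<not> fun_space.dependent S"
    and fin: "finite S" "S \<noteq> {}"
  shows "W = lspan S"
proof
  show "lspan S \<subseteq> W" using S(1) W(1) by (rule fun_space.span_minimal)
  obtain B where B: "B \<subseteq> W" "\<not> fun_space.dependent B" "W \<subseteq> lspan B" "card B = fun_space.dim W"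
    by (rule fun_space.basis_exists)
  have "card B \<noteq> 0" using B(4) W(2) fin by simp
  then have finB: "finite B" by (metis card.infinite)
  show "W \<subseteq> lspan S"
  proof (rule ccontr)
    assume "\<not> W \<subseteq> lspan S"
    then obtain y where y: "y \<in> W" "y \<notin> lspan S" by blast
    then have "\<not> fun_space.dependent (insert y S)" "insert y S \<subseteq> lspan B"
      using S B(3) fun_space.independent_insertI by auto
    from fun_space.independent_span_bound[OF finB this]
    have "card (insert y S) \<le> card S" using B(4) W(2) by simp
    moreover have "y \<notin> S" using y fun_space.span_base by blast
    ultimately show False using fin by simp
  qed
qed

lemma dim_span_pair: "u \<noteq> 0 \<Longrightarrow> v \<notin> lspan {u} \<Longrightarrow> fun_space.dim (lspan {u, v}) = 2"
  using independent_pair[of u v] fun_space.dim_span_eq_card_independent[of "{u, v}"] by simp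

lemma dim_span_triple:
  "u \<noteq> 0 \<Longrightarrow> v \<notin> lspan {u} \<Longrightarrow> w \<notin> lspan {u, v} \<Longrightarrow> fun_space.dim (lspan {u, v, w}) = 3"
  using independent_triple[of u v w] fun_space.dim_span_eq_card_independent[of "{u, v, w}"] by simp

lemma span_pair_eq_plane:
  assumes "fun_space.subspace W" "fun_space.dim W = 2" "u \<in> W" "v \<in> W" "u \<noteq> 0" "v \<notin> lspan {u}"
  shows "W = lspan {u, v}"
  using independent_pair[OF assms(5,6)] assms by (intro subspace_eq_span_independent) auto

lemma span_triple_eq_space:
  assumes "fun_space.subspace W" "fun_space.dim W = 3" "u \<in> W" "v \<in> W" "w \<in> W"
    "u \<noteq> 0" "v \<notin> lspan {u}" "w \<notin> lspan {u, v}"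
  shows "W = lspan {u, v, w}"
  using independent_triple[OF assms(6-8)] assms by (intro subspace_eq_span_independent) auto

lemma not_subset_span_small:
  assumes "finite S" "card S < fun_space.dim W"
  shows "\<not> W \<subseteq> lspan S"
  using fun_space.dim_le_card[of W S] assms by auto

lemma line_complement_vector:
  assumes W: "fun_space.subspace W" "fun_space.dim W = 2" and w: "w \<in> W" "w \<noteq> 0"
  obtains a where "a \<in> W" "a \<notin> lspan {w}" "W = lspan {w, a}"
proof -
  have "card {w} < fun_space.dim W" using W by simp
  then have "\<not> W \<subseteq> lspan {w}" by (intro not_subset_span_small) auto
  then obtain a where a: "a \<in> W" "a \<notin> lspan {w}" by blast
  with span_pair_eq_plane[OF W w(1) a(1) w(2) a(2)] that show thesis by blast
qed

lemma affine_line_curve: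
  assumes "a \<in> ambient r" "w \<in> ambient r" "w \<noteq> 0" "a \<notin> lspan {w}"
  shows "rational_curve r 1 (\<lambda>s. a + fun_scale s w)"
proof -
  have amb: "a + fun_scale s w \<in> ambient r" for s
    using assms subspace_coord_space[of "{..r}"] by (intro fun_space.subspace_add fun_space.subspace_scale) auto
  have key: "k = 0" if "fun_scale k a \<in> lspan {w}" for k
  proof (rule ccontr)
    assume "k \<noteq> 0"
    then have "a = fun_scale (1 / k) (fun_scale k a)" by (simp add: fun_space.scale_scale)
    then show False using fun_space.span_scale[OF that, of "1 / k"] assms(4) by simp
  qed
  have "a + fun_scale s w \<noteq> 0" for s
  proof
    assume "a + fun_scale s w = 0"
    then have "a = fun_scale (- s) w" by (simp add: fun_space.scale_minus_left eq_neg_iff_add_eq_0)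
    then have "a \<in> lspan {w}" unfolding fun_space.span_singleton by blast
    then show False using assms(4) by contradiction
  qed
  moreover have "s = t" if st: "a + fun_scale s w \<in> lspan {a + fun_scale t w}" for s t
  proof -
    obtain k where k: "a + fun_scale s w = fun_scale k (a + fun_scale t w)"
      using st unfolding fun_space.span_singleton by blast
    then have eq: "fun_scale (1 - k) a = fun_scale (k * t - s) w"
      by (simp add: fun_scale_def fun_eq_iff algebra_simps)
    then have "fun_scale (1 - k) a \<in> lspan {w}" by (auto simp: fun_space.span_singleton)
    then have "k = 1" using key by fastforce
    then have "fun_scale (t - s) w = 0" using eq by simp
    then show ?thesis using assms(3) by simp
  qed
  moreover have "\<exists>f. \<forall>i. degree (f i) \<le> 1 \<and> (\<forall>s. (a + fun_scale s w) i = poly (f i) s)"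
    by (intro exI[of _ "\<lambda>i. [:a i, w i:]"]) (auto simp: fun_scale_def mult.commute)
  ultimately show ?thesis using amb unfolding rational_curve_def by blast
qed

lemma on_affine_line:
  assumes "p \<in> Pr r" "p \<subseteq> lspan {w, a}" "p \<noteq> lspan {w}"
  shows "p \<in> range (\<lambda>s. lspan {a + fun_scale s w})"
proof -
  note p = rep_Pr[OF assms(1)]
  have "rep p \<in> lspan {w, a}" using assms(2) p(2) fun_space.span_base[of "rep p" "{rep p}"] by auto
  then obtain \<alpha> \<beta> where x: "rep p = fun_scale \<alpha> w + fun_scale \<beta> a" unfolding in_span_pair by blast
  have "\<beta> \<noteq> 0"
  proof
    assume "\<beta> = 0"
    then have "rep p \<in> lspan {w}" using x by (auto simp: fun_space.span_singleton)
    then have "lspan {rep p} = lspan {w}" using p(1) by (rule span_singleton_eq)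
    then show False using p(2) assms(3) by simp
  qed
  then have "rep p = fun_scale \<beta> (a + fun_scale (\<alpha> / \<beta>) w)"
    unfolding x by (simp add: fun_scale_def fun_eq_iff field_simps)
  then have "rep p \<in> lspan {a + fun_scale (\<alpha> / \<beta>) w}" unfolding fun_space.span_singleton by blast
  from span_singleton_eq[OF this p(1)] p(2) show ?thesis by blast
qed

lemma is_lineE:
  assumes "is_line r D"
  obtains W where "fun_space.subspace W" "W \<subseteq> ambient r" "fun_space.dim W = 2"
    "D = {p \<in> Pr r. p \<subseteq> W}"
  using assms unfolding proj_subspace_def one_add_one by blast

lemma is_line_span:
  assumes "u \<in> ambient r" "v \<in> ambient r" "u \<noteq> 0" "v \<notin> lspan {u}"
  shows "is_line r {p \<in> Pr r. p \<subseteq> lspan {u, v}}"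
  unfolding proj_subspace_def
  using dim_span_pair[OF assms(3,4)] span_subset_coord_space[of "{u, v}" "{..r}"] assms(1,2)
  by (intro exI[of _ "lspan {u, v}"]) (simp add: fun_space.subspace_span)

text \<open>The direction \<open>w\<close> of the parametrization is a point of the line outside the finite set \<open>B\<close>.\<close>

lemma line_curve_avoiding:
  fixes D :: "(nat \<Rightarrow> 'a::field_char_0) set set"
  assumes "is_line r D" "finite B"
  obtains \<phi> where "rational_curve r 1 \<phi>" "D \<inter> B \<subseteq> range (\<lambda>s. lspan {\<phi> s})"
proof -
  obtain W where W: "fun_space.subspace W" "W \<subseteq> ambient r" "fun_space.dim W = 2" "D = {p \<in> Pr r. p \<subseteq> W}"
    using is_lineE[OF assms(1)] .
  have "card ({} :: (nat \<Rightarrow> 'a) set) < fun_space.dim W" using W by simp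
  then have "\<not> W \<subseteq> lspan {}" by (intro not_subset_span_small) auto
  then obtain w0 where w0: "w0 \<in> W" "w0 \<noteq> 0" by auto
  obtain a0 where a0: "a0 \<in> W" "a0 \<notin> lspan {w0}" using line_complement_vector[OF W(1,3) w0] by blast
  have curve0: "rational_curve r 1 (\<lambda>s. a0 + fun_scale s w0)"
    using affine_line_curve[of a0 r w0] a0 w0 W(2) by auto
  have "\<exists>s. lspan {a0 + fun_scale s w0} \<notin> B"
  proof (rule ccontr)
    assume "\<not> ?thesis"
    then have "range (\<lambda>s. lspan {a0 + fun_scale s w0}) \<subseteq> B" by auto
    then have "finite (range (\<lambda>s. lspan {a0 + fun_scale s w0}))" using assms(2) finite_subset by blast
    then show False
      using rational_curve_inj[OF curve0] infinite_UNIV_char_0 by (metis finite_imageD)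
  qed
  then obtain s where s: "lspan {a0 + fun_scale s w0} \<notin> B" by blast
  define w where "w = a0 + fun_scale s w0"
  have w: "w \<in> W" "w \<noteq> 0"
    using W(1) a0 w0 curve0 unfolding w_def rational_curve_def
    by (auto intro!: fun_space.subspace_add fun_space.subspace_scale simp del: plus_fun_apply)
  obtain a where a: "a \<in> W" "a \<notin> lspan {w}" "W = lspan {w, a}" using line_complement_vector[OF W(1,3) w] .
  show thesis
  proof (rule that)
    show "rational_curve r 1 (\<lambda>s. a + fun_scale s w)"
      using affine_line_curve[of a r w] a w W(2) by auto
    show "D \<inter> B \<subseteq> range (\<lambda>s. lspan {a + fun_scale s w})"
    proof
      fix p assume "p \<in> D \<inter> B"
      then show "p \<in> range (\<lambda>s. lspan {a + fun_scale s w})"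
        using s a(3) W(4) by (intro on_affine_line) (auto simp: w_def)
    qed
  qed
qed

definition polar_form :: "nat \<Rightarrow> (nat \<Rightarrow> nat \<Rightarrow> 'a::field) \<Rightarrow> (nat \<Rightarrow> 'a) \<Rightarrow> (nat \<Rightarrow> 'a) \<Rightarrow> 'a" where
  "polar_form r a x w = (\<Sum>k\<le>r. quad_form_deriv r a k x * w k)"

lemma polar_form_expand: "polar_form r a x y = (\<Sum>i\<le>r. \<Sum>j\<le>r. a i j * (x i * y j + y i * x j))"
proof -
  have "polar_form r a x y = (\<Sum>k\<le>r. \<Sum>j\<le>r. a k j * (y k * x j)) + (\<Sum>k\<le>r. \<Sum>j\<le>r. a j k * (x j * y k))"
    unfolding polar_form_def quad_form_deriv_def
    by (simp add: sum_distrib_left sum_distrib_right sum.distrib[symmetric] algebra_simps)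
  also have "(\<Sum>k\<le>r. \<Sum>j\<le>r. a j k * (x j * y k)) = (\<Sum>k\<le>r. \<Sum>j\<le>r. a k j * (x k * y j))"
    by (rule sum.swap)
  finally show ?thesis by (simp add: sum.distrib[symmetric] algebra_simps)
qed

lemma polar_form_sym: "polar_form r a x y = polar_form r a y x"
  unfolding polar_form_expand by (intro sum.cong refl) (simp add: algebra_simps)

lemma polar_form_add: "polar_form r a x (y + z) = polar_form r a x y + polar_form r a x z"
  unfolding polar_form_def by (simp add: distrib_left sum.distrib)

lemma polar_form_scale: "polar_form r a x (fun_scale c y) = c * polar_form r a x y"
  unfolding polar_form_def fun_scale_def by (simp add: sum_distrib_left mult_ac)

lemma polar_form_add_left: "polar_form r a (x + y) z = polar_form r a x z + polar_form r a y z"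
  using polar_form_add[of r a z x y] by (simp only: polar_form_sym[of r a z])

lemma polar_form_scale_left: "polar_form r a (fun_scale c y) x = c * polar_form r a y x"
  using polar_form_scale[of r a x c y] by (simp only: polar_form_sym[of r a x])

lemma quad_form_add: "quad_form r a (x + y) = quad_form r a x + quad_form r a y + polar_form r a x y"
  unfolding quad_form_def polar_form_expand
  by (simp add: sum.distrib[symmetric] algebra_simps)

lemma quad_form_scale: "quad_form r a (fun_scale c x) = c\<^sup>2 * quad_form r a x"
  unfolding quad_form_def fun_scale_def
  by (simp add: sum_distrib_left power2_eq_square mult_ac)

lemma polar_form_self: "polar_form r a x x = 2 * quad_form r a x"
  unfolding quad_form_def polar_form_expand by (simp add: sum_distrib_left algebra_simps)

lemma quad_form_combination:
  "quad_form r a (fun_scale \<alpha> u + (fun_scale \<beta> v + fun_scale \<gamma> w)) =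
    \<alpha>\<^sup>2 * quad_form r a u + \<beta>\<^sup>2 * quad_form r a v + \<gamma>\<^sup>2 * quad_form r a w +
    \<alpha> * \<beta> * polar_form r a u v + \<alpha> * \<gamma> * polar_form r a u w + \<beta> * \<gamma> * polar_form r a v w"
  by (simp only: quad_form_add quad_form_scale polar_form_add polar_form_scale polar_form_scale_left)
    (simp add: algebra_simps)

section \<open>Smooth and singular plane conics\<close>

text \<open>Coordinates in which the conic, projected from its point \<open>w\<close>, becomes a parabola: \<open>v\<close> spans the
tangent at \<open>w\<close> together with \<open>w\<close>, and \<open>u\<close> is normalized so that the form is \<open>x y + \<alpha> y\<^sup>2 + \<beta> y z + \<gamma> z\<^sup>2\<close>
with \<open>\<gamma> \<noteq> 0\<close>.\<close>

locale conic_chart =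
  fixes r :: nat and W :: "(nat \<Rightarrow> 'a::field) set" and a :: "nat \<Rightarrow> nat \<Rightarrow> 'a" and w u v :: "nat \<Rightarrow> 'a"
  assumes ambient: "w \<in> ambient r" "u \<in> ambient r" "v \<in> ambient r"
    and independent: "w \<noteq> 0" "u \<notin> lspan {w}" "v \<notin> lspan {w, u}"
    and W_eq: "W = lspan {w, u, v}"
    and on_conic: "quad_form r a w = 0"
    and normalized: "polar_form r a w u = 1" "polar_form r a w v = 0"
    and nondegenerate: "quad_form r a v \<noteq> 0"
begin

definition \<alpha> where "\<alpha> = quad_form r a u"
definition \<beta> where "\<beta> = polar_form r a u v"
definition \<gamma> where "\<gamma> = quad_form r a v"

definition point :: "'a \<Rightarrow> 'a \<Rightarrow> 'a \<Rightarrow> nat \<Rightarrow> 'a" where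
  "point x y z = fun_scale x w + (fun_scale y u + fun_scale z v)"

text \<open>The second intersection point of the conic with the line through \<open>w\<close> and \<open>u + s v\<close>.\<close>

definition \<phi> :: "'a \<Rightarrow> nat \<Rightarrow> 'a" where
  "\<phi> s = point (- (\<alpha> + \<beta> * s + \<gamma> * s\<^sup>2)) 1 s"

lemma \<gamma>_nonzero: "\<gamma> \<noteq> 0" using nondegenerate by (simp add: \<gamma>_def)

lemma W_points: "x \<in> W \<longleftrightarrow> (\<exists>y0 y1 y2. x = point y0 y1 y2)"
  unfolding W_eq in_span_triple point_def ..

lemma point_in_W: "point x y z \<in> W" using W_points by blast

lemma quad_point: "quad_form r a (point x y z) = x * y + \<alpha> * y\<^sup>2 + \<beta> * (y * z) + \<gamma> * z\<^sup>2"
  unfolding point_def quad_form_combination on_conic normalized \<alpha>_def \<beta>_def \<gamma>_def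
  by (simp add: algebra_simps)

lemma quad_\<phi>: "quad_form r a (\<phi> s) = 0"
  unfolding \<phi>_def quad_point by (simp add: algebra_simps)

lemma \<phi>_in_W: "\<phi> s \<in> W" unfolding \<phi>_def by (rule point_in_W)

lemma W_ambient: "W \<subseteq> ambient r"
  unfolding W_eq using ambient by (intro span_subset_coord_space) auto

lemma point_scale: "fun_scale k (point x y z) = point (k * x) (k * y) (k * z)"
  by (simp add: point_def fun_scale_def fun_eq_iff algebra_simps)

lemma point_inject: "point x y z = point x' y' z' \<longleftrightarrow> x = x' \<and> y = y' \<and> z = z'"
proof
  assume eq: "point x y z = point x' y' z'"
  have z: "z = z'"
  proof (rule ccontr)
    assume "z \<noteq> z'"
    have "(z - z') * v j = (x' - x) * w j + (y' - y) * u j" for j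
    proof -
      have "(z - z') * v j - ((x' - x) * w j + (y' - y) * u j) = point x y z j - point x' y' z' j"
        by (simp add: point_def fun_scale_def algebra_simps)
      then show ?thesis using eq by simp
    qed
    then have "v = fun_scale ((x' - x) / (z - z')) w + fun_scale ((y' - y) / (z - z')) u"
      using \<open>z \<noteq> z'\<close> by (simp add: fun_scale_def fun_eq_iff nonzero_eq_divide_eq mult.commute
          flip: add_divide_distrib)
    then show False using independent(3) in_span_pair by blast
  qed
  have y: "y = y'"
  proof (rule ccontr)
    assume "y \<noteq> y'"
    then have "u = fun_scale ((x' - x) / (y - y')) w"
      using eq z by (auto simp: point_def fun_scale_def fun_eq_iff field_simps)
    then show False using independent(2) unfolding fun_space.span_singleton by blast
  qed
  have "fun_scale (x - x') w = 0"
    using eq z y by (auto simp: point_def fun_scale_def fun_eq_iff algebra_simps)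
  then show "x = x' \<and> y = y' \<and> z = z'" using z y independent(1) by simp
qed simp

lemma curve: "rational_curve r 2 \<phi>"
proof -
  have "\<phi> s \<noteq> 0" for s
  proof
    assume "\<phi> s = 0"
    also have "0 = point 0 0 0" by (simp add: point_def)
    finally show False unfolding \<phi>_def point_inject by simp
  qed
  moreover have "s = t" if st: "\<phi> s \<in> lspan {\<phi> t}" for s t
  proof -
    obtain k where "\<phi> s = fun_scale k (\<phi> t)" using st by (auto simp: fun_space.span_singleton)
    then show ?thesis unfolding \<phi>_def point_scale point_inject by simp
  qed
  moreover have "\<exists>f. \<forall>i. degree (f i) \<le> 2 \<and> (\<forall>s. \<phi> s i = poly (f i) s)"
    by (intro exI[of _ "\<lambda>i. [:- (\<alpha> * w i) + u i, - (\<beta> * w i) + v i, - (\<gamma> * w i):]"])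
      (auto simp: \<phi>_def point_def fun_scale_def algebra_simps power2_eq_square)
  ultimately show ?thesis using \<phi>_in_W W_ambient unfolding rational_curve_def by blast
qed

lemma conic_point_cases:
  assumes "x \<in> W" "quad_form r a x = 0" "x \<notin> lspan {w}"
  shows "\<exists>s. x \<in> lspan {\<phi> s}"
proof -
  obtain y0 y1 y2 where x: "x = point y0 y1 y2" using assms(1) W_points by blast
  have q: "y0 * y1 + \<alpha> * y1\<^sup>2 + \<beta> * (y1 * y2) + \<gamma> * y2\<^sup>2 = 0" using assms(2) x quad_point by simp
  have "y1 \<noteq> 0"
  proof
    assume y1: "y1 = 0"
    then have "y2 = 0" using q \<gamma>_nonzero by simp
    then have "x = fun_scale y0 w" using x y1 by (simp add: point_def)
    then show False using assms(3) unfolding fun_space.span_singleton by blast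
  qed
  define s where "s = y2 / y1"
  have y2: "y2 = y1 * s" using \<open>y1 \<noteq> 0\<close> by (simp add: s_def)
  have "y1 * (y0 + y1 * (\<alpha> + \<beta> * s + \<gamma> * s\<^sup>2)) = 0"
    using q unfolding y2 by (simp add: algebra_simps power2_eq_square)
  then have y0: "y0 = - (y1 * (\<alpha> + \<beta> * s + \<gamma> * s\<^sup>2))" using \<open>y1 \<noteq> 0\<close> by (simp add: eq_neg_iff_add_eq_0)
  have "x = fun_scale y1 (\<phi> s)" unfolding x y2 y0 \<phi>_def point_scale by (simp add: algebra_simps)
  then show ?thesis unfolding fun_space.span_singleton by blast
qed

text \<open>Divided differences of the quadratic parametrization: two chords give a multiple of \<open>w\<close>, then \<open>v\<close> and \<open>u\<close>.\<close>

lemma three_points_span: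
  assumes distinct: "s \<noteq> t" "s \<noteq> t'" "t \<noteq> t'"
    and S: "fun_space.subspace S" "\<phi> s \<in> S" "\<phi> t \<in> S" "\<phi> t' \<in> S"
  shows "W \<subseteq> S"
proof -
  note mem = fun_space.subspace_add[OF S(1)] fun_space.subspace_scale[OF S(1)]
    fun_space.subspace_diff[OF S(1)]
  have chord: "point (- (\<beta> + \<gamma> * (p + p'))) 0 1 \<in> S" if "\<phi> p \<in> S" "\<phi> p' \<in> S" "p \<noteq> p'" for p p'
  proof -
    have "point (- (\<beta> + \<gamma> * (p + p'))) 0 1 = fun_scale (1 / (p - p')) (\<phi> p - \<phi> p')"
      using that(3) by (simp add: \<phi>_def point_def fun_scale_def fun_eq_iff divide_simps)
        (simp add: algebra_simps power2_eq_square)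
    then show ?thesis using that mem by metis
  qed
  have "w = fun_scale (1 / (\<gamma> * (t' - t)))
      (point (- (\<beta> + \<gamma> * (s + t))) 0 1 - point (- (\<beta> + \<gamma> * (s + t'))) 0 1)"
    using \<gamma>_nonzero distinct by (simp add: point_def fun_scale_def fun_eq_iff divide_simps)
      (simp add: algebra_simps)
  then have w: "w \<in> S" using chord[OF S(2,3) distinct(1)] chord[OF S(2,4) distinct(2)] mem by metis
  have "v = point (- (\<beta> + \<gamma> * (s + t))) 0 1 + fun_scale (\<beta> + \<gamma> * (s + t)) w"
    by (simp add: point_def fun_scale_def fun_eq_iff algebra_simps)
  then have v: "v \<in> S" using chord[OF S(2,3) distinct(1)] w mem by metis
  have "u = \<phi> s + (fun_scale (\<alpha> + \<beta> * s + \<gamma> * s\<^sup>2) w - fun_scale s v)"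
    by (simp add: \<phi>_def point_def fun_scale_def fun_eq_iff algebra_simps)
  then have "u \<in> S" using S(2) w v mem by metis
  then show ?thesis unfolding W_eq using w v S(1) by (intro fun_space.span_minimal) auto
qed

text \<open>Along the parametrization the second form is a polynomial of degree at most four. With five roots it is
zero, and its coefficients say that the two forms are proportional.\<close>

lemma conic_through_five_points:
  assumes U: "finite U" "5 \<le> card U" "\<And>s. s \<in> U \<Longrightarrow> quad_form r b (\<phi> s) = 0"
  shows "\<exists>k. \<forall>x\<in>W. quad_form r b x = k * quad_form r a x"
proof -
  define A where "A = quad_form r b w"
  define B where "B = quad_form r b u"
  define C where "C = quad_form r b v"
  define D where "D = polar_form r b w u"
  define E where "E = polar_form r b w v"
  define G where "G = polar_form r b u v"
  have quad: "quad_form r b (point x y z) = A * x\<^sup>2 + B * y\<^sup>2 + C * z\<^sup>2 + D * x * y + E * x * z + G * y * z"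
    for x y z
    unfolding point_def quad_form_combination A_def B_def C_def D_def E_def G_def
    by (simp add: algebra_simps)
  define p where "p = [:A * \<alpha>\<^sup>2 + B - D * \<alpha>, 2 * A * \<alpha> * \<beta> - D * \<beta> - E * \<alpha> + G,
    A * (\<beta>\<^sup>2 + 2 * \<alpha> * \<gamma>) + C - D * \<gamma> - E * \<beta>, 2 * A * \<beta> * \<gamma> - E * \<gamma>, A * \<gamma>\<^sup>2:]"
  have "poly p s = quad_form r b (\<phi> s)" for s
    unfolding \<phi>_def quad p_def by (simp add: algebra_simps power2_eq_square)
  then have "poly p s = 0" if "s \<in> U" for s using U(3) that by simp
  moreover have "degree p < card U"
    using U(2) degree_pCons_le unfolding p_def by (auto intro!: le_less_trans[OF degree_pCons_le] Suc_lessI)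
  ultimately have "p = 0" using poly_zero_many_roots[OF U(1)] by blast
  then have coeffs: "A * \<gamma>\<^sup>2 = 0" "2 * A * \<beta> * \<gamma> - E * \<gamma> = 0"
    "A * (\<beta>\<^sup>2 + 2 * \<alpha> * \<gamma>) + C - D * \<gamma> - E * \<beta> = 0"
    "2 * A * \<alpha> * \<beta> - D * \<beta> - E * \<alpha> + G = 0" "A * \<alpha>\<^sup>2 + B - D * \<alpha> = 0"
    unfolding p_def by (simp_all del: mult_eq_0_iff)
  have "A = 0" using coeffs(1) \<gamma>_nonzero by simp
  moreover from this have "E = 0" using coeffs(2) \<gamma>_nonzero by simp
  moreover from calculation have "C = D * \<gamma>" "G = D * \<beta>" "B = D * \<alpha>" using coeffs by simp_all
  ultimately have "quad_form r b (point x y z) = D * quad_form r a (point x y z)" for x y z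
    unfolding quad quad_point by (simp add: algebra_simps)
  then show ?thesis using W_points by (intro exI[of _ D]) auto
qed

end

text \<open>If the form vanished at \<open>v\<close>, a combination of \<open>v\<close> and \<open>w\<close> would be a singular point of the conic.\<close>

lemma conic_chart_exists:
  fixes W :: "(nat \<Rightarrow> 'a::field_char_0) set"
  assumes W: "fun_space.subspace W" "W \<subseteq> ambient r" "fun_space.dim W = 3"
    and smooth: "\<And>x. x \<in> W \<Longrightarrow> x \<noteq> 0 \<Longrightarrow> quad_form r a x = 0 \<Longrightarrow> \<exists>y\<in>W. polar_form r a x y \<noteq> 0"
    and w: "w \<in> W" "w \<noteq> 0" "quad_form r a w = 0"
  obtains u v where "conic_chart r W a w u v"
proof -
  note mem = fun_space.subspace_add[OF W(1)] fun_space.subspace_scale[OF W(1)]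
  obtain u0 where u0: "u0 \<in> W" "polar_form r a w u0 \<noteq> 0" using smooth[OF w] by blast
  define u where "u = fun_scale (1 / polar_form r a w u0) u0"
  have u: "u \<in> W" "polar_form r a w u = 1" using u0 mem by (simp_all add: u_def polar_form_scale)
  have ww: "polar_form r a w w = 0" using w(3) by (simp add: polar_form_self)
  have uw: "u \<notin> lspan {w}" using u(2) ww by (auto simp: fun_space.span_singleton polar_form_scale)
  have "card {w, u} < fun_space.dim W" using independent_pair[OF w(2) uw] W(3) by simp
  then have "\<not> W \<subseteq> lspan {w, u}" by (intro not_subset_span_small) auto
  then obtain v0 where v0: "v0 \<in> W" "v0 \<notin> lspan {w, u}" by blast
  define v where "v = v0 + fun_scale (- polar_form r a w v0) u"
  have v: "v \<in> W" unfolding v_def by (rule mem(1)[OF v0(1) mem(2)[OF u(1)]])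
  have vw: "polar_form r a w v = 0" unfolding v_def polar_form_add polar_form_scale u(2) by simp
  have vwu: "v \<notin> lspan {w, u}"
  proof
    assume "v \<in> lspan {w, u}"
    moreover have "u \<in> lspan {w, u}" by (simp add: fun_space.span_base)
    ultimately have "v + fun_scale (polar_form r a w v0) u \<in> lspan {w, u}"
      by (intro fun_space.span_add fun_space.span_scale)
    also have "v + fun_scale (polar_form r a w v0) u = v0"
      by (simp add: v_def fun_scale_def fun_eq_iff)
    finally show False using v0 by simp
  qed
  have span: "W = lspan {w, u, v}" by (rule span_triple_eq_space[OF W(1,3) w(1) u(1) v w(2) uw vwu])
  have "quad_form r a v \<noteq> 0"
  proof
    assume qv: "quad_form r a v = 0"
    let ?k = "polar_form r a u v"
    let ?y = "v + fun_scale (- ?k) w"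
    have y: "?y \<in> W" by (rule mem(1)[OF v mem(2)[OF w(1)]])
    have "?y \<noteq> 0"
    proof
      assume "?y = 0"
      then have "v = fun_scale ?k w" by (simp add: fun_scale_def fun_eq_iff)
      moreover have "fun_scale ?k w \<in> lspan {w, u}"
        by (intro fun_space.span_scale fun_space.span_base) simp
      ultimately show False using vwu by metis
    qed
    moreover have "quad_form r a ?y = 0"
      unfolding quad_form_add quad_form_scale polar_form_scale
      using qv w(3) vw polar_form_sym[of r a v w] by simp
    moreover have "polar_form r a ?y z = 0" if z: "z \<in> W" for z
    proof -
      obtain c0 c1 c2 where z: "z = fun_scale c0 w + (fun_scale c1 u + fun_scale c2 v)"
        using z unfolding span in_span_triple by blast
      have "polar_form r a ?y w = 0" "polar_form r a ?y u = 0" "polar_form r a ?y v = 0"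
        using ww vw qv u(2) polar_form_sym[of r a v w] polar_form_sym[of r a v u]
        by (simp_all only: polar_form_add_left polar_form_scale_left polar_form_self) simp_all
      then show ?thesis unfolding z by (simp only: polar_form_add polar_form_scale) simp
    qed
    ultimately show False using smooth[OF y] by blast
  qed
  then have "conic_chart r W a w u v"
    using w u v uw vw vwu span W(2) unfolding conic_chart_def by blast
  then show thesis by (rule that)
qed

lemma smooth_conic_chart:
  fixes T :: "(nat \<Rightarrow> 'a::field_char_0) set set"
  assumes T: "smooth_conic r T" and ne: "T \<noteq> {}" and B: "finite B"
  obtains W a w u v where "conic_chart r W a w u v" "lspan {w} \<notin> B"
    "T = {p \<in> Pr r. p \<subseteq> W \<and> (\<forall>x\<in>p. quad_form r a x = 0)}"
proof -
  obtain W a where W: "fun_space.subspace W" "W \<subseteq> ambient r" "fun_space.dim W = 3"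
    and T_eq: "T = {p \<in> Pr r. p \<subseteq> W \<and> (\<forall>x\<in>p. quad_form r a x = 0)}"
    and smooth: "\<forall>p\<in>T. \<forall>x\<in>p. x \<noteq> 0 \<longrightarrow> (\<exists>w\<in>W. polar_form r a x w \<noteq> 0)"
    using T unfolding smooth_conic_def polar_form_def by blast
  have in_T: "lspan {x} \<in> T" if "x \<in> W" "x \<noteq> 0" "quad_form r a x = 0" for x
  proof -
    have "lspan {x} \<subseteq> W" using that W(1) by (intro fun_space.span_minimal) auto
    moreover have "\<forall>y\<in>lspan {x}. quad_form r a y = 0"
      using that(3) by (auto simp: fun_space.span_singleton quad_form_scale)
    ultimately show ?thesis using span_singleton_Pr[of x r] that W(2) unfolding T_eq by blast
  qed
  have smooth': "\<exists>y\<in>W. polar_form r a x y \<noteq> 0" if "x \<in> W" "x \<noteq> 0" "quad_form r a x = 0" for x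
    using smooth in_T[OF that] that(2) fun_space.span_base[of x "{x}"] by blast
  obtain p where p: "p \<in> T" using ne by blast
  then have "p \<in> Pr r" using T_eq by blast
  note rp = rep_Pr[OF this]
  have "rep p \<in> p" using rp fun_space.span_base[of "rep p" "{rep p}"] by simp
  then have "rep p \<in> W" "quad_form r a (rep p) = 0" using p T_eq by auto
  then obtain u0 v0 where "conic_chart r W a (rep p) u0 v0"
    using conic_chart_exists[OF W smooth' _ rp(1)] by blast
  then interpret c: conic_chart r W a "rep p" u0 v0 .
  have "\<exists>s. lspan {c.\<phi> s} \<notin> B"
  proof (rule ccontr)
    assume "\<not> ?thesis"
    then have "range (\<lambda>s. lspan {c.\<phi> s}) \<subseteq> B" by auto
    then have "finite (range (\<lambda>s. lspan {c.\<phi> s}))" using B finite_subset by blast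
    then show False
      using rational_curve_inj[OF c.curve] infinite_UNIV_char_0 by (metis finite_imageD)
  qed
  then obtain s where s: "lspan {c.\<phi> s} \<notin> B" by blast
  have "c.\<phi> s \<noteq> 0" using c.curve by (simp add: rational_curve_def)
  then obtain u v where "conic_chart r W a (c.\<phi> s) u v"
    using conic_chart_exists[OF W smooth' c.\<phi>_in_W _ c.quad_\<phi>] by blast
  then show thesis using that s T_eq by blast
qed

text \<open>Modulo a singular point \<open>x\<close> the form depends on two variables, so over an algebraically closed field
it is a product of two linear factors.\<close>

lemma singular_conic_two_lines:
  fixes W :: "(nat \<Rightarrow> 'a::alg_closed_field) set"
  assumes W: "fun_space.subspace W" "fun_space.dim W = 3"
    and x: "x \<in> W" "x \<noteq> 0" "quad_form r a x = 0" "\<And>y. y \<in> W \<Longrightarrow> polar_form r a x y = 0"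
    and nz: "z \<in> W" "quad_form r a z \<noteq> 0"
  obtains y1 y2 where "y1 \<in> W" "y2 \<in> W" "y1 \<notin> lspan {x}" "y2 \<notin> lspan {x}"
    "\<And>y. y \<in> W \<Longrightarrow> quad_form r a y = 0 \<Longrightarrow> y \<in> lspan {x, y1} \<union> lspan {x, y2}"
proof -
  have "card {x} < fun_space.dim W" using W by simp
  then have "\<not> W \<subseteq> lspan {x}" by (intro not_subset_span_small) auto
  then obtain u where u: "u \<in> W" "u \<notin> lspan {x}" by blast
  have "card {x, u} < fun_space.dim W" using independent_pair[OF x(2) u(2)] W(2) by simp
  then have "\<not> W \<subseteq> lspan {x, u}" by (intro not_subset_span_small) auto
  then obtain v where v: "v \<in> W" "v \<notin> lspan {x, u}" by blast
  have span: "W = lspan {x, u, v}" by (rule span_triple_eq_space[OF W x(1) u(1) v(1) x(2) u(2) v(2)])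
  define A B C where "A = quad_form r a u" and "B = polar_form r a u v" and "C = quad_form r a v"
  have quad: "quad_form r a (fun_scale k0 x + (fun_scale k1 u + fun_scale k2 v)) =
      A * k1\<^sup>2 + B * k1 * k2 + C * k2\<^sup>2" for k0 k1 k2
    unfolding quad_form_combination x(3) x(4)[OF u(1)] x(4)[OF v(1)] A_def B_def C_def
    by (simp add: algebra_simps)
  have ABC: "A \<noteq> 0 \<or> B \<noteq> 0 \<or> C \<noteq> 0"
  proof -
    obtain k0 k1 k2 where "z = fun_scale k0 x + (fun_scale k1 u + fun_scale k2 v)"
      using nz(1) unfolding span in_span_triple by blast
    then show ?thesis using nz(2) quad by auto
  qed
  have off_x: "fun_scale k1 u + fun_scale k2 v \<notin> lspan {x}" if "k1 \<noteq> 0 \<or> k2 \<noteq> 0" for k1 k2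
  proof
    assume "fun_scale k1 u + fun_scale k2 v \<in> lspan {x}"
    then obtain k where k: "fun_scale k1 u + fun_scale k2 v = fun_scale k x"
      unfolding fun_space.span_singleton by blast
    show False
    proof (cases "k2 = 0")
      case True
      then have "u = fun_scale (k / k1) x" using k that by (auto simp: fun_scale_def fun_eq_iff field_simps)
      then show False using u(2) unfolding fun_space.span_singleton by blast
    next
      case False
      then have "v = fun_scale (k / k2) x + fun_scale (- k1 / k2) u"
        using k by (auto simp: fun_scale_def fun_eq_iff field_simps)
      then show False using v(2) in_span_pair by blast
    qed
  qed
  have in_W: "fun_scale k1 u + fun_scale k2 v \<in> W" for k1 k2
    using u v W(1) by (intro fun_space.subspace_add fun_space.subspace_scale) auto
  have on_line: "fun_scale k0 x + (fun_scale k1 u + fun_scale k2 v) \<in> lspan {x, fun_scale l1 u + fun_scale l2 v}"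
    if "k1 = m * l1" "k2 = m * l2" for k0 k1 k2 l1 l2 m
  proof -
    have "fun_scale k0 x + (fun_scale k1 u + fun_scale k2 v) =
        fun_scale k0 x + fun_scale m (fun_scale l1 u + fun_scale l2 v)"
      using that by (simp add: fun_scale_def fun_eq_iff algebra_simps)
    then show ?thesis unfolding in_span_pair by blast
  qed
  show thesis
  proof (cases "C = 0")
    case True
    show thesis
    proof (rule that[OF in_W in_W off_x off_x])
      show "(0::'a) \<noteq> 0 \<or> (1::'a) \<noteq> 0" by simp
      show "(if B = 0 then 0 else B) \<noteq> 0 \<or> (if B = 0 then 1 else - A) \<noteq> 0" using ABC by auto
      fix y assume y: "y \<in> W" "quad_form r a y = 0"
      obtain k0 k1 k2 where k: "y = fun_scale k0 x + (fun_scale k1 u + fun_scale k2 v)"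
        using y(1) unfolding span in_span_triple by blast
      have q: "k1 * (A * k1 + B * k2) = 0"
        using y(2) unfolding k quad using True by (simp add: algebra_simps power2_eq_square)
      show "y \<in> lspan {x, fun_scale 0 u + fun_scale 1 v} \<union>
          lspan {x, fun_scale (if B = 0 then 0 else B) u + fun_scale (if B = 0 then 1 else - A) v}"
      proof (cases "k1 = 0")
        case True
        then show ?thesis unfolding k using on_line[of k1 k2 0 k2 1 k0] by simp
      next
        case False
        then have *: "A * k1 + B * k2 = 0" using q by simp
        then have "B \<noteq> 0" using False ABC True \<open>C = 0\<close> by auto
        moreover from this have "k2 = k1 / B * (- A)" using * by (simp add: field_simps eq_neg_iff_add_eq_0)
        ultimately show ?thesis unfolding k using on_line[of k1 "k1 / B" B k2 "- A" k0] by simp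
      qed
    qed
  next
    case False
    \<comment> \<open>The class axiom takes the coefficients of the polynomial \<open>A + B t + C t\<^sup>2\<close> as a function.\<close>
    have "\<exists>t. (\<Sum>k\<le>2. (\<lambda>k::nat. if k = 0 then A else if k = 1 then B else C) k * t ^ k) = 0"
      using False by (intro alg_closed) auto
    then obtain t where t: "A + B * t + C * t\<^sup>2 = 0"
      by (auto simp: numeral_2_eq_2)
    \<comment> \<open>The second root, from the sum of the roots.\<close>
    define t' where "t' = - B / C - t"
    have B: "B = - C * (t + t')" using False by (simp add: t'_def field_simps)
    have A: "A = C * t * t'" using t unfolding B by (simp add: algebra_simps power2_eq_square)
    show thesis
    proof (rule that[OF in_W in_W off_x off_x])
      show "(1::'a) \<noteq> 0 \<or> t \<noteq> 0" "(1::'a) \<noteq> 0 \<or> t' \<noteq> 0" by simp_all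
      fix y assume y: "y \<in> W" "quad_form r a y = 0"
      obtain k0 k1 k2 where k: "y = fun_scale k0 x + (fun_scale k1 u + fun_scale k2 v)"
        using y(1) unfolding span in_span_triple by blast
      have "C * ((k2 - t * k1) * (k2 - t' * k1)) = 0"
        using y(2) unfolding k quad A B by (simp add: algebra_simps power2_eq_square)
      then have "k2 = k1 * t \<or> k2 = k1 * t'" using False by (auto simp: mult.commute)
      then show "y \<in> lspan {x, fun_scale 1 u + fun_scale t v} \<union> lspan {x, fun_scale 1 u + fun_scale t' v}"
        unfolding k using on_line[of k1 k1 1 k2 t k0] on_line[of k1 k1 1 k2 t' k0] by auto
    qed
  qed
qed

section \<open>Relations among points of projective space\<close>

lemma span_subset_subspace: "fun_space.subspace W \<Longrightarrow> x \<in> W \<Longrightarrow> lspan {x} \<subseteq> W"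
  by (intro fun_space.span_minimal) auto

lemma point_subset_iff:
  assumes "fun_space.subspace W" "p \<in> Pr r"
  shows "p \<subseteq> W \<longleftrightarrow> rep p \<in> W"
proof -
  note p = rep_Pr[OF assms(2)]
  have "rep p \<in> p" using p(2) fun_space.span_base[of "rep p" "{rep p}"] by simp
  then show ?thesis using span_subset_subspace[OF assms(1), of "rep p"] p(2) by auto
qed

lemma dim_coordinate_frame:
  assumes "coordinate_frame r W b \<xi>"
  shows "fun_space.dim W = 3"
proof -
  have W: "fun_space.subspace W" and b: "\<And>i. i < 3 \<Longrightarrow> b i \<in> W"
    and \<xi>: "\<And>i. i < 3 \<Longrightarrow> hform r (Suc 0) (\<xi> i)"
    and dual: "\<And>i j. i < 3 \<Longrightarrow> j < 3 \<Longrightarrow> \<xi> i (b j) = (if i = j then 1 else 0)"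
    and expand: "\<And>x. x \<in> W \<Longrightarrow> x = (\<Sum>i<3. fun_scale (\<xi> i x) (b i))"
    using assms by (auto simp: coordinate_frame_def)
  have three: "{..<3::nat} = {0,1,2}" by auto
  have off: "b i \<notin> lspan S" if "i < 3" "\<And>y. y \<in> S \<Longrightarrow> \<xi> i y = 0" for i S
    using linear_form_kernel_span[OF \<xi>[OF that(1)] that(2)] dual[OF that(1) that(1)] by fastforce
  have "b 0 \<notin> lspan {}" "b 1 \<notin> lspan {b 0}" "b 2 \<notin> lspan {b 0, b 1}"
    by (rule off; auto simp: dual)+
  moreover have "W = lspan {b 0, b 1, b 2}"
  proof
    show "lspan {b 0, b 1, b 2} \<subseteq> W" using W b by (intro fun_space.span_minimal) auto
    show "W \<subseteq> lspan {b 0, b 1, b 2}"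
    proof
      fix x assume "x \<in> W"
      then have "x = (\<Sum>i<3. fun_scale (\<xi> i x) (b i))" by (rule expand)
      also have "\<dots> \<in> lspan {b 0, b 1, b 2}"
        unfolding three by (intro fun_space.span_sum fun_space.span_scale fun_space.span_base) auto
      finally show "x \<in> lspan {b 0, b 1, b 2}" .
    qed
  qed
  ultimately show ?thesis using dim_span_triple[of "b 0" "b 1" "b 2"] by simp
qed

lemma point_set_line:
  assumes "point_set r Y" "x \<in> Y" "y \<in> Y" "x \<noteq> y"
  shows "is_line r {p \<in> Pr r. p \<subseteq> lspan {x, y}}"
proof (rule is_line_span)
  show "x \<in> ambient r" "y \<in> ambient r" using assms by (auto simp: point_set_def)
  show "x \<noteq> 0" using assms by (metis point_set_def)
  show "y \<notin> lspan {x}" using assms unfolding point_set_def by metis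
qed

text \<open>The plane conics of the classification are split here into smooth ones and pairs of lines.\<close>

lemma relation_on_lines_or_smooth_conic:
  fixes Z :: "(nat \<Rightarrow> 'a::{alg_closed_field, field_char_0}) set set"
  assumes Z: "finite Z" "Z \<subseteq> Pr r" "Z \<noteq> {}" and sup: "supports r e (rep ` Z)" and small: "card Z < 3 * e"
  shows "(\<exists>L1 L2. is_line r L1 \<and> is_line r L2 \<and> Z \<subseteq> L1 \<union> L2) \<or> (\<exists>T. smooth_conic r T \<and> Z \<subseteq> T)"
proof -
  have PZ: "point_set r (rep ` Z)" by (rule point_set_rep[OF Z(1,2)])
  have amb: "rep ` Z \<subseteq> ambient r" using PZ by (simp add: point_set_def)
  have "card (rep ` Z) < 3 * e" using small card_image_le[OF Z(1), of rep] by simp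
  then have "on_two_lines (rep ` Z) \<or> on_plane_conic r (rep ` Z)"
    using supports_on_two_lines_or_conic[OF PZ sup] Z(3) by simp
  then show ?thesis
  proof
    assume "on_two_lines (rep ` Z)"
    then obtain a b c d where abcd: "a \<in> rep ` Z" "b \<in> rep ` Z" "c \<in> rep ` Z" "d \<in> rep ` Z" "a \<noteq> b" "c \<noteq> d"
      and sub: "rep ` Z \<subseteq> lspan {a, b} \<union> lspan {c, d}" unfolding on_two_lines_def by blast
    have line: "is_line r {p \<in> Pr r. p \<subseteq> lspan {x, y}}" if "x \<in> rep ` Z" "y \<in> rep ` Z" "x \<noteq> y" for x y
      using that by (rule point_set_line[OF PZ])
    have "Z \<subseteq> {p \<in> Pr r. p \<subseteq> lspan {a, b}} \<union> {p \<in> Pr r. p \<subseteq> lspan {c, d}}"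
    proof
      fix p assume p: "p \<in> Z"
      then have "p \<in> Pr r" "rep p \<in> lspan {a, b} \<union> lspan {c, d}" using Z(2) sub by auto
      then show "p \<in> {p \<in> Pr r. p \<subseteq> lspan {a, b}} \<union> {p \<in> Pr r. p \<subseteq> lspan {c, d}}"
        by (simp add: point_subset_iff[OF fun_space.subspace_span])
    qed
    then show ?thesis using line[OF abcd(1,2,5)] line[OF abcd(3,4,6)] by (intro disjI1 exI conjI)
  next
    assume "on_plane_conic r (rep ` Z)"
    then obtain W q where W: "plane_conic r W q" "rep ` Z \<subseteq> W" "\<forall>z\<in>rep ` Z. q z = 0"
      unfolding on_plane_conic_def by (elim exE conjE)
    obtain b \<xi> where frame: "coordinate_frame r W b \<xi>" using W(1) by (auto simp: plane_conic_def)
    have Wsub: "fun_space.subspace W" using frame by (simp add: coordinate_frame_def)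
    have dimW: "fun_space.dim W = 3" by (rule dim_coordinate_frame[OF frame])
    have Wamb: "W \<subseteq> ambient r" using W(1) by (simp add: plane_conic_def)
    obtain a where a: "\<And>x. q x = quad_form r a x"
      using hform_degree_two_cases[of r q] W(1) by (auto simp: plane_conic_def)
    obtain z where nz: "z \<in> W" "quad_form r a z \<noteq> 0" using W(1) a by (auto simp: plane_conic_def)
    define T where "T = {p \<in> Pr r. p \<subseteq> W \<and> (\<forall>x\<in>p. quad_form r a x = 0)}"
    have ZT: "Z \<subseteq> T"
    proof
      fix p assume p: "p \<in> Z"
      then have pPr: "p \<in> Pr r" using Z(2) by auto
      have "rep p \<in> W" "quad_form r a (rep p) = 0" using W(2,3) a p by auto
      moreover from this have "\<forall>x\<in>lspan {rep p}. quad_form r a x = 0"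
        by (auto simp: fun_space.span_singleton quad_form_scale)
      ultimately show "p \<in> T"
        unfolding T_def using pPr rep_Pr(2)[OF pPr] point_subset_iff[OF Wsub pPr] by simp
    qed
    show ?thesis
    proof (cases "smooth_conic r T")
      case True
      then show ?thesis using ZT by blast
    next
      case False
      then have "\<not> (\<forall>p\<in>T. \<forall>x\<in>p. x \<noteq> 0 \<longrightarrow> (\<exists>w\<in>W. polar_form r a x w \<noteq> 0))"
        using Wsub Wamb dimW unfolding smooth_conic_def T_def polar_form_def by blast
      then obtain p x where "p \<in> T" "x \<in> p" "x \<noteq> 0" and polar: "\<And>y. y \<in> W \<Longrightarrow> polar_form r a x y = 0"
        by blast
      then have x: "x \<in> W" "x \<noteq> 0" "quad_form r a x = 0" by (auto simp: T_def)
      obtain y1 y2 where y: "y1 \<in> W" "y2 \<in> W" "y1 \<notin> lspan {x}" "y2 \<notin> lspan {x}"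
        and cover: "\<And>y. y \<in> W \<Longrightarrow> quad_form r a y = 0 \<Longrightarrow> y \<in> lspan {x, y1} \<union> lspan {x, y2}"
        using singular_conic_two_lines[OF Wsub dimW x polar nz] by blast
      have "Z \<subseteq> {p \<in> Pr r. p \<subseteq> lspan {x, y1}} \<union> {p \<in> Pr r. p \<subseteq> lspan {x, y2}}"
      proof
        fix p assume p: "p \<in> Z"
        then have "p \<in> Pr r" "rep p \<in> lspan {x, y1} \<union> lspan {x, y2}" using Z(2) cover W(2,3) a by auto
        then show "p \<in> {p \<in> Pr r. p \<subseteq> lspan {x, y1}} \<union> {p \<in> Pr r. p \<subseteq> lspan {x, y2}}"
          by (simp add: point_subset_iff[OF fun_space.subspace_span])
      qed
      moreover have "is_line r {p \<in> Pr r. p \<subseteq> lspan {x, y1}}" "is_line r {p \<in> Pr r. p \<subseteq> lspan {x, y2}}"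
        using x y Wamb by (intro is_line_span; blast)+
      ultimately show ?thesis by (intro disjI1 exI conjI)
    qed
  qed
qed

lemma supporting_points_residual:
  assumes Z: "finite Z" "Z \<subseteq> Pr r" and sup: "supports r (Suc n) (rep ` Z)" and f: "hform r (Suc 0) f"
    and p: "p \<in> Z" "f (rep p) \<noteq> 0"
  shows "n + 2 \<le> card {p \<in> Z. f (rep p) \<noteq> 0}"
proof -
  have PZ: "point_set r (rep ` Z)" by (rule point_set_rep[OF Z])
  let ?Y = "{z \<in> rep ` Z. f z \<noteq> 0}"
  have "supports r n ?Y" using sup Z(1) f by (intro supports_residual_linear) auto
  moreover have "point_set r ?Y" by (rule point_set_subset[OF PZ]) auto
  moreover have "?Y \<noteq> {}" using p by auto
  ultimately have "n + 2 \<le> card ?Y" by (intro card_supports_ge)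
  also have "?Y = rep ` {p \<in> Z. f (rep p) \<noteq> 0}" by auto
  also have "card \<dots> \<le> card {p \<in> Z. f (rep p) \<noteq> 0}" using Z(1) by (intro card_image_le) auto
  finally show ?thesis .
qed

lemma supporting_points_card:
  assumes Z: "finite Z" "Z \<subseteq> Pr r" "Z \<noteq> {}" and sup: "supports r e (rep ` Z)"
  shows "e + 2 \<le> card Z"
  using card_supports_ge[OF point_set_rep[OF Z(1,2)] sup] card_image_le[OF Z(1), of rep] Z(3) by simp

lemma supporting_points_not_collinear:
  assumes Z: "finite Z" "Z \<subseteq> Pr r" "Z \<noteq> {}" and sup: "supports r e (rep ` Z)"
    and no_line: "\<And>L. is_line r L \<Longrightarrow> \<not> Z \<subseteq> L"
  shows "2 * e + 2 \<le> card Z"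
proof (rule ccontr)
  assume small: "\<not> ?thesis"
  have PZ: "point_set r (rep ` Z)" by (rule point_set_rep[OF Z(1,2)])
  have "card (rep ` Z) \<le> 2 * e + 1" using small card_image_le[OF Z(1), of rep] by simp
  then obtain a b where ab: "a \<in> rep ` Z" "b \<in> rep ` Z" "a \<noteq> b" "rep ` Z \<subseteq> lspan {a, b}"
    using supports_small_collinear[OF PZ sup] Z(3) by blast
  have line: "is_line r {p \<in> Pr r. p \<subseteq> lspan {a, b}}"
    using ab(1-3) by (rule point_set_line[OF PZ])
  have "Z \<subseteq> {p \<in> Pr r. p \<subseteq> lspan {a, b}}"
  proof
    fix p assume p: "p \<in> Z"
    then have "p \<in> Pr r" "rep p \<in> lspan {a, b}" using Z(2) ab(4) by auto
    then show "p \<in> {p \<in> Pr r. p \<subseteq> lspan {a, b}}"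
      by (simp add: point_subset_iff[OF fun_space.subspace_span])
  qed
  then show False using no_line[OF line] by blast
qed

lemma lines_meet_once:
  assumes L: "is_line r L" "is_line r L'" "L \<noteq> L'" and X: "finite X" "X \<subseteq> L" "X \<subseteq> L'"
  shows "card X \<le> 1"
proof (rule ccontr)
  assume "\<not> ?thesis"
  then have "2 \<le> card X" by simp
  then obtain Y where Y: "Y \<subseteq> X" "card Y = 2" by (meson obtain_subset_with_card_n)
  then obtain p q where pq: "p \<in> X" "q \<in> X" "p \<noteq> q" by (auto simp: card_2_iff)
  obtain W where W: "fun_space.subspace W" "fun_space.dim W = 2" "L = {p \<in> Pr r. p \<subseteq> W}"
    using is_lineE[OF L(1)] .
  obtain W' where W': "fun_space.subspace W'" "fun_space.dim W' = 2" "L' = {p \<in> Pr r. p \<subseteq> W'}"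
    using is_lineE[OF L(2)] .
  have "p \<in> L" "q \<in> L" "p \<in> L'" "q \<in> L'" using pq X by auto
  then have pq': "p \<in> Pr r" "q \<in> Pr r" "p \<subseteq> W" "q \<subseteq> W" "p \<subseteq> W'" "q \<subseteq> W'" using W(3) W'(3) by auto
  note rp = rep_Pr[OF pq'(1)] and rq = rep_Pr[OF pq'(2)]
  have mem: "rep p \<in> W" "rep q \<in> W" "rep p \<in> W'" "rep q \<in> W'"
    using pq' point_subset_iff[OF W(1)] point_subset_iff[OF W'(1)] by auto
  have "rep q \<notin> lspan {rep p}"
    using span_singleton_eq[of "rep q" "rep p"] rp rq pq(3) by auto
  then have "W = lspan {rep p, rep q}" "W' = lspan {rep p, rep q}"
    using span_pair_eq_plane[OF W(1,2) mem(1,2) rp(1)] span_pair_eq_plane[OF W'(1,2) mem(3,4) rp(1)] by auto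
  then show False using L(3) W(3) W'(3) by simp
qed

lemma smooth_conic_Pr: "smooth_conic r T \<Longrightarrow> T \<subseteq> Pr r"
  unfolding smooth_conic_def by blast

lemma chart_covers:
  assumes "conic_chart r W a w u v" and T: "T = {p \<in> Pr r. p \<subseteq> W \<and> (\<forall>x\<in>p. quad_form r a x = 0)}"
    and p: "p \<in> T" "p \<noteq> lspan {w}"
  shows "p \<in> range (\<lambda>s. lspan {conic_chart.\<phi> r a w u v s})"
proof -
  interpret conic_chart r W a w u v by fact
  have pPr: "p \<in> Pr r" using p T by auto
  note rp = rep_Pr[OF pPr]
  have rep: "rep p \<in> p" using rp(2) fun_space.span_base[of "rep p" "{rep p}"] by simp
  then have "rep p \<in> W" "quad_form r a (rep p) = 0" using p T by auto
  moreover have "rep p \<notin> lspan {w}" using span_singleton_eq[of "rep p" w] rp p(2) by auto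
  ultimately obtain s where "rep p \<in> lspan {\<phi> s}" using conic_point_cases by blast
  from span_singleton_eq[OF this rp(1)] show ?thesis using rp(2) by auto
qed

text \<open>Three points of the conic span its plane, so they are not collinear.\<close>

lemma line_meets_smooth_conic_twice:
  fixes T :: "(nat \<Rightarrow> 'a::field_char_0) set set"
  assumes T: "smooth_conic r T" and L: "is_line r L" and X: "finite X" "X \<subseteq> T" "X \<subseteq> L"
  shows "card X \<le> 2"
proof (rule ccontr)
  assume "\<not> ?thesis"
  then have "3 \<le> card X" by simp
  then obtain Y where Y: "Y \<subseteq> X" "card Y = 3" by (meson obtain_subset_with_card_n)
  then obtain p q p' where pq: "p \<in> X" "q \<in> X" "p' \<in> X" "p \<noteq> q" "p \<noteq> p'" "q \<noteq> p'"
    by (auto simp: card_3_iff)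
  have ne: "T \<noteq> {}" using pq X by auto
  obtain W a w u v where chart: "conic_chart r W a w u v" "lspan {w} \<notin> X"
    and T_eq: "T = {p \<in> Pr r. p \<subseteq> W \<and> (\<forall>x\<in>p. quad_form r a x = 0)}"
    using smooth_conic_chart[OF T ne X(1)] .
  interpret conic_chart r W a w u v by (rule chart(1))
  have param: "\<exists>s. p = lspan {\<phi> s}" if "p \<in> X" for p
    using chart_covers[OF chart(1) T_eq, of p] that X(2) chart(2) by blast
  from param[OF pq(1)] obtain s where s: "p = lspan {\<phi> s}" ..
  from param[OF pq(2)] obtain t where t: "q = lspan {\<phi> t}" ..
  from param[OF pq(3)] obtain t' where t': "p' = lspan {\<phi> t'}" ..
  note s = s t t'
  obtain V where V: "fun_space.subspace V" "fun_space.dim V = 2" "L = {p \<in> Pr r. p \<subseteq> V}"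
    using is_lineE[OF L] .
  have "p \<in> L" "q \<in> L" "p' \<in> L" using pq X(3) by auto
  then have "lspan {\<phi> s} \<subseteq> V" "lspan {\<phi> t} \<subseteq> V" "lspan {\<phi> t'} \<subseteq> V" using V(3) s by auto
  then have "\<phi> s \<in> V" "\<phi> t \<in> V" "\<phi> t' \<in> V" using fun_space.span_base by blast+
  moreover have "s \<noteq> t" "s \<noteq> t'" "t \<noteq> t'" using s pq by auto
  ultimately have WV: "W \<subseteq> V" using three_points_span[OF _ _ _ V(1), of s t t'] by blast
  have dimW: "fun_space.dim W = 3" unfolding W_eq using independent by (rule dim_span_triple)
  obtain B where B: "B \<subseteq> V" "\<not> fun_space.dependent B" "V \<subseteq> lspan B" "card B = fun_space.dim V"
    by (rule fun_space.basis_exists)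
  have "finite B" using B(4) V(2) by (intro card_ge_0_finite) simp
  then have "fun_space.dim W \<le> card B" using WV B(3) by (intro fun_space.dim_le_card) auto
  then show False using dimW V(2) B(4) by simp
qed

lemma smooth_conic_determined_by_five_points:
  fixes T :: "(nat \<Rightarrow> 'a::field_char_0) set set"
  assumes T: "smooth_conic r T" and T': "smooth_conic r T'"
    and X: "finite X" "X \<subseteq> T" "X \<subseteq> T'" "5 \<le> card X"
  shows "T = T'"
proof -
  have "X \<noteq> {}" using X(4) by auto
  then have ne: "T \<noteq> {}" "T' \<noteq> {}" using X by auto
  obtain W a w u v where chart: "conic_chart r W a w u v" "lspan {w} \<notin> X"
    and T_eq: "T = {p \<in> Pr r. p \<subseteq> W \<and> (\<forall>x\<in>p. quad_form r a x = 0)}"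
    using smooth_conic_chart[OF T ne(1) X(1)] .
  interpret c: conic_chart r W a w u v by (rule chart(1))
  obtain W' a' w' u' v' where chart': "conic_chart r W' a' w' u' v'" "lspan {w'} \<notin> X"
    and T'_eq: "T' = {p \<in> Pr r. p \<subseteq> W' \<and> (\<forall>x\<in>p. quad_form r a' x = 0)}"
    using smooth_conic_chart[OF T' ne(2) X(1)] .
  interpret c': conic_chart r W' a' w' u' v' by (rule chart'(1))
  define pt where "pt s = lspan {c.\<phi> s}" for s
  have inj: "inj pt" unfolding pt_def by (rule rational_curve_inj[OF c.curve])
  have range: "X \<subseteq> range pt"
    unfolding pt_def using chart_covers[OF chart(1) T_eq] X(2) chart(2) by blast
  define U where "U = pt -` X"
  have XU: "X = pt ` U" using range by (auto simp: U_def)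
  have finU: "finite U" unfolding U_def using X(1) inj by (rule finite_vimageI)
  have cardU: "card U = card X" using XU inj by (metis card_image inj_on_subset subset_UNIV)
  have on: "c.\<phi> s \<in> W'" "quad_form r a' (c.\<phi> s) = 0" if "s \<in> U" for s
  proof -
    have "pt s \<in> T'" using that X(3) by (auto simp: U_def)
    moreover have "c.\<phi> s \<in> pt s" by (simp add: pt_def fun_space.span_base)
    ultimately show "c.\<phi> s \<in> W'" "quad_form r a' (c.\<phi> s) = 0" using T'_eq by auto
  qed
  have W'sub: "fun_space.subspace W'" unfolding c'.W_eq by (rule fun_space.subspace_span)
  have dimW': "fun_space.dim W' = 3" unfolding c'.W_eq using c'.independent by (rule dim_span_triple)
  have "3 \<le> card U" using cardU X(4) by simp
  then obtain Y where "Y \<subseteq> U" "card Y = 3" by (meson obtain_subset_with_card_n)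
  then obtain s t t' where st: "s \<in> U" "t \<in> U" "t' \<in> U" "s \<noteq> t" "s \<noteq> t'" "t \<noteq> t'"
    by (auto simp: card_3_iff)
  have WW': "W \<subseteq> W'" by (rule c.three_points_span[OF st(4-6) W'sub]) (use on st in auto)
  have "w \<in> W" "u \<in> W" "v \<in> W" unfolding c.W_eq by (auto intro: fun_space.span_base)
  then have "w \<in> W'" "u \<in> W'" "v \<in> W'" using WW' by auto
  from span_triple_eq_space[OF W'sub dimW' this c.independent] have W_eq: "W = W'"
    unfolding c.W_eq by simp
  obtain k where k: "\<And>x. x \<in> W \<Longrightarrow> quad_form r a' x = k * quad_form r a x"
    using c.conic_through_five_points[OF finU _ on(2)] cardU X(4) by auto
  have "k \<noteq> 0"
  proof
    assume "k = 0"
    then have "quad_form r a' v' = 0" using k[of v'] W_eq c'.W_eq fun_space.span_base[of v' "{w', u', v'}"] by simp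
    then show False using c'.nondegenerate by simp
  qed
  then show ?thesis
    unfolding T_eq T'_eq W_eq[symmetric] using k by (auto simp: subset_iff)
qed

section \<open>Two minimal decompositions of one point\<close>

lemma span_singleton_in_line: 
  assumes "L = {p \<in> Pr r. p \<subseteq> W}" "fun_space.subspace W" "W \<subseteq> ambient r" "x \<in> W" "x \<noteq> 0"
  shows "lspan {x} \<in> L"
  using assms span_singleton_Pr[of x r] span_subset_subspace[of W x] by auto

lemma line_spanned_by:
  assumes "fun_space.subspace W" "fun_space.dim W = 2"
  obtains b c where "W = lspan {b, c}" "b \<noteq> 0" "c \<notin> lspan {b}"
proof -
  have "card {} < fun_space.dim W" using assms by simp
  then have "\<not> W \<subseteq> lspan {}" by (intro not_subset_span_small) auto
  then obtain b where b: "b \<in> W" "b \<noteq> 0" by auto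
  obtain c where "c \<in> W" "c \<notin> lspan {b}" "W = lspan {b, c}" by (rule line_complement_vector[OF assms b])
  then show thesis using that b(2) by blast
qed

lemma skew_not_in_span:
  assumes W2: "fun_space.subspace W2" and skew: "lspan {b, c} \<inter> W2 \<subseteq> {0}"
    and y: "y \<in> W2" "y' \<in> W2" "y' \<notin> lspan {y}"
  shows "y' \<notin> lspan {y, b, c}"
proof
  assume "y' \<in> lspan {y, b, c}"
  then obtain k where k: "y' - fun_scale k y \<in> lspan {b, c}" by (subst (asm) fun_space.span_insert) blast
  moreover have "y' - fun_scale k y \<in> W2"
    using W2 y(1,2) by (intro fun_space.subspace_diff fun_space.subspace_scale)
  ultimately have "y' - fun_scale k y = 0" using skew by blast
  then have "y' = fun_scale k y" by simp
  then show False using y(3) unfolding fun_space.span_singleton by blast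
qed

lemma disjoint_lines_skew:
  assumes "L1 = {p \<in> Pr r. p \<subseteq> W1}" "fun_space.subspace W1" "W1 \<subseteq> ambient r"
    and "L2 = {p \<in> Pr r. p \<subseteq> W2}" "fun_space.subspace W2" "W2 \<subseteq> ambient r"
    and "L1 \<inter> L2 = {}"
  shows "W1 \<inter> W2 \<subseteq> {0}"
proof
  fix x assume x: "x \<in> W1 \<inter> W2"
  show "x \<in> {0}"
  proof (rule ccontr)
    assume "x \<notin> {0}"
    then have "lspan {x} \<in> L1" "lspan {x} \<in> L2"
      using x span_singleton_in_line[OF assms(1-3)] span_singleton_in_line[OF assms(4-6)] by auto
    then show False using assms(7) by blast
  qed
qed

text \<open>A hyperplane through \<open>L1\<close> and one point of \<open>Z\<close> on \<open>L2\<close> contains no further point of \<open>L2\<close>, so the residual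
relation lives on all but one of the points of \<open>Z\<close> on \<open>L2\<close>.\<close>

lemma skew_lines_card:
  assumes L: "is_line r L1" "is_line r L2" "L1 \<inter> L2 = {}"
    and Z: "finite Z" "Z \<subseteq> Pr r" "Z \<subseteq> L1 \<union> L2" "\<not> Z \<subseteq> L1" and sup: "supports r (Suc n) (rep ` Z)"
  shows "n + 3 \<le> card (Z \<inter> L2)"
proof -
  obtain W1 where W1: "fun_space.subspace W1" "W1 \<subseteq> ambient r" "fun_space.dim W1 = 2" "L1 = {p \<in> Pr r. p \<subseteq> W1}"
    using is_lineE[OF L(1)] .
  obtain W2 where W2: "fun_space.subspace W2" "W2 \<subseteq> ambient r" "fun_space.dim W2 = 2" "L2 = {p \<in> Pr r. p \<subseteq> W2}"
    using is_lineE[OF L(2)] .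
  have skew: "W1 \<inter> W2 \<subseteq> {0}" by (rule disjoint_lines_skew[OF W1(4,1,2) W2(4,1,2) L(3)])
  obtain b c where bc: "W1 = lspan {b, c}" "b \<noteq> 0" "c \<notin> lspan {b}" by (rule line_spanned_by[OF W1(1,3)])
  have bcW: "b \<in> W1" "c \<in> W1" unfolding bc(1) by (auto intro: fun_space.span_base)
  obtain p where p: "p \<in> Z" "p \<in> L2" using Z(3,4) by blast
  have pPr: "p \<in> Pr r" using p Z by auto
  note rp = rep_Pr[OF pPr]
  have y: "rep p \<in> W2" using p(2) W2(4) point_subset_iff[OF W2(1) pPr] by auto
  have amb: "{rep p, b, c} \<subseteq> ambient r" "{b, c} \<subseteq> ambient r" using rp bcW W1(2) by auto
  have off1: "f (rep q) = 0" if "\<And>z. z \<in> lspan {b, c} \<Longrightarrow> f z = 0" "q \<in> L1" for f q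
  proof -
    have "q \<in> Pr r" "q \<subseteq> W1" using that(2) W1(4) by auto
    then have "rep q \<in> W1" using point_subset_iff[OF W1(1)] by blast
    then show ?thesis using that(1) bc(1) by simp
  qed
  have "\<exists>p'. p' \<in> Z \<inter> L2 \<and> p' \<noteq> p"
  proof (rule ccontr)
    assume only: "\<not> ?thesis"
    have "rep p \<notin> lspan {b, c}" using skew y rp(1) bc(1) by auto
    then obtain f where f: "hform r (Suc 0) f" "\<And>z. z \<in> lspan {b, c} \<Longrightarrow> f z = 0" "f (rep p) = 1"
      using separating_linear_form[OF rp(3) amb(2)] by blast
    have "{q \<in> Z. f (rep q) \<noteq> 0} \<subseteq> {p}"
    proof
      fix q assume q: "q \<in> {q \<in> Z. f (rep q) \<noteq> 0}"
      then have "q \<notin> L1" using off1[of f q, OF f(2)] by blast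
      then show "q \<in> {p}" using q Z(3) only by blast
    qed
    then have "card {q \<in> Z. f (rep q) \<noteq> 0} \<le> card {p}" by (intro card_mono) auto
    moreover have "f (rep p) \<noteq> 0" using f(3) by simp
    ultimately show False using supporting_points_residual[OF Z(1,2) sup f(1) p(1)] by simp
  qed
  then obtain p' where p': "p' \<in> Z" "p' \<in> L2" "p' \<noteq> p" by blast
  have p'Pr: "p' \<in> Pr r" using p' Z by auto
  note rp' = rep_Pr[OF p'Pr]
  have y': "rep p' \<in> W2" using p'(2) W2(4) point_subset_iff[OF W2(1) p'Pr] by auto
  have "rep p' \<notin> lspan {rep p}" using span_singleton_eq[of "rep p'" "rep p"] rp rp' p'(3) by auto
  then have "rep p' \<notin> lspan {rep p, b, c}"
    using skew bc(1) by (intro skew_not_in_span[OF W2(1) _ y y']) auto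
  then obtain f where f: "hform r (Suc 0) f" "\<And>z. z \<in> lspan {rep p, b, c} \<Longrightarrow> f z = 0" "f (rep p') = 1"
    using separating_linear_form[OF rp'(3) amb(1)] by blast
  have f': "f z = 0" if "z \<in> lspan {b, c}" for z
    using f(2) that fun_space.span_mono[of "{b, c}" "{rep p, b, c}"] by auto
  have "{q \<in> Z. f (rep q) \<noteq> 0} \<subseteq> Z \<inter> L2 - {p}"
  proof
    fix q assume q: "q \<in> {q \<in> Z. f (rep q) \<noteq> 0}"
    then have "q \<notin> L1" using off1[of f q, OF f'] by blast
    moreover have "q \<noteq> p" using q f(2)[of "rep p"] by (auto intro: fun_space.span_base)
    ultimately show "q \<in> Z \<inter> L2 - {p}" using q Z(3) by blast
  qed
  then have "card {q \<in> Z. f (rep q) \<noteq> 0} \<le> card (Z \<inter> L2 - {p})" using Z(1) by (intro card_mono) auto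
  also have "\<dots> = card (Z \<inter> L2) - 1" using p by simp
  also have "f (rep p') \<noteq> 0" using f(3) by simp
  ultimately show ?thesis using supporting_points_residual[OF Z(1,2) sup f(1) p'(1)] by simp
qed

lemma meeting_lines_coplanar:
  assumes L: "is_line r L1" "is_line r L2" "L1 \<noteq> L2" "L1 \<inter> L2 \<noteq> {}"
  shows "\<exists>M. is_plane r M \<and> L1 \<union> L2 \<subseteq> M"
proof -
  obtain W1 where W1: "fun_space.subspace W1" "W1 \<subseteq> ambient r" "fun_space.dim W1 = 2" "L1 = {p \<in> Pr r. p \<subseteq> W1}"
    using is_lineE[OF L(1)] .
  obtain W2 where W2: "fun_space.subspace W2" "W2 \<subseteq> ambient r" "fun_space.dim W2 = 2" "L2 = {p \<in> Pr r. p \<subseteq> W2}"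
    using is_lineE[OF L(2)] .
  obtain p where p: "p \<in> L1" "p \<in> L2" using L(4) by blast
  have pPr: "p \<in> Pr r" using p W1(4) by auto
  note rp = rep_Pr[OF pPr]
  define w where "w = rep p"
  have w: "w \<in> W1" "w \<in> W2" "w \<noteq> 0"
    using p W1(4) W2(4) point_subset_iff[OF W1(1) pPr] point_subset_iff[OF W2(1) pPr] rp by (auto simp: w_def)
  obtain b where b: "b \<in> W1" "b \<notin> lspan {w}" "W1 = lspan {w, b}" by (rule line_complement_vector[OF W1(1,3) w(1,3)])
  obtain c where c: "c \<in> W2" "c \<notin> lspan {w}" "W2 = lspan {w, c}" by (rule line_complement_vector[OF W2(1,3) w(2,3)])
  have "c \<notin> lspan {w, b}"
  proof
    assume "c \<in> lspan {w, b}"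
    then have "c \<in> W1" using b by simp
    from span_pair_eq_plane[OF W1(1,3) w(1) this w(3) c(2)] show False using c(3) W1(4) W2(4) L(3) by simp
  qed
  then have dim: "fun_space.dim (lspan {w, b, c}) = 3" by (rule dim_span_triple[OF w(3) b(2)])
  have "W1 \<subseteq> lspan {w, b, c}" "W2 \<subseteq> lspan {w, b, c}"
    unfolding b(3) c(3) by (intro fun_space.span_mono; blast)+
  then have "L1 \<union> L2 \<subseteq> {p \<in> Pr r. p \<subseteq> lspan {w, b, c}}" unfolding W1(4) W2(4) by blast
  moreover have "lspan {w, b, c} \<subseteq> ambient r"
    using w b c W1(2) W2(2) by (intro span_subset_coord_space) auto
  then have "is_plane r {p \<in> Pr r. p \<subseteq> lspan {w, b, c}}"
    unfolding proj_subspace_def using dim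
    by (intro exI[of _ "lspan {w, b, c}"]) (simp add: fun_space.subspace_span)
  ultimately show ?thesis by blast
qed

lemma coplanar_lines_meet:
  fixes L1 :: "(nat \<Rightarrow> 'a::field) set set"
  assumes L: "is_line r L1" "is_line r L2" and M: "is_plane r M" "L1 \<union> L2 \<subseteq> M"
  shows "L1 \<inter> L2 \<noteq> {}"
proof
  assume disj: "L1 \<inter> L2 = {}"
  obtain W1 where W1: "fun_space.subspace W1" "W1 \<subseteq> ambient r" "fun_space.dim W1 = 2" "L1 = {p \<in> Pr r. p \<subseteq> W1}"
    using is_lineE[OF L(1)] .
  obtain W2 where W2: "fun_space.subspace W2" "W2 \<subseteq> ambient r" "fun_space.dim W2 = 2" "L2 = {p \<in> Pr r. p \<subseteq> W2}"
    using is_lineE[OF L(2)] .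
  obtain V where V: "fun_space.subspace V" "fun_space.dim V = 3" "M = {p \<in> Pr r. p \<subseteq> V}"
  proof -
    from M(1) obtain V where "fun_space.subspace V" "fun_space.dim V = 2 + 1" "M = {p \<in> Pr r. p \<subseteq> V}"
      unfolding proj_subspace_def by (elim exE conjE)
    then show thesis by (intro that[of V]) simp_all
  qed
  have skew: "W1 \<inter> W2 \<subseteq> {0}" by (rule disjoint_lines_skew[OF W1(4,1,2) W2(4,1,2) disj])
  obtain b c where bc: "W1 = lspan {b, c}" "b \<noteq> 0" "c \<notin> lspan {b}" by (rule line_spanned_by[OF W1(1,3)])
  obtain y z where yz: "W2 = lspan {y, z}" "y \<noteq> 0" "z \<notin> lspan {y}" by (rule line_spanned_by[OF W2(1,3)])
  have in_V: "x \<in> V" if x: "x \<in> W1 \<union> W2" for x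
  proof (cases "x = 0")
    case True
    then show ?thesis using V(1) by (simp add: fun_space.subspace_0)
  next
    case False
    then have "lspan {x} \<in> M"
      using x M(2) span_singleton_in_line[OF W1(4,1,2)] span_singleton_in_line[OF W2(4,1,2)] by blast
    then show ?thesis using V(3) fun_space.span_base[of x "{x}"] by auto
  qed
  have mem: "b \<in> W1" "c \<in> W1" "y \<in> W2" "z \<in> W2"
    unfolding bc(1) yz(1) by (auto intro: fun_space.span_base)
  have y: "y \<notin> lspan {b, c}" using skew mem(3) yz(2) bc(1) by auto
  have z: "z \<notin> lspan {y, b, c}"
    using skew bc(1) by (intro skew_not_in_span[OF W2(1) _ mem(3,4) yz(3)]) auto
  have ind: "\<not> fun_space.dependent {b, c}" "card {b, c} = 2" using independent_pair[OF bc(2,3)] by auto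
  have ind3: "\<not> fun_space.dependent {y, b, c}" using fun_space.independent_insertI[OF y ind(1)] .
  have ind4: "\<not> fun_space.dependent {z, y, b, c}" using fun_space.independent_insertI[OF z ind3] .
  have "y \<notin> {b, c}" by (rule contra_subsetD[OF fun_space.span_superset y])
  moreover have "z \<notin> {y, b, c}" by (rule contra_subsetD[OF fun_space.span_superset z])
  ultimately have card: "card {z, y, b, c} = 4" using ind(2) by simp
  obtain B where B: "B \<subseteq> V" "\<not> fun_space.dependent B" "V \<subseteq> lspan B" "card B = fun_space.dim V"
    by (rule fun_space.basis_exists)
  have finB: "finite B" using B(4) V(2) by (intro card_ge_0_finite) simp
  have "{z, y, b, c} \<subseteq> lspan B" using mem in_V B(3) by blast
  from fun_space.independent_span_bound[OF finB ind4 this] show False using card B(4) V(2) by simp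
qed

text \<open>A line with enough points of \<open>A\<close> for the part of \<open>A\<close> on it to have infinitely many decompositions.\<close>

definition has_rich_line :: "nat \<Rightarrow> nat \<Rightarrow> (nat \<Rightarrow> 'a::field) set set \<Rightarrow> bool" where
  "has_rich_line r d A \<longleftrightarrow> (\<exists>D. is_line r D \<and> d + 2 \<le> 2 * card (A \<inter> D))"

text \<open>The difference of two distinct minimal decompositions of \<open>x\<close> is a relation whose support \<open>Z\<close> has fewer
than \<open>3 d\<close> points and contains the symmetric difference of \<open>A\<close> and \<open>B\<close>. So outside any set that
contains \<open>Z\<close> the two decompositions agree, and inside it they have the same number of points.\<close>

locale two_decompositions =
  A: minimal_decomposition r d A x a + B: minimal_decomposition r d B x b
  for r d and A :: "(nat \<Rightarrow> 'a::{alg_closed_field, field_char_0}) set set" and x a B b +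
  assumes distinct: "A \<noteq> B" and small: "2 * card A < 3 * d"
begin

definition Z :: "(nat \<Rightarrow> 'a) set set" where
  "Z = {p \<in> A \<union> B. (if p \<in> A then a p else 0) \<noteq> (if p \<in> B then b p else 0)}"

lemma card_eq: "card A = card B"
  using A.computing B.computing by (simp add: computing_sets_def)

lemma finite_Z: "finite Z" and Z_Pr: "Z \<subseteq> Pr r"
  using A.finite_A B.finite_A A.A_Pr B.A_Pr by (auto simp: Z_def)

lemma diff_subset_Z: "A - B \<subseteq> Z" "B - A \<subseteq> Z"
  using A.coeff_nonzero B.coeff_nonzero by (auto simp: Z_def)

lemma Z_nonempty: "Z \<noteq> {}"
  using diff_subset_Z distinct by blast

lemma coeff_eq_off_Z: "p \<in> A \<Longrightarrow> p \<in> B \<Longrightarrow> p \<notin> Z \<Longrightarrow> a p = b p"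
  by (auto simp: Z_def)

lemma d_pos: "0 < d" using small by simp

lemma card_Z: "card Z < 3 * d"
proof -
  have "card Z \<le> card (A \<union> B)"
    using A.finite_A B.finite_A by (intro card_mono) (auto simp: Z_def)
  also have "\<dots> \<le> card A + card B" by (rule card_Un_le)
  finally show ?thesis using small card_eq by simp
qed

lemma Z_supports: "supports r d (rep ` Z)"
proof -
  let ?c = "\<lambda>p. (if p \<in> A then a p else 0) - (if p \<in> B then b p else 0)"
  have fin: "finite (A \<union> B)" using A.finite_A B.finite_A by simp
  have "(\<Sum>p\<in>A \<union> B. fun_scale (?c p) (vero r d p)) =
      (\<Sum>p\<in>A. fun_scale (a p) (vero r d p)) - (\<Sum>p\<in>B. fun_scale (b p) (vero r d p))"
    unfolding zero_sum_extend[OF fin Un_upper1, of a] zero_sum_extend[OF fin Un_upper2, of b]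
    by (simp add: fun_space.scale_left_diff_distrib sum_subtractf)
  also have "\<dots> = 0" unfolding A.sum_eq[symmetric] B.sum_eq[symmetric] by simp
  finally have rel: "\<And>G. hform r d G \<Longrightarrow> (\<Sum>p\<in>A \<union> B. ?c p * G (rep p)) = 0"
    unfolding veronese_relation_iff by blast
  have inj: "inj_on rep Z" using inj_on_rep Z_Pr by (rule inj_on_subset)
  have "(\<Sum>z\<in>rep ` Z. ?c (lspan {z}) * G z) = 0" if G: "hform r d G" for G
  proof -
    have "(\<Sum>z\<in>rep ` Z. ?c (lspan {z}) * G z) = (\<Sum>p\<in>Z. ?c (lspan {rep p}) * G (rep p))"
      by (subst sum.reindex[OF inj]) simp
    also have "\<dots> = (\<Sum>p\<in>Z. ?c p * G (rep p))"
    proof (intro sum.cong refl)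
      fix p assume "p \<in> Z"
      then have "p \<in> Pr r" using Z_Pr by auto
      from rep_Pr(2)[OF this] show "?c (lspan {rep p}) * G (rep p) = ?c p * G (rep p)" by simp
    qed
    also have "\<dots> = (\<Sum>p\<in>A \<union> B. ?c p * G (rep p))"
      using fin by (intro sum.mono_neutral_left) (auto simp: Z_def)
    finally show ?thesis using rel[OF G] by simp
  qed
  moreover have "?c (lspan {z}) \<noteq> 0" if z: "z \<in> rep ` Z" for z
  proof -
    obtain p where p: "p \<in> Z" "z = rep p" using z by blast
    have "p \<in> Pr r" using p Z_Pr by auto
    then have "lspan {z} = p" using p rep_Pr(2) by simp
    then show ?thesis using p(1) unfolding Z_def by auto
  qed
  ultimately show ?thesis unfolding supports_def by (intro exI[of _ "\<lambda>z. ?c (lspan {z})"]) blast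
qed

lemma off_eq: "Z \<subseteq> S \<Longrightarrow> A - S = B - S"
  using diff_subset_Z by blast

lemma card_inter_eq:
  assumes "Z \<subseteq> S"
  shows "card (A \<inter> S) = card (B \<inter> S)" "card Z \<le> 2 * card (A \<inter> S)"
proof -
  have "card A = card (A \<inter> S) + card (A - S)" "card B = card (B \<inter> S) + card (B - S)"
    using A.finite_A B.finite_A by (auto intro: card_Int_Diff)
  then show eq: "card (A \<inter> S) = card (B \<inter> S)" using off_eq[OF assms] card_eq by simp
  have "Z \<subseteq> A \<union> B" by (auto simp: Z_def)
  then have "card Z \<le> card ((A \<inter> S) \<union> (B \<inter> S))"
    using assms A.finite_A B.finite_A by (intro card_mono) blast+
  also have "\<dots> \<le> card (A \<inter> S) + card (B \<inter> S)" by (rule card_Un_le)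
  finally show "card Z \<le> 2 * card (A \<inter> S)" using eq by simp
qed

lemma collinear_rich:
  assumes "is_line r L" "Z \<subseteq> L"
  shows "has_rich_line r d A" "has_rich_line r d B"
proof -
  have "d + 2 \<le> card Z" by (rule supporting_points_card[OF finite_Z Z_Pr Z_nonempty Z_supports])
  then show "has_rich_line r d A" "has_rich_line r d B"
    using card_inter_eq[OF assms(2)] assms(1) unfolding has_rich_line_def by (intro exI[of _ L]; simp)+
qed

lemma not_collinear_card:
  assumes "\<not> has_rich_line r d A \<or> \<not> has_rich_line r d B"
  shows "2 * d + 2 \<le> card Z"
  using collinear_rich assms
  by (intro supporting_points_not_collinear[OF finite_Z Z_Pr Z_nonempty Z_supports]) blast

lemma residual_line:
  assumes L: "is_line r L" and off: "\<not> Z \<subseteq> L"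
  shows "d + 1 \<le> card (Z - L)"
proof -
  obtain W where W: "fun_space.subspace W" "W \<subseteq> ambient r" "fun_space.dim W = 2" "L = {p \<in> Pr r. p \<subseteq> W}"
    using is_lineE[OF L] .
  obtain p where p: "p \<in> Z" "p \<notin> L" using off by blast
  have pPr: "p \<in> Pr r" using p Z_Pr by auto
  have span: "lspan W = W" using W(1) by (simp add: fun_space.span_eq_iff)
  have "rep p \<notin> lspan W" using p pPr point_subset_iff[OF W(1) pPr] W(4) unfolding span by simp
  from separating_linear_form[OF rep_Pr(3)[OF pPr] W(2) this]
  obtain f where f: "hform r (Suc 0) f" "\<And>y. y \<in> W \<Longrightarrow> f y = 0" "f (rep p) = 1"
    unfolding span by blast
  have "f (rep p) \<noteq> 0" using f(3) by simp
  moreover have "supports r (Suc (d - 1)) (rep ` Z)" using Z_supports d_pos by simp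
  ultimately have "d - 1 + 2 \<le> card {p \<in> Z. f (rep p) \<noteq> 0}"
    using supporting_points_residual[OF finite_Z Z_Pr _ f(1) p(1)] by blast
  also have "\<dots> \<le> card (Z - L)"
  proof (intro card_mono subsetI)
    fix q assume q: "q \<in> {p \<in> Z. f (rep p) \<noteq> 0}"
    then have qPr: "q \<in> Pr r" using Z_Pr by auto
    have "rep q \<notin> W" using q f(2) by auto
    then show "q \<in> Z - L" using q W(4) point_subset_iff[OF W(1) qPr] by auto
  qed (use finite_Z in simp)
  finally show ?thesis using d_pos by simp
qed

text \<open>Without a line rich in \<open>B\<close>, the support \<open>Z\<close> is not collinear and has at least \<open>2 d + 2\<close> points. Half of
them must be matched by points of \<open>B\<close> on the two lines, neither of which carries more than
\<open>(d + 1) / 2\<close> of them; all inequalities are equalities. If the lines were skew, \<open>Z\<close> would have two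
points more.\<close>

lemma two_lines_pattern:
  assumes L: "is_line r L1" "is_line r L2" and Z: "Z \<subseteq> L1 \<union> L2" and poor: "\<not> has_rich_line r d B"
  shows "2 * card (B \<inter> L1) = d + 1" "2 * card (B \<inter> L2) = d + 1" "card (B \<inter> (L1 \<union> L2)) = d + 1"
    "L1 \<inter> L2 \<inter> B = {}" "L1 \<noteq> L2" "L1 \<inter> L2 \<noteq> {}"
proof -
  have finB: "finite B" by (rule B.finite_A)
  have le: "2 * card (B \<inter> L1) \<le> d + 1" "2 * card (B \<inter> L2) \<le> d + 1"
  proof -
    have "\<not> d + 2 \<le> 2 * card (B \<inter> L1)" "\<not> d + 2 \<le> 2 * card (B \<inter> L2)"
      using poor L unfolding has_rich_line_def by blast+
    then show "2 * card (B \<inter> L1) \<le> d + 1" "2 * card (B \<inter> L2) \<le> d + 1" by simp_all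
  qed
  have ge: "2 * d + 2 \<le> 2 * card (B \<inter> (L1 \<union> L2))"
    using not_collinear_card poor card_inter_eq[OF Z] by simp
  have "card ((B \<inter> L1) \<union> (B \<inter> L2)) + card ((B \<inter> L1) \<inter> (B \<inter> L2)) = card (B \<inter> L1) + card (B \<inter> L2)"
    using finB by (intro card_Un_Int[symmetric]) auto
  moreover have "(B \<inter> L1) \<union> (B \<inter> L2) = B \<inter> (L1 \<union> L2)" by blast
  ultimately have sum: "card (B \<inter> (L1 \<union> L2)) + card ((B \<inter> L1) \<inter> (B \<inter> L2)) = card (B \<inter> L1) + card (B \<inter> L2)"
    by simp
  show eq: "2 * card (B \<inter> L1) = d + 1" "2 * card (B \<inter> L2) = d + 1" "card (B \<inter> (L1 \<union> L2)) = d + 1"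
    using le ge sum by linarith+
  have "card ((B \<inter> L1) \<inter> (B \<inter> L2)) = 0" using eq sum by linarith
  then have "(B \<inter> L1) \<inter> (B \<inter> L2) = {}" using finB by simp
  then show "L1 \<inter> L2 \<inter> B = {}" by blast
  show ne: "L1 \<noteq> L2"
  proof
    assume "L1 = L2"
    then have "Z \<subseteq> L1" using Z by simp
    then show False using collinear_rich(2)[OF L(1)] poor by blast
  qed
  show "L1 \<inter> L2 \<noteq> {}"
  proof
    assume disj: "L1 \<inter> L2 = {}"
    have off: "\<not> Z \<subseteq> L1" "\<not> Z \<subseteq> L2" using collinear_rich(2) L poor by blast+
    have sup: "supports r (Suc (d - 1)) (rep ` Z)" using Z_supports d_pos by simp
    have far2: "d - 1 + 3 \<le> card (Z \<inter> L2)"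
      by (rule skew_lines_card[OF L disj finite_Z Z_Pr Z off(1) sup])
    have far1: "d - 1 + 3 \<le> card (Z \<inter> L1)"
      using disj Z by (intro skew_lines_card[OF L(2,1) _ finite_Z Z_Pr _ off(2) sup]) blast+
    have "card (Z \<inter> L1) + card (Z \<inter> L2) \<le> card Z"
    proof -
      have "card (Z \<inter> L1) + card (Z \<inter> L2) = card ((Z \<inter> L1) \<union> (Z \<inter> L2))"
        using finite_Z disj by (intro card_Un_disjoint[symmetric]) auto
      also have "\<dots> \<le> card Z" using finite_Z by (intro card_mono) auto
      finally show ?thesis .
    qed
    moreover have "card Z \<le> 2 * (d + 1)" using card_inter_eq[OF Z] eq(3) by simp
    moreover have "d + 2 \<le> card (Z \<inter> L1)" "d + 2 \<le> card (Z \<inter> L2)" using far1 far2 d_pos by simp_all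
    ultimately show False by simp
  qed
qed

text \<open>The residual of \<open>Z\<close> off \<open>L2\<close> has at least \<open>d + 1\<close> points, all on \<open>L1\<close>. A rich line \<open>L2\<close> would leave too few
points of \<open>A\<close> on \<open>L1\<close> for that.\<close>

lemma few_on_second_line:
  assumes L: "is_line r L1" "is_line r L2" and Z: "Z \<subseteq> L1 \<union> L2" and poor: "\<not> has_rich_line r d B"
  shows "2 * card (A \<inter> L2) < d + 2"
proof (rule ccontr)
  assume rich: "\<not> ?thesis"
  note pattern = two_lines_pattern[OF L Z poor]
  have "\<not> Z \<subseteq> L2" using collinear_rich(2)[OF L(2)] poor by blast
  then have "d + 1 \<le> card (Z - L2)" by (rule residual_line[OF L(2)])
  also have "\<dots> \<le> card ((A \<inter> (L1 \<union> L2) - A \<inter> L2) \<union> (B \<inter> L1))"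
  proof (rule card_mono)
    have "Z \<subseteq> A \<union> B" by (auto simp: Z_def)
    then show "Z - L2 \<subseteq> (A \<inter> (L1 \<union> L2) - A \<inter> L2) \<union> (B \<inter> L1)" using Z by blast
  qed (use A.finite_A B.finite_A in simp)
  also have "\<dots> \<le> card (A \<inter> (L1 \<union> L2) - A \<inter> L2) + card (B \<inter> L1)" by (rule card_Un_le)
  also have "card (A \<inter> (L1 \<union> L2) - A \<inter> L2) = card (A \<inter> (L1 \<union> L2)) - card (A \<inter> L2)"
    using A.finite_A by (intro card_Diff_subset) auto
  also have "card (A \<inter> (L1 \<union> L2)) = d + 1" using card_inter_eq(1)[OF Z] pattern(3) by simp
  finally show False using pattern(1) rich by linarith
qed

text \<open>A line different from \<open>L1\<close> and \<open>L2\<close> meets each of them once, and too few points of \<open>A\<close> lie off the two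
lines to make it rich.\<close>

lemma two_lines_poor:
  assumes L: "is_line r L1" "is_line r L2" and Z: "Z \<subseteq> L1 \<union> L2" and poor: "\<not> has_rich_line r d B"
  shows "\<not> has_rich_line r d A"
proof
  assume "has_rich_line r d A"
  then obtain D where D: "is_line r D" "d + 2 \<le> 2 * card (A \<inter> D)" unfolding has_rich_line_def by blast
  note pattern = two_lines_pattern[OF L Z poor]
  have "D \<noteq> L2" using few_on_second_line[OF L Z poor] D(2) by auto
  moreover have "Z \<subseteq> L2 \<union> L1" using Z by blast
  then have "D \<noteq> L1" using few_on_second_line[OF L(2,1) _ poor] D(2) by auto
  ultimately have meet: "card (A \<inter> D \<inter> L1) \<le> 1" "card (A \<inter> D \<inter> L2) \<le> 1"
    using A.finite_A by (intro lines_meet_once[OF D(1) L(1)] lines_meet_once[OF D(1) L(2)]; blast)+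
  have "card (A \<inter> D) \<le> card ((A - (L1 \<union> L2)) \<union> ((A \<inter> D \<inter> L1) \<union> (A \<inter> D \<inter> L2)))"
    using A.finite_A by (intro card_mono) auto
  also have "\<dots> \<le> card (A - (L1 \<union> L2)) + card ((A \<inter> D \<inter> L1) \<union> (A \<inter> D \<inter> L2))" by (rule card_Un_le)
  also have "\<dots> \<le> card (A - (L1 \<union> L2)) + (card (A \<inter> D \<inter> L1) + card (A \<inter> D \<inter> L2))"
    by (intro add_left_mono card_Un_le)
  also have "\<dots> \<le> card (A - (L1 \<union> L2)) + 2" using meet by simp
  finally have *: "card (A \<inter> D) \<le> card (A - (L1 \<union> L2)) + 2" .
  have "card A = card (A \<inter> (L1 \<union> L2)) + card (A - (L1 \<union> L2))"
    using A.finite_A by (rule card_Int_Diff)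
  moreover have "card (A \<inter> (L1 \<union> L2)) = d + 1" using card_inter_eq(1)[OF Z] pattern(3) by simp
  ultimately show False using * D(2) pattern(1) small by presburger
qed

text \<open>A line meets the conic at most twice, and \<open>A\<close> has at most \<open>(d - 3) / 2\<close> points off the conic.\<close>

lemma smooth_conic_pattern:
  assumes T: "smooth_conic r T" and Z: "Z \<subseteq> T"
  shows "d + 1 \<le> card (A \<inter> T)" "\<not> has_rich_line r d A"
proof -
  have "\<not> Z \<subseteq> L" if "is_line r L" for L
  proof
    assume "Z \<subseteq> L"
    then have "card Z \<le> 2" by (rule line_meets_smooth_conic_twice[OF T that finite_Z Z])
    then show False using supporting_points_card[OF finite_Z Z_Pr Z_nonempty Z_supports] d_pos by simp
  qed
  then have "2 * d + 2 \<le> card Z"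
    by (rule supporting_points_not_collinear[OF finite_Z Z_Pr Z_nonempty Z_supports])
  then show many: "d + 1 \<le> card (A \<inter> T)" using card_inter_eq(2)[OF Z] by simp
  show "\<not> has_rich_line r d A"
  proof
    assume "has_rich_line r d A"
    then obtain D where D: "is_line r D" "d + 2 \<le> 2 * card (A \<inter> D)" unfolding has_rich_line_def by blast
    have "card (A \<inter> D) \<le> card ((A - T) \<union> (A \<inter> D \<inter> T))"
      using A.finite_A by (intro card_mono) auto
    also have "\<dots> \<le> card (A - T) + card (A \<inter> D \<inter> T)" by (rule card_Un_le)
    also have "card (A \<inter> D \<inter> T) \<le> 2"
      using A.finite_A by (intro line_meets_smooth_conic_twice[OF T D(1)]) auto
    finally have "card (A \<inter> D) \<le> card (A - T) + 2" by simp
    moreover have "card A = card (A \<inter> T) + card (A - T)" using A.finite_A by (rule card_Int_Diff)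
    ultimately show False using D(2) many small by linarith
  qed
qed

lemma geometry: "(\<exists>L1 L2. is_line r L1 \<and> is_line r L2 \<and> Z \<subseteq> L1 \<union> L2) \<or> (\<exists>T. smooth_conic r T \<and> Z \<subseteq> T)"
  by (rule relation_on_lines_or_smooth_conic[OF finite_Z Z_Pr Z_nonempty Z_supports card_Z])

text \<open>Hence the existence of a rich line is a property of the decomposed point and not of the
decomposition.\<close>

lemma poor_transfer:
  assumes "\<not> has_rich_line r d B"
  shows "\<not> has_rich_line r d A"
  using geometry two_lines_poor assms smooth_conic_pattern(2) by blast

end

section \<open>Uniqueness of minimal decompositions\<close>

lemma minimal_decomposition_exists:
  assumes "A \<in> computing_sets r d (lspan {x})" "x \<noteq> 0"
  shows "\<exists>a. minimal_decomposition r d A x a"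
proof -
  note A = computing_setsD[OF assms(1)]
  obtain a where "x = (\<Sum>p\<in>A. fun_scale (a p) (vero r d p))"
    using in_proj_span_iff[OF A(1,2) assms(2), of d] A(3) by blast
  then have "minimal_decomposition r d A x a" using assms by unfold_locales
  then show ?thesis by blast
qed

lemma ceiling_half_le_iff: "\<lceil>(real d + 2) / 2\<rceil> \<le> int n \<longleftrightarrow> d + 2 \<le> 2 * n"
proof -
  have "\<lceil>(real d + 2) / 2\<rceil> \<le> int n \<longleftrightarrow> (real d + 2) / 2 \<le> real n" by (simp add: ceiling_le_iff)
  also have "\<dots> \<longleftrightarrow> real (d + 2) \<le> real (2 * n)" by (simp add: field_simps)
  finally show ?thesis by (simp only: of_nat_le_iff)
qed

lemma infinitely_many_on_rich_line:
  fixes B :: "(nat \<Rightarrow> 'a::{alg_closed_field, field_char_0}) set set"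
  assumes B: "B \<in> computing_sets r d (lspan {x})" "x \<noteq> 0" and D: "is_line r D" "B \<subseteq> D" "d + 2 \<le> 2 * card B"
  shows "infinite (computing_sets r d (lspan {x}))"
proof -
  obtain \<phi> where \<phi>: "rational_curve r 1 \<phi>" "D \<inter> B \<subseteq> range (\<lambda>s. lspan {\<phi> s})"
    using line_curve_avoiding[OF D(1) computing_setsD(1)[OF B(1)]] .
  have "B \<subseteq> range (\<lambda>s. lspan {\<phi> s})" using \<phi>(2) D(2) by blast
  then show ?thesis using D(3) by (intro infinitely_many_on_curve[OF \<phi>(1) B]) simp_all
qed

lemma infinitely_many_on_smooth_conic:
  fixes B :: "(nat \<Rightarrow> 'a::{alg_closed_field, field_char_0}) set set"
  assumes B: "B \<in> computing_sets r d (lspan {x})" "x \<noteq> 0" and T: "smooth_conic r T" "B \<subseteq> T" "d + 1 \<le> card B"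
  shows "infinite (computing_sets r d (lspan {x}))"
proof -
  have "B \<noteq> {}" using T(3) by auto
  then have "T \<noteq> {}" using T(2) by blast
  from smooth_conic_chart[OF T(1) this computing_setsD(1)[OF B(1)]]
  obtain W a w u v where chart: "conic_chart r W a w u v" "lspan {w} \<notin> B"
    and T_eq: "T = {p \<in> Pr r. p \<subseteq> W \<and> (\<forall>x\<in>p. quad_form r a x = 0)}" .
  interpret conic_chart r W a w u v by (rule chart(1))
  have "B \<subseteq> range (\<lambda>s. lspan {\<phi> s})"
  proof
    fix p assume p: "p \<in> B"
    then have "p \<in> T" "p \<noteq> lspan {w}" using T(2) chart(2) by auto
    then show "p \<in> range (\<lambda>s. lspan {\<phi> s})" by (rule chart_covers[OF chart(1) T_eq])
  qed
  then show ?thesis using T(3) by (intro infinitely_many_on_curve[OF curve B]) simp_all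
qed

text \<open>The common point of the two lines serves as the point at infinity of both.\<close>

lemma infinitely_many_on_reducible_conic:
  fixes A :: "(nat \<Rightarrow> 'a::{alg_closed_field, field_char_0}) set set"
  assumes min: "minimal_decomposition r d A x a" and T: "reducible_conic r T L1 L2"
    and card: "2 * card (A \<inter> L1) = d + 1" "2 * card (A \<inter> L2) = d + 1" and disj: "L1 \<inter> L2 \<inter> A = {}"
  shows "infinite (computing_sets r d (lspan {x}))"
proof -
  interpret minimal_decomposition r d A x a by (rule min)
  have L: "is_line r L1" "is_line r L2" using T by (auto simp: reducible_conic_def)
  obtain M where M: "is_plane r M" "L1 \<union> L2 \<subseteq> M" using T unfolding reducible_conic_def by blast
  obtain p where p: "p \<in> L1" "p \<in> L2" using coplanar_lines_meet[OF L M] by blast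
  have pA: "p \<notin> A" using p disj by blast
  obtain W1 where W1: "fun_space.subspace W1" "W1 \<subseteq> ambient r" "fun_space.dim W1 = 2" "L1 = {p \<in> Pr r. p \<subseteq> W1}"
    using is_lineE[OF L(1)] .
  obtain W2 where W2: "fun_space.subspace W2" "W2 \<subseteq> ambient r" "fun_space.dim W2 = 2" "L2 = {p \<in> Pr r. p \<subseteq> W2}"
    using is_lineE[OF L(2)] .
  have pPr: "p \<in> Pr r" using p W1(4) by auto
  note rp = rep_Pr[OF pPr]
  have w: "rep p \<in> W1" "rep p \<in> W2"
    using p W1(4) W2(4) point_subset_iff[OF W1(1) pPr] point_subset_iff[OF W2(1) pPr] by auto
  obtain b1 where b1: "b1 \<in> W1" "b1 \<notin> lspan {rep p}" "W1 = lspan {rep p, b1}"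
    by (rule line_complement_vector[OF W1(1,3) w(1) rp(1)])
  obtain b2 where b2: "b2 \<in> W2" "b2 \<notin> lspan {rep p}" "W2 = lspan {rep p, b2}"
    by (rule line_complement_vector[OF W2(1,3) w(2) rp(1)])
  have b: "b1 \<in> ambient r" "b2 \<in> ambient r" using b1(1) b2(1) W1(2) W2(2) by auto
  have on: "q \<in> range (\<lambda>s. lspan {c + fun_scale s (rep p)})"
    if "q \<in> A" "q \<in> Pr r" "q \<subseteq> lspan {rep p, c}" for q c
    using that(1) pA rp(2) by (intro on_affine_line[OF that(2,3)]) auto
  show ?thesis
  proof (rule infinitely_many_on_two_lines[OF min affine_line_curve[OF b(1) rp(3,1) b1(2)] affine_line_curve[OF b(2) rp(3,1) b2(2)]])
    show "A \<inter> L1 \<subseteq> A" "A \<inter> L2 \<subseteq> A" "(A \<inter> L1) \<inter> (A \<inter> L2) = {}" using disj by auto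
    show "d + 1 = 2 * card (A \<inter> L1)" "d + 1 = 2 * card (A \<inter> L2)" using card by simp_all
    show "A \<inter> L1 \<noteq> {}" "A \<inter> L2 \<noteq> {}" using card by auto
    show "A \<inter> L1 \<subseteq> range (\<lambda>s. lspan {b1 + fun_scale s (rep p)})"
      using W1(4) b1(3) by (intro subsetI on) auto
    show "A \<inter> L2 \<subseteq> range (\<lambda>s. lspan {b2 + fun_scale s (rep p)})"
      using W2(4) b2(3) by (intro subsetI on) auto
  qed
qed

text \<open>A shorter decomposition on \<open>T\<close> would also be a shorter decomposition in the whole space.\<close>

lemma (in minimal_decomposition) part_computes_rank_on:
  assumes B: "B \<subseteq> A" "B \<noteq> {}" and T: "T \<subseteq> Pr r"
    and E: "finite E" "E \<subseteq> T" "lspan {part B} \<in> proj_span (veronese r d ` E)" "card E = card B"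
  shows "computes_rank_on r d T (lspan {part B}) E"
proof -
  have sub: "veronese r d ` E \<subseteq> veronese r d ` T" using E(2) by blast
  have "rank_wrt (veronese r d ` T) (lspan {part B}) \<le> card (veronese r d ` E)"
    using E(1,3) sub by (intro rank_wrt_le) auto
  also have "\<dots> \<le> card E" by (rule card_image_le[OF E(1)])
  finally have le: "rank_wrt (veronese r d ` T) (lspan {part B}) \<le> card E" .
  obtain S where S: "finite S" "S \<subseteq> veronese r d ` T" "lspan {part B} \<in> proj_span S"
      "card S = rank_wrt (veronese r d ` T) (lspan {part B})"
    by (rule rank_wrt_attained[OF finite_imageI[OF E(1)] sub E(3)])
  obtain C where C: "C \<subseteq> T" "S = veronese r d ` C" "inj_on (veronese r d) C"
    using S(2) by (meson subset_image_inj)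
  have "finite C" "card C = card S" using C S(1) by (simp_all add: finite_image_iff card_image)
  moreover have "card B \<le> card C"
    using calculation C S(3) T by (intro part_replace(2)[OF B]) auto
  ultimately show ?thesis using E S(4) le by (simp add: computes_rank_on_def)
qed

context two_decompositions
begin

lemma part_eq:
  assumes "Z \<subseteq> T"
  shows "A.part (A \<inter> T) = B.part (B \<inter> T)"
proof -
  have diff: "A - A \<inter> T = A - T" "B - B \<inter> T = B - T" by auto
  have "A.part (A - T) = B.part (B - T)"
    unfolding A.part_def B.part_def
  proof (rule sum.cong)
    show "A - T = B - T" by (rule off_eq[OF assms])
    fix p assume p: "p \<in> B - T"
    then have "p \<in> A - T" using off_eq[OF assms] by simp
    then have "a p = b p" using p assms by (intro coeff_eq_off_Z) auto
    then show "fun_scale (a p) (vero r d p) = fun_scale (b p) (vero r d p)" by simp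
  qed
  moreover have "A.part (A \<inter> T) + A.part (A - T) = B.part (B \<inter> T) + B.part (B - T)"
    using A.part_split[of "A \<inter> T"] B.part_split[of "B \<inter> T"] diff by (metis Int_lower1)
  ultimately show ?thesis by simp
qed

text \<open>The conic and the curve that contains \<open>Z\<close> both carry \<open>d + 1\<close> of the fewer than \<open>3 d / 2\<close> points of \<open>B\<close>,
hence they share five of them once \<open>d \<ge> 4\<close>. Two lines meet a smooth conic in at most four points, and two
different smooth conics do as well.\<close>

lemma smooth_conic_rigid:
  assumes d: "4 \<le> d" and poor: "\<not> has_rich_line r d B"
    and T: "smooth_conic r T" "d + 1 \<le> card (B \<inter> T)"
  shows "Z \<subseteq> T"
proof -
  have overlap: "5 \<le> card (B \<inter> T \<inter> S)" if "d + 1 \<le> card (B \<inter> S)" for S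
  proof -
    have "card (B \<inter> T) + card (B \<inter> S) = card ((B \<inter> T) \<union> (B \<inter> S)) + card ((B \<inter> T) \<inter> (B \<inter> S))"
      using B.finite_A by (intro card_Un_Int) auto
    moreover have "card ((B \<inter> T) \<union> (B \<inter> S)) \<le> card B" using B.finite_A by (intro card_mono) auto
    moreover have "(B \<inter> T) \<inter> (B \<inter> S) = B \<inter> T \<inter> S" by blast
    ultimately show ?thesis using that T(2) d small card_eq by simp
  qed
  from geometry show ?thesis
  proof
    assume "\<exists>L1 L2. is_line r L1 \<and> is_line r L2 \<and> Z \<subseteq> L1 \<union> L2"
    then obtain L1 L2 where L: "is_line r L1" "is_line r L2" "Z \<subseteq> L1 \<union> L2" by blast
    have "5 \<le> card (B \<inter> T \<inter> (L1 \<union> L2))" by (rule overlap) (simp add: two_lines_pattern(3)[OF L poor])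
    also have "B \<inter> T \<inter> (L1 \<union> L2) = (B \<inter> T \<inter> L1) \<union> (B \<inter> T \<inter> L2)" by blast
    also have "card \<dots> \<le> card (B \<inter> T \<inter> L1) + card (B \<inter> T \<inter> L2)" by (rule card_Un_le)
    also have "\<dots> \<le> 2 + 2"
      using B.finite_A
      by (intro add_mono line_meets_smooth_conic_twice[OF T(1) L(1)] line_meets_smooth_conic_twice[OF T(1) L(2)]) auto
    finally show ?thesis by simp
  next
    assume "\<exists>T. smooth_conic r T \<and> Z \<subseteq> T"
    then obtain T' where T': "smooth_conic r T'" "Z \<subseteq> T'" by blast
    have "d + 1 \<le> card (B \<inter> T')" using smooth_conic_pattern(1)[OF T'] card_inter_eq(1)[OF T'(2)] by simp
    then have "5 \<le> card (B \<inter> T \<inter> T')" by (rule overlap)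
    then have "T = T'"
      using B.finite_A by (intro smooth_conic_determined_by_five_points[OF T(1) T'(1), of "B \<inter> T \<inter> T'"]) auto
    then show ?thesis using T'(2) by simp
  qed
qed

lemma reducible_conic_of_two_lines:
  assumes L: "is_line r L1" "is_line r L2" "Z \<subseteq> L1 \<union> L2" and poor: "\<not> has_rich_line r d B"
  shows "reducible_conic r (L1 \<union> L2) L1 L2 \<and> 2 * card (B \<inter> L1) = d + 1 \<and> 2 * card (B \<inter> L2) = d + 1 \<and>
    L1 \<inter> L2 \<inter> B = {}"
  using two_lines_pattern[OF L poor] meeting_lines_coplanar[OF L(1,2)] L(1,2)
  unfolding reducible_conic_def by blast

text \<open>For cubics the smooth conic need not be the same for all decompositions: a general plane cubic has
rank four, and its decompositions do not lie on a common conic. But without rich lines a decomposition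
on a smooth conic consists of four coplanar points, no three of them collinear, and these lie on two
lines in pairs.\<close>

lemma reducible_conic_of_four_points:
  assumes d: "d = 3" and poor: "\<not> has_rich_line r d B" and T: "smooth_conic r T" "Z \<subseteq> T"
  shows "\<exists>L1 L2. reducible_conic r (L1 \<union> L2) L1 L2 \<and> 2 * card (B \<inter> L1) = d + 1 \<and>
    2 * card (B \<inter> L2) = d + 1 \<and> L1 \<inter> L2 \<inter> B = {}"
proof -
  have "4 \<le> card (B \<inter> T)" using smooth_conic_pattern(1)[OF T] card_inter_eq(1)[OF T(2)] d by simp
  moreover have "card B \<le> 4" using small card_eq d by simp
  ultimately have cardB: "card B = 4" "card (B \<inter> T) = card B"
    using card_mono[OF B.finite_A, of "B \<inter> T"] by auto
  then have "B \<inter> T = B" using card_subset_eq[OF B.finite_A Int_lower1] by blast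
  then have BT: "B \<subseteq> T" by blast
  obtain p1 where p1: "p1 \<in> B" using cardB(1) by fastforce
  have "card (B - {p1}) = 3" using cardB(1) p1 B.finite_A by simp
  then obtain p2 p3 p4 where p: "B - {p1} = {p2, p3, p4}" "p2 \<noteq> p3" "p2 \<noteq> p4" "p3 \<noteq> p4"
    unfolding card_3_iff by (elim exE conjE)
  have B_eq: "B = {p1, p2, p3, p4}" unfolding p(1)[symmetric] by (rule insert_Diff[OF p1, symmetric])
  have ne: "p1 \<notin> {p2, p3, p4}" unfolding p(1)[symmetric] by simp
  have PB: "point_set r (rep ` B)" by (rule point_set_rep[OF B.finite_A B.A_Pr])
  define L where "L p q = {s \<in> Pr r. s \<subseteq> lspan {rep p, rep q}}" for p q :: "(nat \<Rightarrow> 'a) set"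
  have line: "is_line r (L p q)" if "p \<in> B" "q \<in> B" "p \<noteq> q" for p q
    unfolding L_def
  proof (rule point_set_line[OF PB])
    show "rep p \<noteq> rep q" using inj_on_rep[of r] that B.A_Pr by (metis inj_onD subsetD)
  qed (use that in auto)
  have mem: "p \<in> L p q" "q \<in> L p q" if "p \<in> B" "q \<in> B" for p q
  proof -
    have "p \<in> Pr r" "q \<in> Pr r" using that B.A_Pr by auto
    then show "p \<in> L p q" "q \<in> L p q"
      unfolding L_def by (simp_all add: point_subset_iff[OF fun_space.subspace_span] fun_space.span_base)
  qed
  have inter: "B \<inter> L p q = {p, q}" if pq: "p \<in> B" "q \<in> B" "p \<noteq> q" for p q
  proof -
    have "\<not> d + 2 \<le> 2 * card (B \<inter> L p q)" using poor line[OF pq] unfolding has_rich_line_def by blast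
    then have "card (B \<inter> L p q) \<le> card {p, q}" using pq d by simp
    moreover have "{p, q} \<subseteq> B \<inter> L p q" using pq mem by blast
    ultimately show ?thesis
      using card_seteq[of "B \<inter> L p q" "{p, q}"] B.finite_A by simp
  qed
  let ?L1 = "L p1 p2" and ?L2 = "L p3 p4"
  have inB: "p1 \<in> B" "p2 \<in> B" "p3 \<in> B" "p4 \<in> B" using B_eq by auto
  have i1: "B \<inter> ?L1 = {p1, p2}" using inB ne by (intro inter) auto
  have i2: "B \<inter> ?L2 = {p3, p4}" using inB p by (intro inter) auto
  have lines: "is_line r ?L1" "is_line r ?L2" using inB ne p by (intro line; simp)+
  have "B \<inter> ?L1 \<noteq> B \<inter> ?L2" unfolding i1 i2 using ne by auto
  then have ne12: "?L1 \<noteq> ?L2" by auto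
  obtain W where W: "fun_space.subspace W" "W \<subseteq> ambient r" "fun_space.dim W = 3" "\<forall>p\<in>T. p \<subseteq> W"
    using T(1) unfolding smooth_conic_def by blast
  have "L p q \<subseteq> {p \<in> Pr r. p \<subseteq> W}" if "p \<in> B" "q \<in> B" for p q
  proof -
    have "p \<in> Pr r" "q \<in> Pr r" "p \<subseteq> W" "q \<subseteq> W" using that B.A_Pr BT W(4) by auto
    then have "rep p \<in> W" "rep q \<in> W" using point_subset_iff[OF W(1)] by auto
    then have "lspan {rep p, rep q} \<subseteq> W" using W(1) by (intro fun_space.span_minimal) auto
    then show ?thesis unfolding L_def by blast
  qed
  then have "?L1 \<union> ?L2 \<subseteq> {p \<in> Pr r. p \<subseteq> W}" using inB by blast
  moreover have "is_plane r {p \<in> Pr r. p \<subseteq> W}"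
    unfolding proj_subspace_def using W(1-3) by (intro exI[of _ W]) simp
  ultimately have "reducible_conic r (?L1 \<union> ?L2) ?L1 ?L2"
    using lines ne12 unfolding reducible_conic_def by blast
  moreover have "2 * card (B \<inter> ?L1) = d + 1" "2 * card (B \<inter> ?L2) = d + 1"
    unfolding i1 i2 using ne p d by auto
  moreover have "?L1 \<inter> ?L2 \<inter> B = (B \<inter> ?L1) \<inter> (B \<inter> ?L2)" by blast
  then have "?L1 \<inter> ?L2 \<inter> B = {}" unfolding i1 i2 using ne p by auto
  ultimately show ?thesis by blast
qed

end

theorem theorem2:
  fixes P :: "((nat \<Rightarrow> nat) \<Rightarrow> 'a::{alg_closed_field, field_char_0}) set"
    and r d t :: nat
  assumes "r \<ge> 2" and "d \<ge> 3"
    and "t > 0" and "real t < 3 * real d / 2"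
    and "P \<in> PN r d" and "sr r d P = t"
  shows "\<not> is_singleton (computing_sets r d P) \<longleftrightarrow>
    (\<forall>A \<in> computing_sets r d P. \<exists>D. is_line r D \<and>
        int (card (A \<inter> D)) \<ge> \<lceil>(real d + 2) / 2\<rceil> \<and>
        (let F = A - (A \<inter> D) in
          \<exists>P\<^sub>D. proj_span (veronese r d ` (A \<inter> D)) \<inter> proj_span ({P} \<union> veronese r d ` F) = {P\<^sub>D} \<and>
            infinite (computing_sets r d P\<^sub>D) \<and>
            (\<forall>E \<in> computing_sets r d P\<^sub>D. E \<inter> F = {} \<and> E \<union> F \<in> computing_sets r d P)))
    \<or>
    (\<forall>A \<in> computing_sets r d P. \<exists>T. smooth_conic r T \<and>
        card (A \<inter> T) \<ge> d + 1 \<and>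
        (let F = A - (A \<inter> T) in
          \<exists>P\<^sub>T. proj_span (veronese r d ` (A \<inter> T)) \<inter> proj_span ({P} \<union> veronese r d ` F) = {P\<^sub>T} \<and>
            infinite (computing_sets r d P\<^sub>T) \<and>
            (\<forall>E \<in> computing_sets r d P\<^sub>T. E \<inter> F = {}) \<and>
            (\<forall>B \<in> computing_sets r d P. \<exists>E'. computes_rank_on r d T P\<^sub>T E' \<and> B = E' \<union> F)))
    \<or>
    (odd d \<and>
      (\<forall>A \<in> computing_sets r d P. \<exists>T L1 L2. reducible_conic r T L1 L2 \<and>
        real (card (A \<inter> L1)) = (real d + 1) / 2 \<and>
        real (card (A \<inter> L2)) = (real d + 1) / 2 \<and>
        L1 \<inter> L2 \<inter> A = {}))"
    (is "_ \<longleftrightarrow> (\<forall>A\<in>?C. ?line A) \<or> (\<forall>A\<in>?C. ?smooth A) \<or> (odd d \<and> (\<forall>A\<in>?C. ?reducible A))")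
proof -
  have "proj_point P" using assms(5) by (simp add: proj_space_def)
  then obtain x where x: "x \<noteq> 0" "P = lspan {x}" by (auto simp: proj_point_iff)
  have decomposition: "\<exists>a. minimal_decomposition r d A x a" if "A \<in> ?C" for A
    using minimal_decomposition_exists[of A r d x] that x by simp
  have half: "real (card S) = (real d + 1) / 2 \<longleftrightarrow> 2 * card S = d + 1" for S :: "(nat \<Rightarrow> 'a) set set"
  proof -
    have "real (card S) = (real d + 1) / 2 \<longleftrightarrow> real (2 * card S) = real (d + 1)" by (auto simp: field_simps)
    then show ?thesis by (simp only: of_nat_eq_iff)
  qed
  show ?thesis
  proof
    assume not_single: "\<not> is_singleton ?C"
    have small: "2 * card A < 3 * d" if "A \<in> ?C" for A
    proof -
      have "real (2 * card A) < real (3 * d)" using that assms(4,6) by (simp add: computing_sets_def)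
      then show ?thesis by (simp only: of_nat_less_iff)
    qed
    have pair: "\<exists>a b. two_decompositions r d A x a B b" if AB: "A \<in> ?C" "B \<in> ?C" "A \<noteq> B" for A B
    proof -
      obtain a b where "minimal_decomposition r d A x a" "minimal_decomposition r d B x b"
        using decomposition AB by blast
      then have "two_decompositions r d A x a B b"
        using AB(3) small[OF AB(1)] by (simp add: two_decompositions_def two_decompositions_axioms_def)
      then show ?thesis by blast
    qed
    have partner: "\<exists>B\<in>?C. B \<noteq> A" if "A \<in> ?C" for A
    proof (rule ccontr)
      assume "\<not> ?thesis"
      then have "?C = {A}" using that by blast
      then show False using not_single by (simp add: is_singleton_def)
    qed
    show "(\<forall>A\<in>?C. ?line A) \<or> (\<forall>A\<in>?C. ?smooth A) \<or> (odd d \<and> (\<forall>A\<in>?C. ?reducible A))"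
    proof (cases "\<forall>A\<in>?C. has_rich_line r d A")
      case True
      have "?line A" if A: "A \<in> ?C" for A
      proof -
        obtain D where D: "is_line r D" "d + 2 \<le> 2 * card (A \<inter> D)"
          using True A unfolding has_rich_line_def by blast
        obtain a where "minimal_decomposition r d A x a" using decomposition[OF A] by blast
        then interpret minimal_decomposition r d A x a .
        have B: "A \<inter> D \<subseteq> A" "A \<inter> D \<noteq> {}" using D(2) by auto
        have "infinite (computing_sets r d (lspan {part (A \<inter> D)}))"
          using D by (intro infinitely_many_on_rich_line[OF part_computing[OF B] part_nonzero[OF B] D(1)]) auto
        then show ?thesis
          using D ceiling_half_le_iff[of d "card (A \<inter> D)"] part_unique[OF B] part_exchange[OF B]
          unfolding Let_def x(2) by (intro exI[of _ D] exI[of _ "lspan {part (A \<inter> D)}"] conjI ballI) simp_all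
      qed
      then show ?thesis by blast
    next
      case False
      then obtain A0 where A0: "A0 \<in> ?C" "\<not> has_rich_line r d A0" by blast
      have poor: "\<not> has_rich_line r d A" if A: "A \<in> ?C" for A
      proof (cases "A = A0")
        case False
        then obtain a b where "two_decompositions r d A x a A0 b" using pair[OF A A0(1)] by blast
        then show ?thesis using two_decompositions.poor_transfer A0(2) by blast
      qed (use A0 in simp)
      define on_smooth where "on_smooth A T \<longleftrightarrow> smooth_conic r T \<and> d + 1 \<le> card (A \<inter> T)"
        for A T :: "(nat \<Rightarrow> 'a) set set"
      \<comment> \<open>For \<open>d = 3\<close> the conic may change with the decomposition; its four points are then split into two pairs.\<close>
      show ?thesis
      proof (cases "4 \<le> d \<and> (\<exists>A\<in>?C. \<exists>T. on_smooth A T)")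
        case True
        then obtain A1 T where A1: "A1 \<in> ?C" "smooth_conic r T" "d + 1 \<le> card (A1 \<inter> T)" and d: "4 \<le> d"
          unfolding on_smooth_def by blast
        have many: "d + 1 \<le> card (A \<inter> T)" if A: "A \<in> ?C" for A
        proof (cases "A = A1")
          case False
          then obtain a b where "two_decompositions r d A x a A1 b" using pair[OF A A1(1)] by blast
          then interpret two_decompositions r d A x a A1 b .
          have "Z \<subseteq> T" by (rule smooth_conic_rigid[OF d poor[OF A1(1)] A1(2,3)])
          then show ?thesis using card_inter_eq(1) A1(3) by simp
        qed (use A1 in simp)
        have "?smooth A" if A: "A \<in> ?C" for A
        proof -
          obtain a where "minimal_decomposition r d A x a" using decomposition[OF A] by blast
          then interpret minimal_decomposition r d A x a .
          let ?F = "A - (A \<inter> T)" and ?Q = "lspan {part (A \<inter> T)}"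
          have card: "d + 1 \<le> card (A \<inter> T)" by (rule many[OF A])
          then have B: "A \<inter> T \<subseteq> A" "A \<inter> T \<noteq> {}" by auto
          have inf: "infinite (computing_sets r d ?Q)"
            using card by (intro infinitely_many_on_smooth_conic[OF part_computing[OF B] part_nonzero[OF B] A1(2)]) auto
          have split: "\<forall>C\<in>?C. \<exists>E'. computes_rank_on r d T ?Q E' \<and> C = E' \<union> ?F"
          proof (intro ballI, goal_cases)
            case (1 C)
            note C = this
            show ?case
            proof (cases "C = A")
              case True
              have "computes_rank_on r d T ?Q (A \<inter> T)"
                using finite_A computing_setsD(3)[OF part_computing[OF B]]
                by (intro part_computes_rank_on[OF B smooth_conic_Pr[OF A1(2)]]) auto
              then show ?thesis using True by blast
            next
              case False
              then obtain c a' where "two_decompositions r d C x c A a'" using pair[OF C A] by blast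
              then interpret pair: two_decompositions r d C x c A a' .
              have ZT: "pair.Z \<subseteq> T" by (rule pair.smooth_conic_rigid[OF d poor[OF A] A1(2) card])
              \<comment> \<open>The coefficients of \<open>A\<close> were chosen anew for this pair; they are unique.\<close>
            have same: "a' p = a p" if "p \<in> A" for p
              proof -
                have "(\<Sum>p\<in>A. fun_scale (a' p - a p) (vero r d p)) = 0"
                  using sum_eq pair.B.sum_eq by (simp add: fun_space.scale_left_diff_distrib sum_subtractf)
                from independent[OF this that] show ?thesis by simp
              qed
              have "pair.B.part (A \<inter> T) = part (A \<inter> T)"
                unfolding pair.B.part_def part_def using same by (intro sum.cong) auto
              then have part: "pair.A.part (C \<inter> T) = part (A \<inter> T)" using pair.part_eq[OF ZT] by simp
              have cardC: "card (C \<inter> T) = card (A \<inter> T)" by (rule pair.card_inter_eq(1)[OF ZT])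
              have BC: "C \<inter> T \<subseteq> C" "C \<inter> T \<noteq> {}" using cardC card by auto
              have "?Q \<in> proj_span (veronese r d ` (C \<inter> T))"
                using computing_setsD(3)[OF pair.A.part_computing[OF BC]] part by simp
              then have "computes_rank_on r d T ?Q (C \<inter> T)"
                using pair.A.finite_A cardC
                by (intro part_computes_rank_on[OF B smooth_conic_Pr[OF A1(2)]]) auto
              moreover have "C = (C \<inter> T) \<union> ?F" using pair.off_eq[OF ZT] by blast
              ultimately show ?thesis by blast
            qed
          qed
          have unique: "proj_span (veronese r d ` (A \<inter> T)) \<inter> proj_span ({P} \<union> veronese r d ` ?F) = {?Q}"
            using part_unique[OF B] unfolding x(2) .
          have disjoint: "\<forall>E\<in>computing_sets r d ?Q. E \<inter> ?F = {}" using part_exchange(1)[OF B] by blast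
          show ?thesis
            unfolding Let_def
            by (intro exI[of _ T] conjI, fact A1(2), fact card, intro exI[of _ ?Q] conjI)
              (fact unique inf disjoint split)+
        qed
        then show ?thesis by blast
      next
        case no_smooth: False
        have pattern: "\<exists>L1 L2. reducible_conic r (L1 \<union> L2) L1 L2 \<and> 2 * card (A \<inter> L1) = d + 1 \<and>
            2 * card (A \<inter> L2) = d + 1 \<and> L1 \<inter> L2 \<inter> A = {}" if A: "A \<in> ?C" for A
        proof -
          obtain B where B: "B \<in> ?C" "B \<noteq> A" using partner[OF A] by blast
          then obtain b a where "two_decompositions r d B x b A a" using pair[OF B(1) A] by blast
          then interpret two_decompositions r d B x b A a .
          from geometry show ?thesis
          proof
            assume "\<exists>L1 L2. is_line r L1 \<and> is_line r L2 \<and> Z \<subseteq> L1 \<union> L2"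
            then show ?thesis using reducible_conic_of_two_lines poor[OF A] by blast
          next
            assume "\<exists>T. smooth_conic r T \<and> Z \<subseteq> T"
            then obtain T where T: "smooth_conic r T" "Z \<subseteq> T" by blast
            have "d = 3"
              using no_smooth T(1) smooth_conic_pattern(1)[OF T] B(1) assms(2) unfolding on_smooth_def by force
            then show ?thesis by (rule reducible_conic_of_four_points[OF _ poor[OF A] T])
          qed
        qed
        have "odd d"
        proof -
          obtain L1 where "2 * card (A0 \<inter> L1) = d + 1" using pattern[OF A0(1)] by blast
          then show ?thesis by presburger
        qed
        moreover have "?reducible A" if A: "A \<in> ?C" for A
          using pattern[OF A] unfolding half by blast
        ultimately show ?thesis by blast
      qed
    qed
  next
    assume cases: "(\<forall>A\<in>?C. ?line A) \<or> (\<forall>A\<in>?C. ?smooth A) \<or> (odd d \<and> (\<forall>A\<in>?C. ?reducible A))"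
    show "\<not> is_singleton ?C"
    proof
      assume "is_singleton ?C"
      then obtain A where C: "?C = {A}" by (auto simp: is_singleton_def)
      then have A: "A \<in> ?C" and fin: "finite (computing_sets r d (lspan {x}))" using x(2) by auto
      obtain a where min: "minimal_decomposition r d A x a" using decomposition[OF A] by blast
      interpret minimal_decomposition r d A x a by (rule min)
      have infinite_part: False
        if "A \<inter> S \<noteq> {}" "proj_span (veronese r d ` (A \<inter> S)) \<inter> proj_span ({P} \<union> veronese r d ` (A - (A \<inter> S))) = {Q}"
          "infinite (computing_sets r d Q)" for S Q
      proof -
        have "Q = lspan {part (A \<inter> S)}"
          using part_unique[of "A \<inter> S"] that(1,2) unfolding x(2) by simp
        then have "infinite (computing_sets r d (lspan {x}))"
          using that(1,3) part_infinite[of "A \<inter> S"] by simp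
        then show False using fin by contradiction
      qed
      from cases consider "?line A" | "?smooth A" | "?reducible A" using A by blast
      then show False
      proof cases
        case 1
        then obtain D Q where D: "\<lceil>(real d + 2) / 2\<rceil> \<le> int (card (A \<inter> D))"
          "proj_span (veronese r d ` (A \<inter> D)) \<inter> proj_span ({P} \<union> veronese r d ` (A - (A \<inter> D))) = {Q}"
          "infinite (computing_sets r d Q)"
          unfolding Let_def by (elim exE conjE) (rule that)
        have "A \<inter> D \<noteq> {}" using D(1) unfolding ceiling_half_le_iff by auto
        then show False using D(2,3) by (rule infinite_part)
      next
        case 2
        then obtain T Q where T: "d + 1 \<le> card (A \<inter> T)"
          "proj_span (veronese r d ` (A \<inter> T)) \<inter> proj_span ({P} \<union> veronese r d ` (A - (A \<inter> T))) = {Q}"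
          "infinite (computing_sets r d Q)"
          unfolding Let_def by (elim exE conjE) (rule that)
        have "A \<inter> T \<noteq> {}" using T(1) by auto
        then show False using T(2,3) by (rule infinite_part)
      next
        case 3
        then obtain T L1 L2 where "reducible_conic r T L1 L2" "2 * card (A \<inter> L1) = d + 1"
          "2 * card (A \<inter> L2) = d + 1" "L1 \<inter> L2 \<inter> A = {}"
          unfolding half by blast
        from infinitely_many_on_reducible_conic[OF min this] show False using fin by contradiction
      qed
    qed
  qed
qed

end
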